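(* Let $K=\mathbb Q(\theta)$ be an algebraic number field with $\theta$ an algebraic integer, let $R$ be the ring of integers of $K$, and let $M=\mathbb Z[\theta]$. Let $G=K\rtimes K^\times$, $D$, $\alpha$ and the generalized Bost–Connes algebra $C^*(\mathcal M)$ be as in the context. If $M=R$, then $C^*(\mathcal M)$ embeds faithfully in the corner $p(D\rtimes_\alpha G)p$, where $p=i_D(\chi_M)$.
   Context: $N=K$ and $M=\mathbb Z[\theta]$ are regarded as additive groups, $H=K^\times$ is the multiplicative group of $K$, and $G=N\rtimes H=K\rtimes K^\times$ is the discrete semidirect product, $H$ acting on $N$ by multiplication. $D$ is the $C^*$-subalgebra of $\ell^\infty(K)$ generated by the characteristic functions $\chi_{x+aM}$, $x\in K$, $a\in K^\times$. For $g=(x,a)\in G$ let $\beta_g(y)=x+ay$ for $y\in K$; the action $\alpha$ of $G$ on $D$ is $\alpha_g(f)=f\circ\beta_{g^{-1}}$. $D\rtimes_\alpha G$ is the full crossed product with canonical map $i_D:D\to D\rtimes_\alpha G$. $M$ (as a subgroup of $G$) is a Hecke subgroup: $L(g):=|M/(M\cap gMg^{-1})|<\infty$ for all $g\in G$. The Hecke algebra $\mathcal M$ of $(G,M)$ is the $*$-algebra of $M$-biinvariant functions $f:G\to\mathbb C$ supported on finitely many double cosets $MgM$, with convolution $(f*h)(x)=\sum_{yM\in G/M}f(y)h(y^{-1}x)$ and involution $f^*(x)=\Delta(x^{-1})\overline{f(x^{-1})}$, where $\Delta(x)=L(x)/L(x^{-1})$. It has a universal enveloping $C^*$-algebra $C^*(\mathcal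 M)$, the Hecke $C^*$-algebra of $(G,M)$, which in this situation is called the generalized Bost–Connes $C^*$-algebra. "Embeds faithfully" means that there is an injective $*$-homomorphism. *)

theory Defs
  imports "HOL-Analysis.Analysis" "HOL-Computational_Algebra.Computational_Algebra"
    "HOL-Algebra.Left_Coset"
begin

section \<open>Complex *-algebras and \<open>C\<^sup>*\<close>-algebras on carriers (no unit assumed)\<close>

record 'a star_alg = "'a partial_object" +
  zero_a :: "'a"  (\<open>\<zero>\<^sub>*\<index>\<close>)
  plus_a :: "'a \<Rightarrow> 'a \<Rightarrow> 'a"  (infixl \<open>\<boxplus>\<index>\<close> 65)
  scale_a :: "complex \<Rightarrow> 'a \<Rightarrow> 'a"  (infixr \<open>\<odot>\<index>\<close> 75)
  times_a :: "'a \<Rightarrow> 'a \<Rightarrow> 'a"  (infixl \<open>\<boxtimes>\<index>\<close> 70)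
  star_a :: "'a \<Rightarrow> 'a"  (\<open>_\<^sup>\<star>\<index>\<close> [1000] 999)

record 'a cstar_alg = "'a star_alg" +
  norm_a :: "'a \<Rightarrow> real"  (\<open>\<parallel>_\<parallel>\<index>\<close> [0] 1000)

definition minus_a :: "('a, 'b) star_alg_scheme \<Rightarrow> 'a \<Rightarrow> 'a \<Rightarrow> 'a"  (infixl \<open>\<boxminus>\<index>\<close> 65) where
  "x \<boxminus>\<^bsub>A\<^esub> y = x \<boxplus>\<^bsub>A\<^esub> (-1) \<odot>\<^bsub>A\<^esub> y"

locale star_algebra =
  fixes A (structure)
  assumes zero_closed [simp]: "\<zero>\<^sub>* \<in> carrier A"
    and plus_closed [simp]: "x \<in> carrier A \<Longrightarrow> y \<in> carrier A \<Longrightarrow> x \<boxplus> y \<in> carrier A"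
    and scale_closed [simp]: "x \<in> carrier A \<Longrightarrow> c \<odot> x \<in> carrier A"
    and times_closed [simp]: "x \<in> carrier A \<Longrightarrow> y \<in> carrier A \<Longrightarrow> x \<boxtimes> y \<in> carrier A"
    and star_closed [simp]: "x \<in> carrier A \<Longrightarrow> x\<^sup>\<star> \<in> carrier A"
    and plus_assoc: "x \<in> carrier A \<Longrightarrow> y \<in> carrier A \<Longrightarrow> z \<in> carrier A \<Longrightarrow>
      x \<boxplus> y \<boxplus> z = x \<boxplus> (y \<boxplus> z)"
    and plus_comm: "x \<in> carrier A \<Longrightarrow> y \<in> carrier A \<Longrightarrow> x \<boxplus> y = y \<boxplus> x"
    and zero_plus: "x \<in> carrier A \<Longrightarrow> \<zero>\<^sub>* \<boxplus> x = x"
    and plus_neg: "x \<in> carrier A \<Longrightarrow> x \<boxplus> (-1) \<odot> x = \<zero>\<^sub>*"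
    and scale_scale: "x \<in> carrier A \<Longrightarrow> c \<odot> d \<odot> x = (c * d) \<odot> x"
    and scale_one: "x \<in> carrier A \<Longrightarrow> 1 \<odot> x = x"
    and scale_add_left: "x \<in> carrier A \<Longrightarrow> (c + d) \<odot> x = c \<odot> x \<boxplus> d \<odot> x"
    and scale_add_right: "x \<in> carrier A \<Longrightarrow> y \<in> carrier A \<Longrightarrow>
      c \<odot> (x \<boxplus> y) = c \<odot> x \<boxplus> c \<odot> y"
    and times_assoc: "x \<in> carrier A \<Longrightarrow> y \<in> carrier A \<Longrightarrow> z \<in> carrier A \<Longrightarrow>
      x \<boxtimes> y \<boxtimes> z = x \<boxtimes> (y \<boxtimes> z)"
    and times_plus_left: "x \<in> carrier A \<Longrightarrow> y \<in> carrier A \<Longrightarrow> z \<in> carrier A \<Longrightarrow>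
      (x \<boxplus> y) \<boxtimes> z = x \<boxtimes> z \<boxplus> y \<boxtimes> z"
    and times_plus_right: "x \<in> carrier A \<Longrightarrow> y \<in> carrier A \<Longrightarrow> z \<in> carrier A \<Longrightarrow>
      z \<boxtimes> (x \<boxplus> y) = z \<boxtimes> x \<boxplus> z \<boxtimes> y"
    and scale_times_left: "x \<in> carrier A \<Longrightarrow> y \<in> carrier A \<Longrightarrow>
      (c \<odot> x) \<boxtimes> y = c \<odot> (x \<boxtimes> y)"
    and scale_times_right: "x \<in> carrier A \<Longrightarrow> y \<in> carrier A \<Longrightarrow>
      x \<boxtimes> (c \<odot> y) = c \<odot> (x \<boxtimes> y)"
    and star_star: "x \<in> carrier A \<Longrightarrow> (x\<^sup>\<star>)\<^sup>\<star> = x"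
    and star_plus: "x \<in> carrier A \<Longrightarrow> y \<in> carrier A \<Longrightarrow> (x \<boxplus> y)\<^sup>\<star> = x\<^sup>\<star> \<boxplus> y\<^sup>\<star>"
    and star_scale: "x \<in> carrier A \<Longrightarrow> (c \<odot> x)\<^sup>\<star> = cnj c \<odot> x\<^sup>\<star>"
    and star_times: "x \<in> carrier A \<Longrightarrow> y \<in> carrier A \<Longrightarrow> (x \<boxtimes> y)\<^sup>\<star> = y\<^sup>\<star> \<boxtimes> x\<^sup>\<star>"

definition cstar_seminorm :: "('a, 'b) star_alg_scheme \<Rightarrow> ('a \<Rightarrow> real) \<Rightarrow> bool" where
  "cstar_seminorm A q \<longleftrightarrow>
     (\<forall>x\<in>carrier A. 0 \<le> q x) \<and>
     (\<forall>x\<in>carrier A. \<forall>y\<in>carrier A. q (x \<boxplus>\<^bsub>A\<^esub> y) \<le> q x + q y) \<and>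
     (\<forall>c. \<forall>x\<in>carrier A. q (c \<odot>\<^bsub>A\<^esub> x) = cmod c * q x) \<and>
     (\<forall>x\<in>carrier A. \<forall>y\<in>carrier A. q (x \<boxtimes>\<^bsub>A\<^esub> y) \<le> q x * q y) \<and>
     (\<forall>x\<in>carrier A. q (x\<^sup>\<star>\<^bsub>A\<^esub> \<boxtimes>\<^bsub>A\<^esub> x) = (q x)\<^sup>2)"

definition cauchy_seqs :: "('a, 'b) star_alg_scheme \<Rightarrow> ('a \<Rightarrow> real) \<Rightarrow> (nat \<Rightarrow> 'a) set" where
  "cauchy_seqs A q = {s. (\<forall>n. s n \<in> carrier A) \<and>
     (\<forall>e>0. \<exists>N. \<forall>m\<ge>N. \<forall>n\<ge>N. q (s m \<boxminus>\<^bsub>A\<^esub> s n) < e)}"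

locale cstar_algebra = star_algebra A for A :: "('a, 'b) cstar_alg_scheme" (structure) +
  assumes norm_cstar_seminorm: "cstar_seminorm A (norm_a A)"
    and norm_eq_0: "x \<in> carrier A \<Longrightarrow> \<parallel>x\<parallel> = 0 \<Longrightarrow> x = \<zero>\<^sub>*"
    and complete: "s \<in> cauchy_seqs A (norm_a A) \<Longrightarrow>
      \<exists>l\<in>carrier A. (\<lambda>n. \<parallel>s n \<boxminus> l\<parallel>) \<longlonglongrightarrow> 0"

definition star_hom ::
  "('a, 'c) star_alg_scheme \<Rightarrow> ('b, 'd) star_alg_scheme \<Rightarrow> ('a \<Rightarrow> 'b) \<Rightarrow> bool" where
  "star_hom A B \<phi> \<longleftrightarrow>
     (\<forall>x\<in>carrier A. \<phi> x \<in> carrier B) \<and>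
     (\<forall>x\<in>carrier A. \<forall>y\<in>carrier A. \<phi> (x \<boxplus>\<^bsub>A\<^esub> y) = \<phi> x \<boxplus>\<^bsub>B\<^esub> \<phi> y) \<and>
     (\<forall>c. \<forall>x\<in>carrier A. \<phi> (c \<odot>\<^bsub>A\<^esub> x) = c \<odot>\<^bsub>B\<^esub> \<phi> x) \<and>
     (\<forall>x\<in>carrier A. \<forall>y\<in>carrier A. \<phi> (x \<boxtimes>\<^bsub>A\<^esub> y) = \<phi> x \<boxtimes>\<^bsub>B\<^esub> \<phi> y) \<and>
     (\<forall>x\<in>carrier A. \<phi> (x\<^sup>\<star>\<^bsub>A\<^esub>) = (\<phi> x)\<^sup>\<star>\<^bsub>B\<^esub>)"

definition corner :: "('a, 'b) star_alg_scheme \<Rightarrow> 'a \<Rightarrow> ('a, 'b) star_alg_scheme" where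
  "corner A p = A\<lparr>carrier := {p \<boxtimes>\<^bsub>A\<^esub> x \<boxtimes>\<^bsub>A\<^esub> p | x. x \<in> carrier A}\<rparr>"

definition cstar_subalgebra :: "('a, 'b) cstar_alg_scheme \<Rightarrow> 'a set \<Rightarrow> bool" where
  "cstar_subalgebra A S \<longleftrightarrow> S \<subseteq> carrier A \<and> \<zero>\<^sub>*\<^bsub>A\<^esub> \<in> S \<and>
     (\<forall>x\<in>S. \<forall>y\<in>S. x \<boxplus>\<^bsub>A\<^esub> y \<in> S) \<and> (\<forall>c. \<forall>x\<in>S. c \<odot>\<^bsub>A\<^esub> x \<in> S) \<and>
     (\<forall>x\<in>S. \<forall>y\<in>S. x \<boxtimes>\<^bsub>A\<^esub> y \<in> S) \<and> (\<forall>x\<in>S. x\<^sup>\<star>\<^bsub>A\<^esub> \<in> S) \<and>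
     (\<forall>s l. (\<forall>n. s n \<in> S) \<longrightarrow> l \<in> carrier A \<longrightarrow>
        (\<lambda>n::nat. \<parallel>s n \<boxminus>\<^bsub>A\<^esub> l\<parallel>\<^bsub>A\<^esub>) \<longlonglongrightarrow> 0 \<longrightarrow> l \<in> S)"

definition cstar_generated :: "('a, 'b) cstar_alg_scheme \<Rightarrow> 'a set \<Rightarrow> 'a set" where
  "cstar_generated A X = \<Inter>{S. cstar_subalgebra A S \<and> X \<subseteq> S}"

section \<open>The enveloping \<open>C\<^sup>*\<close>-algebra of a *-algebra\<close>

text \<open>
  The enveloping \<open>C\<^sup>*\<close>-algebra is the Hausdorff completion in the largest \<open>C\<^sup>*\<close>-seminorm.  The
  functions \<open>x \<mapsto> \<parallel>\<pi>(x)\<parallel>\<close>, for \<open>\<pi>\<close> a *-homomorphism into a \<open>C\<^sup>*\<close>-algebra (or a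
  *-representation on a Hilbert space), are exactly the \<open>C\<^sup>*\<close>-seminorms; quantifying over
  seminorms avoids a quantification over all types.  The construction is meaningful when the
  supremum is finite; then it is a \<open>C\<^sup>*\<close>-algebra with the expected universal property, for
  target \<open>C\<^sup>*\<close>-algebras on arbitrary types (\<open>env_cstar_cstar_algebra\<close>,
  \<open>env_cstar_universal\<close> below).
\<close>

definition env_norm :: "('a, 'b) star_alg_scheme \<Rightarrow> 'a \<Rightarrow> real" where
  "env_norm A x = (SUP q\<in>{q. cstar_seminorm A q}. q x)"

definition env_finite :: "('a, 'b) star_alg_scheme \<Rightarrow> bool" where
  "env_finite A \<longleftrightarrow> (\<forall>x\<in>carrier A. bdd_above ((\<lambda>q. q x) ` {q. cstar_seminorm A q}))"

definition null_rel ::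
  "('a, 'b) star_alg_scheme \<Rightarrow> ('a \<Rightarrow> real) \<Rightarrow> ((nat \<Rightarrow> 'a) \<times> (nat \<Rightarrow> 'a)) set" where
  "null_rel A q = {(s, t). s \<in> cauchy_seqs A q \<and> t \<in> cauchy_seqs A q \<and>
     (\<lambda>n. q (s n \<boxminus>\<^bsub>A\<^esub> t n)) \<longlonglongrightarrow> 0}"

definition cls :: "('a, 'b) star_alg_scheme \<Rightarrow> ('a \<Rightarrow> real) \<Rightarrow> (nat \<Rightarrow> 'a) \<Rightarrow> (nat \<Rightarrow> 'a) set" where
  "cls A q s = null_rel A q `` {s}"

definition rep :: "(nat \<Rightarrow> 'a) set \<Rightarrow> nat \<Rightarrow> 'a" where
  "rep X = (SOME s. s \<in> X)"

definition completion ::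
  "('a, 'b) star_alg_scheme \<Rightarrow> ('a \<Rightarrow> real) \<Rightarrow> (nat \<Rightarrow> 'a) set cstar_alg" where
  "completion A q =
     \<lparr>carrier = cauchy_seqs A q // null_rel A q,
      zero_a = cls A q (\<lambda>n. \<zero>\<^sub>*\<^bsub>A\<^esub>),
      plus_a = (\<lambda>X Y. cls A q (\<lambda>n. rep X n \<boxplus>\<^bsub>A\<^esub> rep Y n)),
      scale_a = (\<lambda>c X. cls A q (\<lambda>n. c \<odot>\<^bsub>A\<^esub> rep X n)),
      times_a = (\<lambda>X Y. cls A q (\<lambda>n. rep X n \<boxtimes>\<^bsub>A\<^esub> rep Y n)),
      star_a = (\<lambda>X. cls A q (\<lambda>n. (rep X n)\<^sup>\<star>\<^bsub>A\<^esub>)),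
      norm_a = (\<lambda>X. lim (\<lambda>n. q (rep X n)))\<rparr>"

definition env_cstar :: "('a, 'b) star_alg_scheme \<Rightarrow> (nat \<Rightarrow> 'a) set cstar_alg" where
  "env_cstar A = completion A (env_norm A)"

definition env_map :: "('a, 'b) star_alg_scheme \<Rightarrow> 'a \<Rightarrow> (nat \<Rightarrow> 'a) set" where
  "env_map A x = cls A (env_norm A) (\<lambda>n. x)"

lemma tendsto_zero_dominated:
  fixes f g :: "nat \<Rightarrow> real"
  assumes "g \<longlonglongrightarrow> 0" "\<And>n. 0 \<le> f n" "\<And>n. f n \<le> g n"
  shows "f \<longlonglongrightarrow> 0"
  by (rule tendsto_sandwich[OF _ _ tendsto_const assms(1)]) (auto simp: assms)

context star_algebra
begin

lemma plus_left_comm: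
  "x \<in> carrier A \<Longrightarrow> y \<in> carrier A \<Longrightarrow> z \<in> carrier A \<Longrightarrow> x \<boxplus> (y \<boxplus> z) = y \<boxplus> (x \<boxplus> z)"
  by (metis plus_assoc plus_comm)

lemma plus_zero: "x \<in> carrier A \<Longrightarrow> x \<boxplus> \<zero>\<^sub>* = x"
  by (metis plus_comm zero_closed zero_plus)

lemma neg_plus: "x \<in> carrier A \<Longrightarrow> (-1) \<odot> x \<boxplus> x = \<zero>\<^sub>*"
  by (metis plus_comm scale_closed plus_neg)

lemma scale_0: "x \<in> carrier A \<Longrightarrow> 0 \<odot> x = \<zero>\<^sub>*"
  using scale_add_left[of x 1 "-1"] by (simp add: scale_one plus_neg)

lemma minus_closed [simp]: "x \<in> carrier A \<Longrightarrow> y \<in> carrier A \<Longrightarrow> x \<boxminus> y \<in> carrier A"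
  by (simp add: minus_a_def)

lemma minus_self: "x \<in> carrier A \<Longrightarrow> x \<boxminus> x = \<zero>\<^sub>*"
  by (simp add: minus_a_def plus_neg)

lemma minus_zero: "x \<in> carrier A \<Longrightarrow> x \<boxminus> \<zero>\<^sub>* = x"
  by (metis minus_a_def plus_neg plus_zero scale_closed zero_closed zero_plus)

lemma minus_plus_cancel: "x \<in> carrier A \<Longrightarrow> y \<in> carrier A \<Longrightarrow> (x \<boxminus> y) \<boxplus> y = x"
  by (simp add: minus_a_def plus_assoc neg_plus plus_zero)

lemma minus_split:
  assumes "x \<in> carrier A" "y \<in> carrier A" "z \<in> carrier A"
  shows "x \<boxminus> z = (x \<boxminus> y) \<boxplus> (y \<boxminus> z)"
proof -
  have "(x \<boxminus> y) \<boxplus> (y \<boxminus> z) = ((x \<boxminus> y) \<boxplus> y) \<boxplus> (-1) \<odot> z"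
    using assms by (simp add: minus_a_def plus_assoc)
  with assms show ?thesis by (simp add: minus_plus_cancel) (simp add: minus_a_def)
qed

lemma minus_flip: "x \<in> carrier A \<Longrightarrow> y \<in> carrier A \<Longrightarrow> y \<boxminus> x = (-1) \<odot> (x \<boxminus> y)"
  by (simp add: minus_a_def scale_add_right scale_scale scale_one plus_comm)

lemma plus_minus_plus:
  "x \<in> carrier A \<Longrightarrow> y \<in> carrier A \<Longrightarrow> x' \<in> carrier A \<Longrightarrow> y' \<in> carrier A \<Longrightarrow>
    (x \<boxplus> y) \<boxminus> (x' \<boxplus> y') = (x \<boxminus> x') \<boxplus> (y \<boxminus> y')"
  by (simp add: minus_a_def scale_add_right plus_assoc plus_left_comm)

lemma scale_minus_scale:
  "x \<in> carrier A \<Longrightarrow> y \<in> carrier A \<Longrightarrow> c \<odot> x \<boxminus> c \<odot> y = c \<odot> (x \<boxminus> y)"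
  by (simp add: minus_a_def scale_add_right scale_scale mult.commute)

lemma star_minus_star:
  "x \<in> carrier A \<Longrightarrow> y \<in> carrier A \<Longrightarrow> x\<^sup>\<star> \<boxminus> y\<^sup>\<star> = (x \<boxminus> y)\<^sup>\<star>"
  by (simp add: minus_a_def star_plus star_scale)

lemma times_minus_times:
  assumes "x \<in> carrier A" "y \<in> carrier A" "x' \<in> carrier A" "y' \<in> carrier A"
  shows "x \<boxtimes> y \<boxminus> x' \<boxtimes> y' = (x \<boxminus> x') \<boxtimes> y \<boxplus> x' \<boxtimes> (y \<boxminus> y')"
proof -
  have "(x \<boxminus> x') \<boxtimes> y = x \<boxtimes> y \<boxminus> x' \<boxtimes> y" "x' \<boxtimes> (y \<boxminus> y') = x' \<boxtimes> y \<boxminus> x' \<boxtimes> y'"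
    using assms by (simp_all add: minus_a_def times_plus_left times_plus_right
        scale_times_left scale_times_right)
  then show ?thesis using minus_split[of "x \<boxtimes> y" "x' \<boxtimes> y" "x' \<boxtimes> y'"] assms by simp
qed

end

locale seminormed_star_algebra = star_algebra +
  fixes q :: "'a \<Rightarrow> real"
  assumes seminorm: "cstar_seminorm A q"
begin

lemma q_nonneg: "x \<in> carrier A \<Longrightarrow> 0 \<le> q x"
  and q_triangle: "x \<in> carrier A \<Longrightarrow> y \<in> carrier A \<Longrightarrow> q (x \<boxplus> y) \<le> q x + q y"
  and q_scale: "x \<in> carrier A \<Longrightarrow> q (c \<odot> x) = cmod c * q x"
  and q_times: "x \<in> carrier A \<Longrightarrow> y \<in> carrier A \<Longrightarrow> q (x \<boxtimes> y) \<le> q x * q y"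
  and q_cstar: "x \<in> carrier A \<Longrightarrow> q (x\<^sup>\<star> \<boxtimes> x) = (q x)\<^sup>2"
  using seminorm by (auto simp: cstar_seminorm_def)

lemma q_zero [simp]: "q \<zero>\<^sub>* = 0"
  using q_scale[of "\<zero>\<^sub>*" 0] by (simp add: scale_0)

lemma q_star_le: "x \<in> carrier A \<Longrightarrow> q x \<le> q (x\<^sup>\<star>)"
proof (cases "q x = 0")
  assume x: "x \<in> carrier A" and "q x \<noteq> 0"
  then have "0 < q x" using q_nonneg[OF x] by simp
  moreover have "q x * q x \<le> q (x\<^sup>\<star>) * q x"
    using q_cstar[OF x] q_times[of "x\<^sup>\<star>" x] x by (simp add: power2_eq_square)
  ultimately show ?thesis by simp
qed (simp add: q_nonneg)

lemma q_star: "x \<in> carrier A \<Longrightarrow> q (x\<^sup>\<star>) = q x"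
  using q_star_le[of x] q_star_le[of "x\<^sup>\<star>"] by (simp add: star_star)

lemma q_flip: "x \<in> carrier A \<Longrightarrow> y \<in> carrier A \<Longrightarrow> q (y \<boxminus> x) = q (x \<boxminus> y)"
  by (simp add: minus_flip[of x y] q_scale)

lemma q_minus_triangle:
  "x \<in> carrier A \<Longrightarrow> y \<in> carrier A \<Longrightarrow> z \<in> carrier A \<Longrightarrow> q (x \<boxminus> z) \<le> q (x \<boxminus> y) + q (y \<boxminus> z)"
  by (simp add: minus_split[of x y z] q_triangle)

lemma q_diff:
  assumes "x \<in> carrier A" "y \<in> carrier A"
  shows "\<bar>q x - q y\<bar> \<le> q (x \<boxminus> y)"
proof -
  have "q x \<le> q (x \<boxminus> y) + q y" "q y \<le> q (y \<boxminus> x) + q x"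
    using q_triangle[of "x \<boxminus> y" y] q_triangle[of "y \<boxminus> x" x] assms
    by (simp_all add: minus_plus_cancel)
  moreover have "q (y \<boxminus> x) = q (x \<boxminus> y)" using assms by (rule q_flip)
  ultimately show ?thesis by linarith
qed

abbreviation "C \<equiv> cauchy_seqs A q"

lemma C_carrier: "s \<in> C \<Longrightarrow> s n \<in> carrier A"
  by (simp add: cauchy_seqs_def)

lemma C_D: "s \<in> C \<Longrightarrow> 0 < e \<Longrightarrow> \<exists>N. \<forall>m\<ge>N. \<forall>n\<ge>N. q (s m \<boxminus> s n) < e"
  by (simp add: cauchy_seqs_def)

lemma C_I:
  assumes "\<And>n. s n \<in> carrier A" "\<And>e. 0 < e \<Longrightarrow> \<exists>N. \<forall>m\<ge>N. \<forall>n\<ge>N. q (s m \<boxminus> s n) < e"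
  shows "s \<in> C"
  using assms by (auto simp: cauchy_seqs_def)

lemma C_const: "x \<in> carrier A \<Longrightarrow> (\<lambda>n. x) \<in> C"
  by (auto simp: cauchy_seqs_def minus_self)

lemma C_norm_Cauchy:
  assumes "s \<in> C" shows "Cauchy (\<lambda>n. q (s n))"
proof (rule metric_CauchyI)
  fix e :: real assume "0 < e"
  then obtain N where N: "\<forall>m\<ge>N. \<forall>n\<ge>N. q (s m \<boxminus> s n) < e" using C_D[OF assms] by blast
  show "\<exists>M. \<forall>m\<ge>M. \<forall>n\<ge>M. dist (q (s m)) (q (s n)) < e"
  proof (intro exI allI impI)
    fix m n assume "N \<le> m" "N \<le> n"
    then have "q (s m \<boxminus> s n) < e" using N by blast
    moreover have "\<bar>q (s m) - q (s n)\<bar> \<le> q (s m \<boxminus> s n)" using C_carrier[OF assms] by (intro q_diff)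
    ultimately show "dist (q (s m)) (q (s n)) < e" by (simp add: dist_real_def)
  qed
qed

lemma C_norm_lim: "s \<in> C \<Longrightarrow> (\<lambda>n. q (s n)) \<longlonglongrightarrow> lim (\<lambda>n. q (s n))"
  using C_norm_Cauchy Cauchy_convergent convergent_LIMSEQ_iff by blast

lemma C_bounded:
  assumes "s \<in> C" obtains B where "0 < B" "\<And>n. q (s n) \<le> B"
proof -
  have "Bseq (\<lambda>n. q (s n))" using C_norm_Cauchy[OF assms] Cauchy_Bseq by blast
  then obtain B where "0 < B" "\<And>n. \<bar>q (s n)\<bar> \<le> B" by (auto simp: Bseq_def)
  then show ?thesis using that by (meson abs_le_D1)
qed

lemma C_dominated:
  assumes s: "s \<in> C" and t: "t \<in> C" and u: "\<And>n. u n \<in> carrier A" and B: "0 < B"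
    and le: "\<And>m n. q (u m \<boxminus> u n) \<le> B * q (s m \<boxminus> s n) + B * q (t m \<boxminus> t n)"
  shows "u \<in> C"
proof (rule C_I[OF u])
  fix e :: real assume "0 < e"
  then have e: "0 < e / (2 * B)" using B by simp
  obtain N where N: "\<forall>m\<ge>N. \<forall>n\<ge>N. q (s m \<boxminus> s n) < e / (2 * B)" using C_D[OF s e] by blast
  obtain N' where N': "\<forall>m\<ge>N'. \<forall>n\<ge>N'. q (t m \<boxminus> t n) < e / (2 * B)" using C_D[OF t e] by blast
  show "\<exists>N. \<forall>m\<ge>N. \<forall>n\<ge>N. q (u m \<boxminus> u n) < e"
  proof (intro exI allI impI)
    fix m n assume "max N N' \<le> m" "max N N' \<le> n"
    then have "q (s m \<boxminus> s n) < e / (2 * B)" "q (t m \<boxminus> t n) < e / (2 * B)" using N N' by auto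
    then have "B * q (s m \<boxminus> s n) < e / 2" "B * q (t m \<boxminus> t n) < e / 2"
      using B by (simp_all add: field_simps)
    then show "q (u m \<boxminus> u n) < e" using le[of m n] by linarith
  qed
qed

lemma q_times_minus:
  assumes "x \<in> carrier A" "y \<in> carrier A" "x' \<in> carrier A" "y' \<in> carrier A"
    "q y \<le> B" "q x' \<le> B"
  shows "q (x \<boxtimes> y \<boxminus> x' \<boxtimes> y') \<le> B * q (x \<boxminus> x') + B * q (y \<boxminus> y')"
proof -
  have "q (x \<boxtimes> y \<boxminus> x' \<boxtimes> y') \<le> q ((x \<boxminus> x') \<boxtimes> y) + q (x' \<boxtimes> (y \<boxminus> y'))"
    using assms by (simp add: times_minus_times q_triangle)
  also have "\<dots> \<le> q (x \<boxminus> x') * q y + q x' * q (y \<boxminus> y')"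
    using assms by (intro add_mono q_times) auto
  also have "\<dots> \<le> q (x \<boxminus> x') * B + B * q (y \<boxminus> y')"
    using assms by (intro add_mono mult_mono) (auto simp: q_nonneg order_trans[OF q_nonneg])
  finally show ?thesis by (simp add: mult.commute)
qed

lemma q_plus_minus:
  assumes "x \<in> carrier A" "y \<in> carrier A" "x' \<in> carrier A" "y' \<in> carrier A"
  shows "q ((x \<boxplus> y) \<boxminus> (x' \<boxplus> y')) \<le> q (x \<boxminus> x') + q (y \<boxminus> y')"
  using assms by (simp add: plus_minus_plus q_triangle)

lemma C_plus:
  assumes s: "s \<in> C" and t: "t \<in> C" shows "(\<lambda>n. s n \<boxplus> t n) \<in> C"
  by (rule C_dominated[OF s t, where B = 1]) (simp_all add: q_plus_minus C_carrier[OF s] C_carrier[OF t])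

lemma C_scale:
  assumes s: "s \<in> C" shows "(\<lambda>n. c \<odot> s n) \<in> C"
  by (rule C_dominated[OF s s, where B = "cmod c + 1"])
    (simp_all add: C_carrier[OF s] scale_minus_scale q_scale algebra_simps q_nonneg add_pos_nonneg)

lemma C_star:
  assumes s: "s \<in> C" shows "(\<lambda>n. (s n)\<^sup>\<star>) \<in> C"
  by (rule C_dominated[OF s s, where B = 1])
    (simp_all add: C_carrier[OF s] star_minus_star q_star q_nonneg)

lemma C_times:
  assumes s: "s \<in> C" and t: "t \<in> C" shows "(\<lambda>n. s n \<boxtimes> t n) \<in> C"
proof -
  obtain B where B: "0 < B" "\<And>n. q (s n) \<le> B" using C_bounded[OF s] by blast
  obtain B' where B': "0 < B'" "\<And>n. q (t n) \<le> B'" using C_bounded[OF t] by blast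
  have "q (s n) \<le> max B B'" "q (t n) \<le> max B B'" for n
    using B(2)[of n] B'(2)[of n] by auto
  then show ?thesis
    using B(1) by (intro C_dominated[OF s t, where B = "max B B'"] q_times_minus)
      (simp_all add: C_carrier[OF s] C_carrier[OF t])
qed

lemma C_minus: "s \<in> C \<Longrightarrow> t \<in> C \<Longrightarrow> (\<lambda>n. s n \<boxminus> t n) \<in> C"
  unfolding minus_a_def by (intro C_plus C_scale)

lemma null_equiv: "equiv C (null_rel A q)"
proof (rule equivI)
  show "null_rel A q \<subseteq> C \<times> C" by (auto simp: null_rel_def)
  show "refl_on C (null_rel A q)"
  proof (rule refl_onI)
    fix s assume s: "s \<in> C"
    then show "(s, s) \<in> null_rel A q" by (simp add: null_rel_def minus_self C_carrier[OF s])
  qed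
  show "sym (null_rel A q)"
  proof (rule symI)
    fix s t assume st: "(s, t) \<in> null_rel A q"
    then have "s \<in> C" "t \<in> C" by (auto simp: null_rel_def)
    then have "q (t n \<boxminus> s n) = q (s n \<boxminus> t n)" for n by (intro q_flip C_carrier)
    with st show "(t, s) \<in> null_rel A q" by (simp add: null_rel_def)
  qed
  show "trans (null_rel A q)"
  proof (rule transI)
    fix s t u assume st: "(s, t) \<in> null_rel A q" "(t, u) \<in> null_rel A q"
    then have C: "s \<in> C" "t \<in> C" "u \<in> C" by (auto simp: null_rel_def)
    have "(\<lambda>n. q (s n \<boxminus> t n) + q (t n \<boxminus> u n)) \<longlonglongrightarrow> 0 + 0"
      using st by (intro tendsto_add) (auto simp: null_rel_def)
    then have "(\<lambda>n. q (s n \<boxminus> t n) + q (t n \<boxminus> u n)) \<longlonglongrightarrow> 0" by simp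
    then have "(\<lambda>n. q (s n \<boxminus> u n)) \<longlonglongrightarrow> 0"
      by (rule tendsto_zero_dominated)
        (simp_all add: q_nonneg q_minus_triangle C_carrier[OF C(1)] C_carrier[OF C(2)] C_carrier[OF C(3)])
    with C show "(s, u) \<in> null_rel A q" by (simp add: null_rel_def)
  qed
qed

lemma null_dominated:
  assumes "(s, s') \<in> null_rel A q" "(t, t') \<in> null_rel A q" and u: "u \<in> C" and u': "u' \<in> C"
    and le: "\<And>n. q (u n \<boxminus> u' n) \<le> B * q (s n \<boxminus> s' n) + B * q (t n \<boxminus> t' n)"
  shows "(u, u') \<in> null_rel A q"
proof -
  have "(\<lambda>n. B * q (s n \<boxminus> s' n) + B * q (t n \<boxminus> t' n)) \<longlonglongrightarrow> B * 0 + B * 0"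
    using assms(1,2) by (intro tendsto_add tendsto_mult tendsto_const) (simp_all add: null_rel_def)
  then have "(\<lambda>n. B * q (s n \<boxminus> s' n) + B * q (t n \<boxminus> t' n)) \<longlonglongrightarrow> 0" by simp
  then have "(\<lambda>n. q (u n \<boxminus> u' n)) \<longlonglongrightarrow> 0"
    by (rule tendsto_zero_dominated) (simp_all add: q_nonneg C_carrier[OF u] C_carrier[OF u'] le)
  with u u' show ?thesis by (simp add: null_rel_def)
qed

lemma null_C: "(s, t) \<in> null_rel A q \<Longrightarrow> s \<in> C" "(s, t) \<in> null_rel A q \<Longrightarrow> t \<in> C"
  by (auto simp: null_rel_def)

lemma null_plus:
  assumes s: "(s, s') \<in> null_rel A q" and t: "(t, t') \<in> null_rel A q"
  shows "((\<lambda>n. s n \<boxplus> t n), (\<lambda>n. s' n \<boxplus> t' n)) \<in> null_rel A q"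
proof (rule null_dominated[OF s t, where B = 1])
  note C = null_C[OF s] null_C[OF t]
  show "(\<lambda>n. s n \<boxplus> t n) \<in> C" "(\<lambda>n. s' n \<boxplus> t' n) \<in> C" using C by (auto intro: C_plus)
  show "q (s n \<boxplus> t n \<boxminus> (s' n \<boxplus> t' n)) \<le> 1 * q (s n \<boxminus> s' n) + 1 * q (t n \<boxminus> t' n)" for n
    using q_plus_minus[of "s n" "t n" "s' n" "t' n"] C[THEN C_carrier, of n] by simp
qed

lemma null_scale:
  assumes s: "(s, s') \<in> null_rel A q"
  shows "((\<lambda>n. c \<odot> s n), (\<lambda>n. c \<odot> s' n)) \<in> null_rel A q"
proof (rule null_dominated[OF s s, where B = "cmod c"])
  note C = null_C[OF s]
  show "(\<lambda>n. c \<odot> s n) \<in> C" "(\<lambda>n. c \<odot> s' n) \<in> C" using C by (auto intro: C_scale)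
  show "q (c \<odot> s n \<boxminus> c \<odot> s' n) \<le> cmod c * q (s n \<boxminus> s' n) + cmod c * q (s n \<boxminus> s' n)" for n
    using C[THEN C_carrier, of n] by (simp add: scale_minus_scale q_scale q_nonneg)
qed

lemma null_star:
  assumes s: "(s, s') \<in> null_rel A q"
  shows "((\<lambda>n. (s n)\<^sup>\<star>), (\<lambda>n. (s' n)\<^sup>\<star>)) \<in> null_rel A q"
proof (rule null_dominated[OF s s, where B = 1])
  note C = null_C[OF s]
  show "(\<lambda>n. (s n)\<^sup>\<star>) \<in> C" "(\<lambda>n. (s' n)\<^sup>\<star>) \<in> C" using C by (auto intro: C_star)
  show "q ((s n)\<^sup>\<star> \<boxminus> (s' n)\<^sup>\<star>) \<le> 1 * q (s n \<boxminus> s' n) + 1 * q (s n \<boxminus> s' n)" for n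
    using C[THEN C_carrier, of n] by (simp add: star_minus_star q_star q_nonneg)
qed

lemma null_times:
  assumes s: "(s, s') \<in> null_rel A q" and t: "(t, t') \<in> null_rel A q"
  shows "((\<lambda>n. s n \<boxtimes> t n), (\<lambda>n. s' n \<boxtimes> t' n)) \<in> null_rel A q"
proof -
  have C: "s \<in> C" "s' \<in> C" "t \<in> C" "t' \<in> C" using s t null_C by blast+
  obtain B where B: "0 < B" "\<And>n. q (s' n) \<le> B" using C_bounded[OF C(2)] by blast
  obtain B' where B': "0 < B'" "\<And>n. q (t n) \<le> B'" using C_bounded[OF C(3)] by blast
  have "q (s' n) \<le> max B B'" "q (t n) \<le> max B B'" for n
    using B(2)[of n] B'(2)[of n] by auto
  then show ?thesis
    using C by (intro null_dominated[OF s t, where B = "max B B'"] C_times q_times_minus)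
      (simp_all add: C[THEN C_carrier])
qed

abbreviation "E \<equiv> completion A q"
abbreviation "cl \<equiv> cls A q"

lemma cl_eq: "(s, t) \<in> null_rel A q \<Longrightarrow> cl s = cl t"
  unfolding cls_def using equiv_class_eq[OF null_equiv] .

lemma cl_eqD: "cl s = cl t \<Longrightarrow> t \<in> C \<Longrightarrow> (s, t) \<in> null_rel A q"
  unfolding cls_def using eq_equiv_class[OF _ null_equiv] by blast

lemma cl_carrier: "s \<in> C \<Longrightarrow> cl s \<in> carrier E"
  by (simp add: completion_def cls_def quotientI)

lemma E_cases: assumes "X \<in> carrier E" obtains s where "s \<in> C" "X = cl s"
  using assms by (auto simp: completion_def cls_def elim: quotientE)

lemma rep_cl:
  assumes "s \<in> C" shows "(rep (cl s), s) \<in> null_rel A q"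
proof -
  have "s \<in> cl s" unfolding cls_def using equiv_class_self[OF null_equiv assms] .
  then have "rep (cl s) \<in> cl s" unfolding rep_def by (rule someI[of "\<lambda>t. t \<in> cl s"])
  then have "(s, rep (cl s)) \<in> null_rel A q" by (simp add: cls_def)
  then show ?thesis using null_equiv by (meson equivE symE)
qed

lemma E_zero: "\<zero>\<^sub>*\<^bsub>E\<^esub> = cl (\<lambda>n. \<zero>\<^sub>*)"
  by (simp add: completion_def)

lemma E_plus: "s \<in> C \<Longrightarrow> t \<in> C \<Longrightarrow> cl s \<boxplus>\<^bsub>E\<^esub> cl t = cl (\<lambda>n. s n \<boxplus> t n)"
  by (simp add: completion_def cl_eq null_plus rep_cl)

lemma E_scale: "s \<in> C \<Longrightarrow> c \<odot>\<^bsub>E\<^esub> cl s = cl (\<lambda>n. c \<odot> s n)"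
  by (simp add: completion_def cl_eq null_scale rep_cl)

lemma E_times: "s \<in> C \<Longrightarrow> t \<in> C \<Longrightarrow> cl s \<boxtimes>\<^bsub>E\<^esub> cl t = cl (\<lambda>n. s n \<boxtimes> t n)"
  by (simp add: completion_def cl_eq null_times rep_cl)

lemma E_star: "s \<in> C \<Longrightarrow> (cl s)\<^sup>\<star>\<^bsub>E\<^esub> = cl (\<lambda>n. (s n)\<^sup>\<star>)"
  by (simp add: completion_def cl_eq null_star rep_cl)

lemma E_minus: "s \<in> C \<Longrightarrow> t \<in> C \<Longrightarrow> cl s \<boxminus>\<^bsub>E\<^esub> cl t = cl (\<lambda>n. s n \<boxminus> t n)"
  by (simp add: minus_a_def E_scale E_plus C_scale)

lemma E_norm: assumes "s \<in> C" shows "(\<lambda>n. q (s n)) \<longlonglongrightarrow> \<parallel>cl s\<parallel>\<^bsub>E\<^esub>"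
proof -
  let ?r = "rep (cl s)"
  have r: "(?r, s) \<in> null_rel A q" using rep_cl[OF assms] .
  then have rC: "?r \<in> C" using null_C by blast
  have "(\<lambda>n. q (s n) - q (?r n)) \<longlonglongrightarrow> 0"
  proof (rule tendsto_rabs_zero_cancel, rule tendsto_zero_dominated)
    show "(\<lambda>n. q (?r n \<boxminus> s n)) \<longlonglongrightarrow> 0" using r by (simp add: null_rel_def)
    show "\<bar>q (s n) - q (?r n)\<bar> \<le> q (?r n \<boxminus> s n)" for n
      using q_diff[OF C_carrier[OF assms] C_carrier[OF rC]] q_flip[OF C_carrier[OF assms] C_carrier[OF rC]]
      by metis
  qed simp
  from tendsto_add[OF this C_norm_lim[OF rC]] show ?thesis by (simp add: completion_def)
qed

lemma E_star_algebra: "star_algebra E"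
proof (unfold_locales, goal_cases)
  case 1 then show ?case by (simp add: E_zero cl_carrier C_const)
next
  case 2 then show ?case by (auto elim!: E_cases simp: E_plus cl_carrier C_plus)
next
  case 3 then show ?case by (auto elim!: E_cases simp: E_scale cl_carrier C_scale)
next
  case 4 then show ?case by (auto elim!: E_cases simp: E_times cl_carrier C_times)
next
  case 5 then show ?case by (auto elim!: E_cases simp: E_star cl_carrier C_star)
next
  case (7 X Y)
  then obtain s t where st: "s \<in> C" "X = cl s" "t \<in> C" "Y = cl t" by (metis E_cases)
  then have "(\<lambda>n. s n \<boxplus> t n) = (\<lambda>n. t n \<boxplus> s n)" by (intro ext plus_comm C_carrier)
  with st show ?case by (simp add: E_plus)
qed (auto elim!: E_cases simp: E_zero E_plus E_scale E_times E_star C_const C_plus C_scale C_times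
      C_star C_carrier zero_plus plus_neg scale_scale scale_one scale_add_left scale_add_right
      times_assoc times_plus_left times_plus_right scale_times_left scale_times_right
      star_star star_plus star_scale star_times plus_assoc)

lemma E_seminorm: "cstar_seminorm E (norm_a E)"
  unfolding cstar_seminorm_def
proof (intro conjI ballI allI)
  fix X Y c assume "X \<in> carrier E" "Y \<in> carrier E"
  then obtain s t where s: "s \<in> C" "X = cl s" and t: "t \<in> C" "Y = cl t" by (metis E_cases)
  note lim = E_norm[OF s(1), folded s(2)] E_norm[OF t(1), folded t(2)]
  show "\<parallel>X \<boxplus>\<^bsub>E\<^esub> Y\<parallel>\<^bsub>E\<^esub> \<le> \<parallel>X\<parallel>\<^bsub>E\<^esub> + \<parallel>Y\<parallel>\<^bsub>E\<^esub>"
    using s t by (intro LIMSEQ_le[OF E_norm[OF C_plus[OF s(1) t(1)], folded E_plus[OF s(1) t(1)]]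
          tendsto_add[OF lim], folded s(2) t(2)]) (auto simp: q_triangle C_carrier)
  show "\<parallel>X \<boxtimes>\<^bsub>E\<^esub> Y\<parallel>\<^bsub>E\<^esub> \<le> \<parallel>X\<parallel>\<^bsub>E\<^esub> * \<parallel>Y\<parallel>\<^bsub>E\<^esub>"
    using s t by (intro LIMSEQ_le[OF E_norm[OF C_times[OF s(1) t(1)], folded E_times[OF s(1) t(1)]]
          tendsto_mult[OF lim], folded s(2) t(2)]) (auto simp: q_times C_carrier)
next
  fix X c assume "X \<in> carrier E"
  then obtain s where s: "s \<in> C" "X = cl s" by (metis E_cases)
  note lim = E_norm[OF s(1), folded s(2)]
  show "0 \<le> \<parallel>X\<parallel>\<^bsub>E\<^esub>"
    using s by (intro LIMSEQ_le_const[OF lim]) (auto simp: q_nonneg C_carrier)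
  have "(\<lambda>n. q (c \<odot> s n)) \<longlonglongrightarrow> cmod c * \<parallel>X\<parallel>\<^bsub>E\<^esub>"
    using s tendsto_mult[OF tendsto_const lim] by (simp add: q_scale C_carrier)
  then show "\<parallel>c \<odot>\<^bsub>E\<^esub> X\<parallel>\<^bsub>E\<^esub> = cmod c * \<parallel>X\<parallel>\<^bsub>E\<^esub>"
    using LIMSEQ_unique[OF E_norm[OF C_scale[OF s(1)]]] s by (simp add: E_scale)
  have "(\<lambda>n. q ((s n)\<^sup>\<star> \<boxtimes> s n)) \<longlonglongrightarrow> (\<parallel>X\<parallel>\<^bsub>E\<^esub>)\<^sup>2"
    using s tendsto_power[OF lim, of 2] by (simp add: q_cstar C_carrier)
  then show "\<parallel>X\<^sup>\<star>\<^bsub>E\<^esub> \<boxtimes>\<^bsub>E\<^esub> X\<parallel>\<^bsub>E\<^esub> = (\<parallel>X\<parallel>\<^bsub>E\<^esub>)\<^sup>2"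
    using LIMSEQ_unique[OF E_norm[OF C_times[OF C_star[OF s(1)] s(1)]]] s
    by (simp add: E_star E_times C_star)
qed

lemma E_norm_eq_0:
  assumes "X \<in> carrier E" "\<parallel>X\<parallel>\<^bsub>E\<^esub> = 0" shows "X = \<zero>\<^sub>*\<^bsub>E\<^esub>"
proof -
  obtain s where s: "s \<in> C" "X = cl s" using assms E_cases by blast
  have "(s, \<lambda>n. \<zero>\<^sub>*) \<in> null_rel A q"
    using E_norm[OF s(1)] s assms(2) by (simp add: null_rel_def C_const minus_zero C_carrier)
  then show ?thesis using s cl_eq E_zero by simp
qed

lemma E_norm_const: "x \<in> carrier A \<Longrightarrow> \<parallel>cl (\<lambda>n. x)\<parallel>\<^bsub>E\<^esub> = q x"
  using LIMSEQ_unique[OF E_norm[OF C_const[of x]]] by simp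

lemma E_dense: assumes s: "s \<in> C" shows "(\<lambda>k. \<parallel>cl s \<boxminus>\<^bsub>E\<^esub> cl (\<lambda>n. s k)\<parallel>\<^bsub>E\<^esub>) \<longlonglongrightarrow> 0"
proof (rule LIMSEQ_I)
  fix e :: real assume e: "0 < e"
  then obtain N where N: "\<forall>m\<ge>N. \<forall>n\<ge>N. q (s m \<boxminus> s n) < e / 2"
    using C_D[OF s, of "e/2"] by auto
  show "\<exists>N. \<forall>k\<ge>N. norm (\<parallel>cl s \<boxminus>\<^bsub>E\<^esub> cl (\<lambda>n. s k)\<parallel>\<^bsub>E\<^esub> - 0) < e"
  proof (intro exI allI impI)
    fix k assume "N \<le> k"
    have k: "(\<lambda>n. s k) \<in> C" by (rule C_const[OF C_carrier[OF s]])
    have "\<parallel>cl s \<boxminus>\<^bsub>E\<^esub> cl (\<lambda>n. s k)\<parallel>\<^bsub>E\<^esub> \<le> e / 2"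
      unfolding E_minus[OF s k] using N \<open>N \<le> k\<close>
      by (intro LIMSEQ_le_const2[OF E_norm[OF C_minus[OF s k]]]) (auto intro!: exI[of _ N] less_imp_le)
    moreover have "0 \<le> \<parallel>cl s \<boxminus>\<^bsub>E\<^esub> cl (\<lambda>n. s k)\<parallel>\<^bsub>E\<^esub>"
      using E_seminorm cl_carrier[OF C_minus[OF s k]] by (simp add: E_minus s k cstar_seminorm_def)
    ultimately show "norm (\<parallel>cl s \<boxminus>\<^bsub>E\<^esub> cl (\<lambda>n. s k)\<parallel>\<^bsub>E\<^esub> - 0) < e" using e by simp
  qed
qed

lemma E_cstar_algebra: "cstar_algebra E"
proof -
  interpret EE: seminormed_star_algebra E "norm_a E"
    using E_star_algebra E_seminorm
    by (simp add: seminormed_star_algebra_def seminormed_star_algebra_axioms_def)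
  show ?thesis
  proof (unfold_locales)
    show "cstar_seminorm E (norm_a E)" by (rule E_seminorm)
    show "X = \<zero>\<^sub>*\<^bsub>E\<^esub>" if "X \<in> carrier E" "\<parallel>X\<parallel>\<^bsub>E\<^esub> = 0" for X using E_norm_eq_0 that .
    fix S assume S: "S \<in> cauchy_seqs E (norm_a E)"
    have "\<exists>x\<in>carrier A. \<parallel>S k \<boxminus>\<^bsub>E\<^esub> cl (\<lambda>n. x)\<parallel>\<^bsub>E\<^esub> < inverse (real (Suc k))" for k
    proof -
      obtain s where s: "s \<in> C" "S k = cl s" using EE.C_carrier[OF S] E_cases by blast
      obtain m where "\<parallel>cl s \<boxminus>\<^bsub>E\<^esub> cl (\<lambda>n. s m)\<parallel>\<^bsub>E\<^esub> < inverse (real (Suc k))"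
        using order_tendstoD(2)[OF E_dense[OF s(1)], of "inverse (real (Suc k))"]
        by (auto simp: eventually_sequentially)
      then show ?thesis unfolding s(2) using C_carrier[OF s(1), of m] by (intro bexI[of _ "s m"])
    qed
    then obtain t where t: "\<And>k. t k \<in> carrier A"
      "\<And>k. \<parallel>S k \<boxminus>\<^bsub>E\<^esub> cl (\<lambda>n. t k)\<parallel>\<^bsub>E\<^esub> < inverse (real (Suc k))" by metis
    note Sc = EE.C_carrier[OF S]
    let ?T = "\<lambda>k. cl (\<lambda>n. t k)"
    have T: "?T k \<in> carrier E" for k using t by (simp add: cl_carrier C_const)
    have lim0: "(\<lambda>k. \<parallel>S k \<boxminus>\<^bsub>E\<^esub> ?T k\<parallel>\<^bsub>E\<^esub>) \<longlonglongrightarrow> 0"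
      by (rule tendsto_zero_dominated[OF LIMSEQ_inverse_real_of_nat])
        (intro less_imp_le[OF t(2)] EE.q_nonneg EE.minus_closed T Sc)+
    have tC: "t \<in> C"
    proof (rule C_I[OF t(1)])
      fix e :: real assume "0 < e"
      then have e: "0 < e / 3" by simp
      obtain N where N: "\<forall>m\<ge>N. \<forall>n\<ge>N. \<parallel>S m \<boxminus>\<^bsub>E\<^esub> S n\<parallel>\<^bsub>E\<^esub> < e / 3" using EE.C_D[OF S e] by blast
      obtain N' where N': "\<And>k. k \<ge> N' \<Longrightarrow> \<parallel>S k \<boxminus>\<^bsub>E\<^esub> ?T k\<parallel>\<^bsub>E\<^esub> < e / 3"
        using order_tendstoD(2)[OF lim0 e] by (auto simp: eventually_sequentially)
      show "\<exists>N. \<forall>m\<ge>N. \<forall>n\<ge>N. q (t m \<boxminus> t n) < e"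
      proof (intro exI allI impI)
        fix m n assume mn: "max N N' \<le> m" "max N N' \<le> n"
        have "q (t m \<boxminus> t n) = \<parallel>?T m \<boxminus>\<^bsub>E\<^esub> ?T n\<parallel>\<^bsub>E\<^esub>"
          using t(1) by (simp add: E_minus C_const E_norm_const)
        also have "\<dots> \<le> \<parallel>?T m \<boxminus>\<^bsub>E\<^esub> S m\<parallel>\<^bsub>E\<^esub> + (\<parallel>S m \<boxminus>\<^bsub>E\<^esub> S n\<parallel>\<^bsub>E\<^esub> + \<parallel>S n \<boxminus>\<^bsub>E\<^esub> ?T n\<parallel>\<^bsub>E\<^esub>)"
          using EE.q_minus_triangle[of "?T m" "S m" "?T n"] EE.q_minus_triangle[of "S m" "S n" "?T n"] T Sc
          by fastforce
        also have "\<dots> < e"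
          using N N'[of m] N'[of n] mn EE.q_flip[of "S m" "?T m"] T Sc by fastforce
        finally show "q (t m \<boxminus> t n) < e" .
      qed
    qed
    have "(\<lambda>k. \<parallel>S k \<boxminus>\<^bsub>E\<^esub> cl t\<parallel>\<^bsub>E\<^esub>) \<longlonglongrightarrow> 0"
    proof (rule tendsto_zero_dominated)
      show "(\<lambda>k. \<parallel>S k \<boxminus>\<^bsub>E\<^esub> ?T k\<parallel>\<^bsub>E\<^esub> + \<parallel>cl t \<boxminus>\<^bsub>E\<^esub> ?T k\<parallel>\<^bsub>E\<^esub>) \<longlonglongrightarrow> 0"
        using tendsto_add[OF lim0 E_dense[OF tC]] by simp
      show "0 \<le> \<parallel>S k \<boxminus>\<^bsub>E\<^esub> cl t\<parallel>\<^bsub>E\<^esub>" for k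
        by (intro EE.q_nonneg EE.minus_closed Sc cl_carrier[OF tC])
      show "\<parallel>S k \<boxminus>\<^bsub>E\<^esub> cl t\<parallel>\<^bsub>E\<^esub> \<le> \<parallel>S k \<boxminus>\<^bsub>E\<^esub> ?T k\<parallel>\<^bsub>E\<^esub> + \<parallel>cl t \<boxminus>\<^bsub>E\<^esub> ?T k\<parallel>\<^bsub>E\<^esub>" for k
        using EE.q_minus_triangle[of "S k" "?T k" "cl t"] EE.q_flip[of "cl t" "?T k"]
          T Sc cl_carrier[OF tC] by simp
    qed
    then show "\<exists>l\<in>carrier E. (\<lambda>n. \<parallel>S n \<boxminus>\<^bsub>E\<^esub> l\<parallel>\<^bsub>E\<^esub>) \<longlonglongrightarrow> 0"
      using cl_carrier[OF tC] by blast
  qed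
qed

lemma E_hom: "star_hom A E (\<lambda>x. cl (\<lambda>n. x))"
  by (auto simp: star_hom_def cl_carrier C_const E_plus E_scale E_times E_star)

end

lemma zero_seminorm: "cstar_seminorm A (\<lambda>x. 0)"
  by (simp add: cstar_seminorm_def)

lemma env_norm_upper:
  "env_finite A \<Longrightarrow> cstar_seminorm A q \<Longrightarrow> x \<in> carrier A \<Longrightarrow> q x \<le> env_norm A x"
  unfolding env_norm_def env_finite_def by (intro cSUP_upper) auto

lemma env_norm_least:
  "(\<And>q. cstar_seminorm A q \<Longrightarrow> q x \<le> b) \<Longrightarrow> env_norm A x \<le> b"
  unfolding env_norm_def using zero_seminorm by (intro cSUP_least) auto

lemma (in star_algebra) env_norm_seminorm:
  assumes "env_finite A" shows "cstar_seminorm A (env_norm A)"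
proof -
  note up = env_norm_upper[OF assms]
  have nn: "0 \<le> env_norm A x" if "x \<in> carrier A" for x using up[OF zero_seminorm that] .
  have scale_le: "env_norm A (c \<odot> x) \<le> cmod c * env_norm A x" if x: "x \<in> carrier A" for c x
  proof (rule env_norm_least)
    fix q assume q: "cstar_seminorm A q"
    then have "q (c \<odot> x) = cmod c * q x" using x by (simp add: cstar_seminorm_def)
    then show "q (c \<odot> x) \<le> cmod c * env_norm A x"
      using up[OF q x] by (simp add: mult_left_mono)
  qed
  show ?thesis
    unfolding cstar_seminorm_def
  proof (intro conjI ballI allI)
    fix x assume x: "x \<in> carrier A"
    show "0 \<le> env_norm A x" by (rule nn[OF x])
    fix c
    have "cmod c * env_norm A x \<le> env_norm A (c \<odot> x)" if "c \<noteq> 0"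
      using scale_le[of "c \<odot> x" "inverse c"] x that
      by (simp add: scale_scale scale_one norm_divide divide_simps mult.commute)
    then show "env_norm A (c \<odot> x) = cmod c * env_norm A x"
      using scale_le[OF x, of c] nn[of "c \<odot> x"] x by (cases "c = 0") auto
    have "env_norm A (x\<^sup>\<star> \<boxtimes> x) \<le> (env_norm A x)\<^sup>2"
    proof (rule env_norm_least)
      fix q assume q: "cstar_seminorm A q"
      then have "q (x\<^sup>\<star> \<boxtimes> x) = (q x)\<^sup>2" "0 \<le> q x" using x by (auto simp: cstar_seminorm_def)
      then show "q (x\<^sup>\<star> \<boxtimes> x) \<le> (env_norm A x)\<^sup>2" using up[OF q x] by (simp add: power_mono)
    qed
    moreover have "env_norm A x \<le> sqrt (env_norm A (x\<^sup>\<star> \<boxtimes> x))"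
    proof (rule env_norm_least)
      fix q assume q: "cstar_seminorm A q"
      then have "q (x\<^sup>\<star> \<boxtimes> x) = (q x)\<^sup>2" using x by (auto simp: cstar_seminorm_def)
      then show "q x \<le> sqrt (env_norm A (x\<^sup>\<star> \<boxtimes> x))"
        using up[OF q, of "x\<^sup>\<star> \<boxtimes> x"] x by (simp add: real_le_rsqrt)
    qed
    ultimately show "env_norm A (x\<^sup>\<star> \<boxtimes> x) = (env_norm A x)\<^sup>2"
      using nn[OF x] nn[of "x\<^sup>\<star> \<boxtimes> x"] x
      by (metis antisym power_mono real_sqrt_pow2 star_closed times_closed)
    fix y assume y: "y \<in> carrier A"
    show "env_norm A (x \<boxplus> y) \<le> env_norm A x + env_norm A y"
    proof (rule env_norm_least)
      fix q assume q: "cstar_seminorm A q"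
      then have "q (x \<boxplus> y) \<le> q x + q y" using x y by (auto simp: cstar_seminorm_def)
      then show "q (x \<boxplus> y) \<le> env_norm A x + env_norm A y" using up[OF q x] up[OF q y] by simp
    qed
    show "env_norm A (x \<boxtimes> y) \<le> env_norm A x * env_norm A y"
    proof (rule env_norm_least)
      fix q assume q: "cstar_seminorm A q"
      then have "q (x \<boxtimes> y) \<le> q x * q y" "0 \<le> q x" "0 \<le> q y"
        using x y by (auto simp: cstar_seminorm_def)
      then show "q (x \<boxtimes> y) \<le> env_norm A x * env_norm A y"
        using up[OF q x] up[OF q y] nn[OF x] by (meson mult_mono order_trans)
    qed
  qed
qed

theorem env_cstar_cstar_algebra:
  assumes "star_algebra A" "env_finite A"
  shows "cstar_algebra (env_cstar A)" and "star_hom A (env_cstar A) (env_map A)"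
    and "\<And>X. X \<in> carrier (env_cstar A) \<Longrightarrow> \<exists>s. (\<forall>k. s k \<in> carrier A) \<and>
      (\<lambda>k. norm_a (env_cstar A) (X \<boxminus>\<^bsub>env_cstar A\<^esub> env_map A (s k))) \<longlonglongrightarrow> 0"
proof -
  interpret seminormed_star_algebra A "env_norm A"
    using assms star_algebra.env_norm_seminorm
    by (simp add: seminormed_star_algebra_def seminormed_star_algebra_axioms_def)
  show "cstar_algebra (env_cstar A)" unfolding env_cstar_def by (rule E_cstar_algebra)
  show "star_hom A (env_cstar A) (env_map A)"
    unfolding env_cstar_def env_map_def[abs_def] by (rule E_hom)
  fix X assume "X \<in> carrier (env_cstar A)"
  then obtain s where s: "s \<in> C" "X = cl s" unfolding env_cstar_def using E_cases by blast
  then show "\<exists>s. (\<forall>k. s k \<in> carrier A) \<and>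
      (\<lambda>k. norm_a (env_cstar A) (X \<boxminus>\<^bsub>env_cstar A\<^esub> env_map A (s k))) \<longlonglongrightarrow> 0"
    unfolding env_cstar_def env_map_def using E_dense[OF s(1)] C_carrier[OF s(1)] by (intro exI[of _ s]) simp
qed

theorem env_cstar_universal:
  assumes A: "star_algebra A" "env_finite A"
    and B: "cstar_algebra B" and \<phi>: "star_hom A B \<phi>"
  shows "\<exists>\<psi>. star_hom (env_cstar A) B \<psi> \<and> (\<forall>x\<in>carrier A. \<psi> (env_map A x) = \<phi> x) \<and>
    (\<forall>X\<in>carrier (env_cstar A). \<parallel>\<psi> X\<parallel>\<^bsub>B\<^esub> \<le> \<parallel>X\<parallel>\<^bsub>env_cstar A\<^esub>)"
proof -
  interpret seminormed_star_algebra A "env_norm A"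
    using A star_algebra.env_norm_seminorm
    by (simp add: seminormed_star_algebra_def seminormed_star_algebra_axioms_def)
  interpret B: cstar_algebra B by (rule B)
  interpret B: seminormed_star_algebra B "norm_a B"
    using B.norm_cstar_seminorm by unfold_locales
  have \<phi>c [simp]: "x \<in> carrier A \<Longrightarrow> \<phi> x \<in> carrier B" for x using \<phi> by (simp add: star_hom_def)
  have pull: "cstar_seminorm A (\<lambda>x. \<parallel>\<phi> x\<parallel>\<^bsub>B\<^esub>)"
    using \<phi> by (simp add: cstar_seminorm_def star_hom_def B.q_nonneg B.q_triangle B.q_scale
        B.q_times B.q_cstar)
  have \<phi>le: "\<parallel>\<phi> x\<parallel>\<^bsub>B\<^esub> \<le> env_norm A x" if "x \<in> carrier A" for x
    using env_norm_upper[OF A(2) pull that] .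
  have \<phi>minus: "\<phi> (x \<boxminus>\<^bsub>A\<^esub> y) = \<phi> x \<boxminus>\<^bsub>B\<^esub> \<phi> y" if "x \<in> carrier A" "y \<in> carrier A" for x y
    using \<phi> that by (simp add: minus_a_def star_hom_def)
  define L where "L s l \<longleftrightarrow> l \<in> carrier B \<and> (\<lambda>n. \<parallel>\<phi> (s n) \<boxminus>\<^bsub>B\<^esub> l\<parallel>\<^bsub>B\<^esub>) \<longlonglongrightarrow> 0" for s l
  have ex: "\<exists>l. L s l" if s: "s \<in> C" for s
  proof -
    have "(\<lambda>n. \<phi> (s n)) \<in> B.C"
    proof (rule B.C_I)
      fix e :: real assume "0 < e"
      then obtain N where N: "\<forall>m\<ge>N. \<forall>n\<ge>N. env_norm A (s m \<boxminus>\<^bsub>A\<^esub> s n) < e" using C_D[OF s] by blast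
      have "\<parallel>\<phi> (s m) \<boxminus>\<^bsub>B\<^esub> \<phi> (s n)\<parallel>\<^bsub>B\<^esub> \<le> env_norm A (s m \<boxminus>\<^bsub>A\<^esub> s n)" for m n
        using \<phi>le[of "s m \<boxminus>\<^bsub>A\<^esub> s n"] C_carrier[OF s] by (simp add: \<phi>minus)
      with N show "\<exists>N. \<forall>m\<ge>N. \<forall>n\<ge>N. \<parallel>\<phi> (s m) \<boxminus>\<^bsub>B\<^esub> \<phi> (s n)\<parallel>\<^bsub>B\<^esub> < e"
        by (meson order_le_less_trans)
    qed (simp add: C_carrier[OF s])
    from B.complete[OF this] show ?thesis unfolding L_def by blast
  qed
  have uniq: "l = l'" if st: "(s, t) \<in> null_rel A (env_norm A)" and l: "L s l" and l': "L t l'" for s t l l'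
  proof -
    have "s \<in> C" "t \<in> C" using st null_C by blast+
    then have C: "s n \<in> carrier A" "t n \<in> carrier A" for n by (auto intro: C_carrier)
    have lc: "l \<in> carrier B" "l' \<in> carrier B" using l l' by (auto simp: L_def)
    have "(\<lambda>n. \<parallel>\<phi> (s n) \<boxminus>\<^bsub>B\<^esub> l\<parallel>\<^bsub>B\<^esub> + (env_norm A (s n \<boxminus>\<^bsub>A\<^esub> t n) + \<parallel>\<phi> (t n) \<boxminus>\<^bsub>B\<^esub> l'\<parallel>\<^bsub>B\<^esub>)) \<longlonglongrightarrow> 0 + (0 + 0)"
      using l l' st by (intro tendsto_add) (auto simp: L_def null_rel_def)
    moreover have "\<parallel>l \<boxminus>\<^bsub>B\<^esub> l'\<parallel>\<^bsub>B\<^esub> \<le> \<parallel>\<phi> (s n) \<boxminus>\<^bsub>B\<^esub> l\<parallel>\<^bsub>B\<^esub> + (env_norm A (s n \<boxminus>\<^bsub>A\<^esub> t n) + \<parallel>\<phi> (t n) \<boxminus>\<^bsub>B\<^esub> l'\<parallel>\<^bsub>B\<^esub>)" for n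
    proof -
      have "\<parallel>l \<boxminus>\<^bsub>B\<^esub> l'\<parallel>\<^bsub>B\<^esub> \<le> \<parallel>l \<boxminus>\<^bsub>B\<^esub> \<phi> (s n)\<parallel>\<^bsub>B\<^esub> + (\<parallel>\<phi> (s n) \<boxminus>\<^bsub>B\<^esub> \<phi> (t n)\<parallel>\<^bsub>B\<^esub> + \<parallel>\<phi> (t n) \<boxminus>\<^bsub>B\<^esub> l'\<parallel>\<^bsub>B\<^esub>)"
        using B.q_minus_triangle[of l "\<phi> (s n)" l'] B.q_minus_triangle[of "\<phi> (s n)" "\<phi> (t n)" l'] C lc
        by simp
      then show ?thesis
        using \<phi>le[of "s n \<boxminus>\<^bsub>A\<^esub> t n"] C lc by (simp add: \<phi>minus B.q_flip[of l "\<phi> (s n)"])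
    qed
    ultimately have "(\<lambda>n::nat. \<parallel>l \<boxminus>\<^bsub>B\<^esub> l'\<parallel>\<^bsub>B\<^esub>) \<longlonglongrightarrow> 0"
      using lc by (simp add: tendsto_zero_dominated[OF _ B.q_nonneg])
    then have "\<parallel>l \<boxminus>\<^bsub>B\<^esub> l'\<parallel>\<^bsub>B\<^esub> = 0" by (simp add: LIMSEQ_const_iff)
    then have "l \<boxminus>\<^bsub>B\<^esub> l' = \<zero>\<^sub>*\<^bsub>B\<^esub>" using B.norm_eq_0 lc by simp
    then show ?thesis using B.minus_plus_cancel[of l l'] lc by (simp add: B.zero_plus)
  qed
  define \<psi> where "\<psi> X = (SOME l. L (rep X) l)" for X
  have \<psi>rep: "L (rep (cl s)) (\<psi> (cl s))" if "s \<in> C" for s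
    unfolding \<psi>_def using ex[of "rep (cl s)"] null_C(1)[OF rep_cl[OF that]] by (auto intro: someI_ex)
  have \<psi>_eq: "\<psi> (cl s) = l" if "s \<in> C" "L s l" for s l
    using uniq[OF rep_cl[OF that(1)] \<psi>rep[OF that(1)] that(2)] .
  have L\<psi>: "L s (\<psi> (cl s))" if "s \<in> C" for s
    using ex[OF that] \<psi>_eq[OF that] by metis
  have \<psi>c: "\<psi> (cl s) \<in> carrier B" if "s \<in> C" for s using L\<psi>[OF that] by (simp add: L_def)
  have bound: "\<parallel>\<psi> (cl s)\<parallel>\<^bsub>B\<^esub> \<le> \<parallel>cl s\<parallel>\<^bsub>E\<^esub>" if s: "s \<in> C" for s
  proof (rule LIMSEQ_le_const)
    have "(\<lambda>n. env_norm A (s n) + \<parallel>\<phi> (s n) \<boxminus>\<^bsub>B\<^esub> \<psi> (cl s)\<parallel>\<^bsub>B\<^esub>) \<longlonglongrightarrow> \<parallel>cl s\<parallel>\<^bsub>E\<^esub> + 0"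
      using E_norm[OF s] L\<psi>[OF s] by (intro tendsto_add) (auto simp: L_def)
    then show "(\<lambda>n. env_norm A (s n) + \<parallel>\<phi> (s n) \<boxminus>\<^bsub>B\<^esub> \<psi> (cl s)\<parallel>\<^bsub>B\<^esub>) \<longlonglongrightarrow> \<parallel>cl s\<parallel>\<^bsub>E\<^esub>" by simp
    have "\<parallel>\<psi> (cl s)\<parallel>\<^bsub>B\<^esub> \<le> env_norm A (s n) + \<parallel>\<phi> (s n) \<boxminus>\<^bsub>B\<^esub> \<psi> (cl s)\<parallel>\<^bsub>B\<^esub>" for n
      using B.q_diff[of "\<phi> (s n)" "\<psi> (cl s)"] \<psi>c[OF s] \<phi>le[of "s n"] C_carrier[OF s] by auto
    then show "\<exists>N. \<forall>n\<ge>N. \<parallel>\<psi> (cl s)\<parallel>\<^bsub>B\<^esub> \<le> env_norm A (s n) + \<parallel>\<phi> (s n) \<boxminus>\<^bsub>B\<^esub> \<psi> (cl s)\<parallel>\<^bsub>B\<^esub>" by blast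
  qed
  have const: "\<psi> (cl (\<lambda>n. x)) = \<phi> x" if "x \<in> carrier A" for x
    using that by (intro \<psi>_eq C_const) (auto simp: L_def B.minus_self)
  have hom: "star_hom E B \<psi>"
    unfolding star_hom_def
  proof (intro conjI ballI allI)
    fix X c assume "X \<in> carrier E"
    then obtain s where s: "s \<in> C" "X = cl s" using E_cases by blast
    note [simp] = C_carrier[OF s(1)]
    note l = L\<psi>[OF s(1), folded s(2)]
    have lc: "\<psi> X \<in> carrier B" using l by (simp add: L_def)
    show "\<psi> X \<in> carrier B" by (rule lc)
    have "L (\<lambda>n. c \<odot>\<^bsub>A\<^esub> s n) (c \<odot>\<^bsub>B\<^esub> \<psi> X)"
    proof -
      have eq: "\<parallel>\<phi> (c \<odot>\<^bsub>A\<^esub> s n) \<boxminus>\<^bsub>B\<^esub> c \<odot>\<^bsub>B\<^esub> \<psi> X\<parallel>\<^bsub>B\<^esub> = cmod c * \<parallel>\<phi> (s n) \<boxminus>\<^bsub>B\<^esub> \<psi> X\<parallel>\<^bsub>B\<^esub>" for n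
        using \<phi> s lc by (simp add: star_hom_def B.scale_minus_scale B.q_scale)
      have "(\<lambda>n. cmod c * \<parallel>\<phi> (s n) \<boxminus>\<^bsub>B\<^esub> \<psi> X\<parallel>\<^bsub>B\<^esub>) \<longlonglongrightarrow> cmod c * 0"
        using l by (intro tendsto_intros) (simp add: L_def)
      then show ?thesis using lc by (simp add: L_def eq)
    qed
    then show "\<psi> (c \<odot>\<^bsub>E\<^esub> X) = c \<odot>\<^bsub>B\<^esub> \<psi> X" using s by (simp add: E_scale \<psi>_eq C_scale)
    have "L (\<lambda>n. (s n)\<^sup>\<star>\<^bsub>A\<^esub>) ((\<psi> X)\<^sup>\<star>\<^bsub>B\<^esub>)"
    proof -
      have eq: "\<parallel>\<phi> ((s n)\<^sup>\<star>\<^bsub>A\<^esub>) \<boxminus>\<^bsub>B\<^esub> (\<psi> X)\<^sup>\<star>\<^bsub>B\<^esub>\<parallel>\<^bsub>B\<^esub> = \<parallel>\<phi> (s n) \<boxminus>\<^bsub>B\<^esub> \<psi> X\<parallel>\<^bsub>B\<^esub>" for n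
        using \<phi> s lc by (simp add: star_hom_def B.star_minus_star B.q_star)
      show ?thesis using l by (simp add: L_def eq)
    qed
    then show "\<psi> (X\<^sup>\<star>\<^bsub>E\<^esub>) = (\<psi> X)\<^sup>\<star>\<^bsub>B\<^esub>" using s by (simp add: E_star \<psi>_eq C_star)
    fix Y assume "Y \<in> carrier E"
    then obtain t where t: "t \<in> C" "Y = cl t" using E_cases by blast
    note [simp] = C_carrier[OF t(1)]
    note l' = L\<psi>[OF t(1), folded t(2)]
    have lc': "\<psi> Y \<in> carrier B" using l' by (simp add: L_def)
    have "L (\<lambda>n. s n \<boxplus>\<^bsub>A\<^esub> t n) (\<psi> X \<boxplus>\<^bsub>B\<^esub> \<psi> Y)"
    proof -
      have le: "\<parallel>\<phi> (s n \<boxplus>\<^bsub>A\<^esub> t n) \<boxminus>\<^bsub>B\<^esub> (\<psi> X \<boxplus>\<^bsub>B\<^esub> \<psi> Y)\<parallel>\<^bsub>B\<^esub> \<le> \<parallel>\<phi> (s n) \<boxminus>\<^bsub>B\<^esub> \<psi> X\<parallel>\<^bsub>B\<^esub> + \<parallel>\<phi> (t n) \<boxminus>\<^bsub>B\<^esub> \<psi> Y\<parallel>\<^bsub>B\<^esub>" for n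
        using \<phi> s t lc lc' by (simp add: star_hom_def B.q_plus_minus)
      have "(\<lambda>n. \<parallel>\<phi> (s n) \<boxminus>\<^bsub>B\<^esub> \<psi> X\<parallel>\<^bsub>B\<^esub> + \<parallel>\<phi> (t n) \<boxminus>\<^bsub>B\<^esub> \<psi> Y\<parallel>\<^bsub>B\<^esub>) \<longlonglongrightarrow> 0 + 0"
        using l l' by (intro tendsto_add) (auto simp: L_def)
      then have "(\<lambda>n. \<parallel>\<phi> (s n) \<boxminus>\<^bsub>B\<^esub> \<psi> X\<parallel>\<^bsub>B\<^esub> + \<parallel>\<phi> (t n) \<boxminus>\<^bsub>B\<^esub> \<psi> Y\<parallel>\<^bsub>B\<^esub>) \<longlonglongrightarrow> 0" by simp
      from tendsto_zero_dominated[OF this _ le] show ?thesis using lc lc'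
        unfolding L_def by (simp add: B.q_nonneg)
    qed
    then show "\<psi> (X \<boxplus>\<^bsub>E\<^esub> Y) = \<psi> X \<boxplus>\<^bsub>B\<^esub> \<psi> Y" using s t by (simp add: E_plus \<psi>_eq C_plus)
    have "L (\<lambda>n. s n \<boxtimes>\<^bsub>A\<^esub> t n) (\<psi> X \<boxtimes>\<^bsub>B\<^esub> \<psi> Y)"
    proof -
      obtain b where b: "0 < b" "\<And>n. env_norm A (t n) \<le> b" using C_bounded[OF t(1)] by blast
      let ?b = "max b \<parallel>\<psi> X\<parallel>\<^bsub>B\<^esub>"
      have "\<parallel>\<phi> (t n)\<parallel>\<^bsub>B\<^esub> \<le> ?b" for n
        using \<phi>le[of "t n"] b(2)[of n] t by simp
      then have le: "\<parallel>\<phi> (s n \<boxtimes>\<^bsub>A\<^esub> t n) \<boxminus>\<^bsub>B\<^esub> (\<psi> X \<boxtimes>\<^bsub>B\<^esub> \<psi> Y)\<parallel>\<^bsub>B\<^esub> \<le> ?b * \<parallel>\<phi> (s n) \<boxminus>\<^bsub>B\<^esub> \<psi> X\<parallel>\<^bsub>B\<^esub> + ?b * \<parallel>\<phi> (t n) \<boxminus>\<^bsub>B\<^esub> \<psi> Y\<parallel>\<^bsub>B\<^esub>" for n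
        using \<phi> s t lc lc' B.q_times_minus[of "\<phi> (s n)" "\<phi> (t n)" "\<psi> X" "\<psi> Y" ?b]
        by (simp add: star_hom_def)
      have "(\<lambda>n. ?b * \<parallel>\<phi> (s n) \<boxminus>\<^bsub>B\<^esub> \<psi> X\<parallel>\<^bsub>B\<^esub> + ?b * \<parallel>\<phi> (t n) \<boxminus>\<^bsub>B\<^esub> \<psi> Y\<parallel>\<^bsub>B\<^esub>) \<longlonglongrightarrow> ?b * 0 + ?b * 0"
        using l l' by (intro tendsto_add tendsto_mult tendsto_const) (auto simp: L_def)
      then have "(\<lambda>n. ?b * \<parallel>\<phi> (s n) \<boxminus>\<^bsub>B\<^esub> \<psi> X\<parallel>\<^bsub>B\<^esub> + ?b * \<parallel>\<phi> (t n) \<boxminus>\<^bsub>B\<^esub> \<psi> Y\<parallel>\<^bsub>B\<^esub>) \<longlonglongrightarrow> 0" by simp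
      from tendsto_zero_dominated[OF this _ le] show ?thesis using lc lc'
        unfolding L_def by (simp add: B.q_nonneg)
    qed
    then show "\<psi> (X \<boxtimes>\<^bsub>E\<^esub> Y) = \<psi> X \<boxtimes>\<^bsub>B\<^esub> \<psi> Y" using s t by (simp add: E_times \<psi>_eq C_times)
  qed
  show ?thesis
    unfolding env_cstar_def env_map_def
  proof (intro exI[of _ \<psi>] conjI ballI)
    show "star_hom E B \<psi>" by (rule hom)
    show "\<psi> (cl (\<lambda>n. x)) = \<phi> x" if "x \<in> carrier A" for x using const[OF that] .
    show "\<parallel>\<psi> X\<parallel>\<^bsub>B\<^esub> \<le> \<parallel>X\<parallel>\<^bsub>E\<^esub>" if X: "X \<in> carrier E" for X
      by (rule E_cases[OF X]) (simp add: bound)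
  qed
qed

section \<open>Full crossed products by discrete groups\<close>

definition linf :: "('y \<Rightarrow> complex) cstar_alg" where
  "linf = \<lparr>carrier = {f. bounded (range f)},
      zero_a = (\<lambda>y. 0),
      plus_a = (\<lambda>f h y. f y + h y),
      scale_a = (\<lambda>c f y. c * f y),
      times_a = (\<lambda>f h y. f y * h y),
      star_a = (\<lambda>f y. cnj (f y)),
      norm_a = (\<lambda>f. SUP y. cmod (f y))\<rparr>"

text \<open>
  For a *-subalgebra \<open>D\<close> of \<open>linf\<close> and an action \<open>\<alpha>\<close> of the discrete group \<open>G\<close> on \<open>D\<close>, the
  *-algebra \<open>C\<^sub>c(G, D)\<close> of finitely supported functions, in which \<open>F\<close> stands for the formal sum
  of the \<open>F(g) u\<^sub>g\<close>:
  \<open>(F H)(g) = \<Sum>\<^sub>h F(h) \<alpha>\<^sub>h(H(h\<^sup>-\<^sup>1 g))\<close> and \<open>F\<^sup>*(g) = \<alpha>\<^sub>g(F(g\<^sup>-\<^sup>1)\<^sup>*)\<close>.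
  Since \<open>G\<close> is discrete, the full crossed product is its enveloping \<open>C\<^sup>*\<close>-algebra.
\<close>

definition crossed_alg :: "('g, 'm) monoid_scheme \<Rightarrow> ('y \<Rightarrow> complex) set \<Rightarrow>
    ('g \<Rightarrow> ('y \<Rightarrow> complex) \<Rightarrow> 'y \<Rightarrow> complex) \<Rightarrow> ('g \<Rightarrow> 'y \<Rightarrow> complex) star_alg" where
  "crossed_alg G D \<alpha> =
     \<lparr>carrier = {F. (\<forall>g\<in>carrier G. F g \<in> D) \<and> (\<forall>g. g \<notin> carrier G \<longrightarrow> F g = (\<lambda>y. 0)) \<and>
                    finite {g. F g \<noteq> (\<lambda>y. 0)}},
      zero_a = (\<lambda>g y. 0),
      plus_a = (\<lambda>F H g y. F g y + H g y),
      scale_a = (\<lambda>c F g y. c * F g y),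
      times_a = (\<lambda>F H g y. if g \<in> carrier G
         then \<Sum>h\<in>{h \<in> carrier G. F h \<noteq> (\<lambda>y. 0)}. F h y * \<alpha> h (H (inv\<^bsub>G\<^esub> h \<otimes>\<^bsub>G\<^esub> g)) y
         else 0),
      star_a = (\<lambda>F g. if g \<in> carrier G then \<alpha> g (\<lambda>y. cnj (F (inv\<^bsub>G\<^esub> g) y)) else (\<lambda>y. 0))\<rparr>"

definition full_crossed_product :: "('g, 'm) monoid_scheme \<Rightarrow> ('y \<Rightarrow> complex) set \<Rightarrow>
    ('g \<Rightarrow> ('y \<Rightarrow> complex) \<Rightarrow> 'y \<Rightarrow> complex) \<Rightarrow> (nat \<Rightarrow> 'g \<Rightarrow> 'y \<Rightarrow> complex) set cstar_alg" where
  "full_crossed_product G D \<alpha> = env_cstar (crossed_alg G D \<alpha>)"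

definition i_D :: "('g, 'm) monoid_scheme \<Rightarrow> ('y \<Rightarrow> complex) set \<Rightarrow>
    ('g \<Rightarrow> ('y \<Rightarrow> complex) \<Rightarrow> 'y \<Rightarrow> complex) \<Rightarrow> ('y \<Rightarrow> complex) \<Rightarrow> (nat \<Rightarrow> 'g \<Rightarrow> 'y \<Rightarrow> complex) set" where
  "i_D G D \<alpha> f = env_map (crossed_alg G D \<alpha>) (\<lambda>g. if g = \<one>\<^bsub>G\<^esub> then f else (\<lambda>y. 0))"

section \<open>Hecke algebras\<close>

definition hecke_L :: "('g, 'm) monoid_scheme \<Rightarrow> 'g set \<Rightarrow> 'g \<Rightarrow> nat" where
  "hecke_L G M g =
     card (lcosets\<^bsub>G\<lparr>carrier := M\<rparr>\<^esub> (M \<inter> (g <#\<^bsub>G\<^esub> M #>\<^bsub>G\<^esub> (inv\<^bsub>G\<^esub> g))))"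

definition hecke_Delta :: "('g, 'm) monoid_scheme \<Rightarrow> 'g set \<Rightarrow> 'g \<Rightarrow> real" where
  "hecke_Delta G M g = real (hecke_L G M g) / real (hecke_L G M (inv\<^bsub>G\<^esub> g))"

text \<open>
  Functions on \<open>G\<close> are extended by 0 outside \<open>carrier G\<close>.  In the convolution the summand does
  not depend on the representative of the left coset, since \<open>f\<close> is right and \<open>h\<close> left
  \<open>M\<close>-invariant.
\<close>

definition hecke_algebra :: "('g, 'm) monoid_scheme \<Rightarrow> 'g set \<Rightarrow> ('g \<Rightarrow> complex) star_alg" where
  "hecke_algebra G M =
     \<lparr>carrier = {f. (\<forall>g. g \<notin> carrier G \<longrightarrow> f g = 0) \<and>
                    (\<forall>g\<in>carrier G. \<forall>m\<in>M. \<forall>n\<in>M. f (m \<otimes>\<^bsub>G\<^esub> g \<otimes>\<^bsub>G\<^esub> n) = f g) \<and>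
                    finite {M #>\<^bsub>G\<^esub> g <#>\<^bsub>G\<^esub> M | g. g \<in> carrier G \<and> f g \<noteq> 0}},
      zero_a = (\<lambda>g. 0),
      plus_a = (\<lambda>f h g. f g + h g),
      scale_a = (\<lambda>c f g. c * f g),
      times_a = (\<lambda>f h x. if x \<in> carrier G
         then \<Sum>C\<in>{C \<in> lcosets\<^bsub>G\<^esub> M. \<exists>y\<in>C. f y \<noteq> 0}.
                let y = (SOME y. y \<in> C) in f y * h (inv\<^bsub>G\<^esub> y \<otimes>\<^bsub>G\<^esub> x)
         else 0),
      star_a = (\<lambda>f x. if x \<in> carrier G
         then complex_of_real (hecke_Delta G M (inv\<^bsub>G\<^esub> x)) * cnj (f (inv\<^bsub>G\<^esub> x)) else 0)\<rparr>"

definition hecke_cstar :: "('g, 'm) monoid_scheme \<Rightarrow> 'g set \<Rightarrow> (nat \<Rightarrow> 'g \<Rightarrow> complex) set cstar_alg" where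
  "hecke_cstar G M = env_cstar (hecke_algebra G M)"

section \<open>The number field data\<close>

definition Q_adjoin :: "'k::field_char_0 \<Rightarrow> 'k set" where
  "Q_adjoin \<theta> =
     {poly (map_poly of_rat p) \<theta> / poly (map_poly of_rat q) \<theta> | p q. poly (map_poly of_rat q) \<theta> \<noteq> 0}"

definition Z_adjoin :: "'k::field_char_0 \<Rightarrow> 'k set" where
  "Z_adjoin \<theta> = range (\<lambda>p. poly (map_poly of_int p) \<theta>)"

definition affine_group :: "('k::field \<times> 'k) monoid" where
  "affine_group =
     \<lparr>carrier = UNIV \<times> (UNIV - {0}),
      mult = (\<lambda>(x, a) (y, b). (x + a * y, a * b)),
      one = (0, 1)\<rparr>"

lemma group_affine_group: "group affine_group"
proof (rule groupI)
  fix g :: "'k::field \<times> 'k" assume "g \<in> carrier affine_group"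
  then obtain x a where g: "g = (x, a)" "a \<noteq> 0" by (auto simp: affine_group_def)
  then show "\<exists>h\<in>carrier affine_group. h \<otimes>\<^bsub>affine_group\<^esub> g = \<one>\<^bsub>affine_group\<^esub>"
    by (intro bexI[of _ "(- inverse a * x, inverse a)"]) (auto simp: affine_group_def)
qed (auto simp: affine_group_def algebra_simps)

definition transl :: "'k set \<Rightarrow> ('k::field \<times> 'k) set" where
  "transl M = (\<lambda>m. (m, 1)) ` M"

definition aff_act :: "'k::field \<times> 'k \<Rightarrow> 'k \<Rightarrow> 'k" where
  "aff_act = (\<lambda>(x, a) y. x + a * y)"

definition aff_alpha :: "'k::field \<times> 'k \<Rightarrow> ('k \<Rightarrow> complex) \<Rightarrow> 'k \<Rightarrow> complex" where
  "aff_alpha g f = f \<circ> aff_act (inv\<^bsub>affine_group\<^esub> g)"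

definition coset_algebra :: "'k::field set \<Rightarrow> ('k \<Rightarrow> complex) set" where
  "coset_algebra M =
     cstar_generated linf {indicator ((\<lambda>m. x + a * m) ` M) | x a. a \<noteq> 0}"

end

theory Submission
  imports Defs "HOL-Real_Asymp.Real_Asymp" "HOL-Computational_Algebra.Field_as_Ring"
begin

text \<open>
  The embedding is a Fourier transform.  Elements of the Hecke algebra of \<open>(K \<rtimes> K\<^sup>\<times>, M)\<close> are
  functions \<open>f(x, b)\<close> of a translation \<open>x\<close> and a degree \<open>b\<close>, and for each \<open>b\<close> the function
  \<open>f(\<cdot>, b)\<close> lives on finitely many cosets of a lattice.  Let \<open>\<psi>\<close> be a character of \<open>K\<close> for which
  \<open>M\<close> is its own annihilator: \<open>\<psi>\<close> is trivial on \<open>x M\<close> exactly when \<open>x \<in> M\<close>.  The Fourier transform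
  of \<open>f(\<cdot>, b)\<close> with respect to \<open>\<psi>\<close> is again a combination of indicator functions of cosets
  \<open>s + d M\<close>, so it lies in \<open>D\<close>; it is supported in \<open>M \<inter> b\<^sup>-\<^sup>1 M\<close>.  Since dilating \<open>x\<close> by \<open>b\<close>
  dilates the dual variable by \<open>b\<^sup>-\<^sup>1\<close>, placing the transform of \<open>f(\<cdot>, b)\<close> at the group element
  \<open>(0, b\<^sup>-\<^sup>1)\<close> and summing over \<open>b\<close> defines an injective *-homomorphism (\<open>transform_star_hom\<close>,
  \<open>transform_inj\<close>) into the finitely supported part of \<open>D \<rtimes> G\<close>, and its image lies in the
  corner of \<open>\<chi>\<^sub>M\<close>.

  For \<open>M = \<int>[\<theta>]\<close> such a character exists because the dual of \<open>\<int>[\<theta>]\<close> for the trace form is the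
  principal module generated by \<open>1 / P'(\<theta>)\<close>, where \<open>P\<close> is the minimal polynomial.  Rescaling
  the trace by this factor gives Euler's functional, which reads off the coefficient of
  \<open>\<theta>\<^sup>n\<^sup>-\<^sup>1\<close> in the basis \<open>1, \<theta>, \<dots>, \<theta>\<^sup>n\<^sup>-\<^sup>1\<close>.  For this functional self-duality is visible
  directly (\<open>Z_adjoin_self_dual\<close>), by peeling off the coefficients of an element one at a time.

  It remains to pass to the enveloping \<open>C\<^sup>*\<close>-algebras, where injectivity amounts to the transform
  being isometric (\<open>env_cstar_embeds_corner\<close>).  Pulling back the norm of the crossed product gives one
  inequality.  The other, \<open>seminorm_le_cross_norm\<close>, says that no \<open>C\<^sup>*\<close>-seminorm \<open>q\<close> of the Hecke
  algebra exceeds the norm of the transform; it expresses the amenability of the abelian group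
  \<open>K\<^sup>\<times>\<close> and is proved by counting.  In the crossed product the norm of an element that lives
  at a single group element is the supremum of its coefficient, and a coefficient never exceeds
  the norm.  By Fourier inversion on a finite group and the identity
  \<open>q ((f\<^sup>* f)\<^sup>m) = q (f)\<^sup>2\<^sup>m\<close> (for \<open>m\<close> a power of 2), the inequality holds for \<open>f\<close> of degree 1, hence, by
  \<open>q (f)\<^sup>2 = q (f\<^sup>* f)\<close>, for \<open>f\<close> homogeneous of any degree.  An element with \<open>N\<close> degrees therefore
  satisfies the inequality up to the factor \<open>N\<close>.  The degrees of \<open>(f\<^sup>* f)\<^sup>m\<close> are products of \<open>m\<close>
  elements of a fixed finite subset of a commutative group, so their number is bounded
  by a polynomial in \<open>m\<close>, and after extracting \<open>2 m\<close>-th roots the factor disappears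
  (\<open>polynomial_growth_root\<close>).

  The two facts on the norm of the crossed product are obtained as follows.  Coefficients are matrix
  entries in the representations on \<open>\<ell>\<^sup>2(G)\<close> attached to the points of \<open>K\<close>
  (\<open>coeff_le_env_norm\<close>).  Conversely, a real \<open>f \<in> D\<close> with \<open>\<bar>f\<bar> < 1\<close> is the average of the two
  unitaries \<open>f \<plusminus> \<i> \<surd>(1 - f\<^sup>2)\<close>, and the square root is available because \<open>D\<close> is closed
  (\<open>env_norm_homogeneous_le\<close>).
\<close>

section \<open>Isometric embeddings of enveloping \<open>C\<^sup>*\<close>-algebras\<close>

lemma seminormed_star_algebraI:
  "star_algebra A \<Longrightarrow> cstar_seminorm A q \<Longrightarrow> seminormed_star_algebra A q"
  by (simp add: seminormed_star_algebra_def seminormed_star_algebra_axioms_def)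

lemma star_hom_minus:
  assumes "star_hom A B \<phi>" "star_algebra A" "x \<in> carrier A" "y \<in> carrier A"
  shows "\<phi> (x \<boxminus>\<^bsub>A\<^esub> y) = \<phi> x \<boxminus>\<^bsub>B\<^esub> \<phi> y"
  using assms by (simp add: minus_a_def star_hom_def star_algebra.scale_closed)

text \<open>
  This spares the verification of the identities of a *-algebra, such as associativity, for an algebra
  that is embedded in a known one.
\<close>

lemma star_algebra_inject:
  assumes B: "star_algebra B" and inj: "inj_on \<phi> (carrier A)" and hom: "star_hom A B \<phi>"
    and zero: "\<phi> \<zero>\<^sub>*\<^bsub>A\<^esub> = \<zero>\<^sub>*\<^bsub>B\<^esub>"
    and cl: "\<zero>\<^sub>*\<^bsub>A\<^esub> \<in> carrier A"
      "\<And>x y. x \<in> carrier A \<Longrightarrow> y \<in> carrier A \<Longrightarrow> x \<boxplus>\<^bsub>A\<^esub> y \<in> carrier A"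
      "\<And>c x. x \<in> carrier A \<Longrightarrow> c \<odot>\<^bsub>A\<^esub> x \<in> carrier A"
      "\<And>x y. x \<in> carrier A \<Longrightarrow> y \<in> carrier A \<Longrightarrow> x \<boxtimes>\<^bsub>A\<^esub> y \<in> carrier A"
      "\<And>x. x \<in> carrier A \<Longrightarrow> x\<^sup>\<star>\<^bsub>A\<^esub> \<in> carrier A"
  shows "star_algebra A"
proof -
  interpret B: star_algebra B by (rule B)
  have h: "\<And>x. x \<in> carrier A \<Longrightarrow> \<phi> x \<in> carrier B"
    "\<And>x y. x \<in> carrier A \<Longrightarrow> y \<in> carrier A \<Longrightarrow> \<phi> (x \<boxplus>\<^bsub>A\<^esub> y) = \<phi> x \<boxplus>\<^bsub>B\<^esub> \<phi> y"
    "\<And>c x. x \<in> carrier A \<Longrightarrow> \<phi> (c \<odot>\<^bsub>A\<^esub> x) = c \<odot>\<^bsub>B\<^esub> \<phi> x"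
    "\<And>x y. x \<in> carrier A \<Longrightarrow> y \<in> carrier A \<Longrightarrow> \<phi> (x \<boxtimes>\<^bsub>A\<^esub> y) = \<phi> x \<boxtimes>\<^bsub>B\<^esub> \<phi> y"
    "\<And>x. x \<in> carrier A \<Longrightarrow> \<phi> (x\<^sup>\<star>\<^bsub>A\<^esub>) = (\<phi> x)\<^sup>\<star>\<^bsub>B\<^esub>"
    using hom by (auto simp: star_hom_def)
  note eqI = inj_onD[OF inj]
  show ?thesis
  proof (unfold_locales, goal_cases)
    case (7 x y) then show ?case by (intro eqI) (simp_all add: cl h B.plus_comm)
  qed (auto intro!: cl eqI simp: cl h zero B.plus_assoc B.zero_plus B.plus_neg
      B.scale_scale B.scale_one B.scale_add_left B.scale_add_right B.times_assoc B.times_plus_left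
      B.times_plus_right B.scale_times_left B.scale_times_right B.star_star B.star_plus B.star_scale
      B.star_times)
qed

text \<open>
  An isometric homomorphism acts termwise on Cauchy sequences and both preserves and
  reflects null sequences.
\<close>

lemma completion_isometry:
  assumes A: "seminormed_star_algebra A qA" and B: "seminormed_star_algebra B qB"
    and hom: "star_hom A B \<phi>" and iso: "\<And>x. x \<in> carrier A \<Longrightarrow> qB (\<phi> x) = qA x"
  defines "\<Phi> \<equiv> \<lambda>X. cls B qB (\<lambda>n. \<phi> (rep X n))"
  shows "star_hom (completion A qA) (completion B qB) \<Phi>"
    and "inj_on \<Phi> (carrier (completion A qA))"
proof -
  interpret A: seminormed_star_algebra A qA by (rule A)
  interpret B: seminormed_star_algebra B qB by (rule B)
  have h: "\<And>x. x \<in> carrier A \<Longrightarrow> \<phi> x \<in> carrier B"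
    "\<And>x y. x \<in> carrier A \<Longrightarrow> y \<in> carrier A \<Longrightarrow> \<phi> (x \<boxplus>\<^bsub>A\<^esub> y) = \<phi> x \<boxplus>\<^bsub>B\<^esub> \<phi> y"
    "\<And>c x. x \<in> carrier A \<Longrightarrow> \<phi> (c \<odot>\<^bsub>A\<^esub> x) = c \<odot>\<^bsub>B\<^esub> \<phi> x"
    "\<And>x y. x \<in> carrier A \<Longrightarrow> y \<in> carrier A \<Longrightarrow> \<phi> (x \<boxtimes>\<^bsub>A\<^esub> y) = \<phi> x \<boxtimes>\<^bsub>B\<^esub> \<phi> y"
    "\<And>x. x \<in> carrier A \<Longrightarrow> \<phi> (x\<^sup>\<star>\<^bsub>A\<^esub>) = (\<phi> x)\<^sup>\<star>\<^bsub>B\<^esub>"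
    using hom by (auto simp: star_hom_def)
  have m: "qB (\<phi> x \<boxminus>\<^bsub>B\<^esub> \<phi> y) = qA (x \<boxminus>\<^bsub>A\<^esub> y)" if "x \<in> carrier A" "y \<in> carrier A" for x y
    using iso[of "x \<boxminus>\<^bsub>A\<^esub> y"] star_hom_minus[OF hom A.star_algebra_axioms that] that by simp
  have C: "(\<lambda>n. \<phi> (s n)) \<in> B.C" if "s \<in> A.C" for s
    using that by (auto simp: cauchy_seqs_def h m)
  have null: "((\<lambda>n. \<phi> (s n)), (\<lambda>n. \<phi> (t n))) \<in> null_rel B qB \<longleftrightarrow> (s, t) \<in> null_rel A qA"
    if st: "s \<in> A.C" "t \<in> A.C" for s t
    using C[OF st(1)] C[OF st(2)] st by (simp add: null_rel_def m A.C_carrier)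
  have cl: "\<Phi> (A.cl s) = B.cl (\<lambda>n. \<phi> (s n))" if s: "s \<in> A.C" for s
  proof -
    have r: "(rep (A.cl s), s) \<in> null_rel A qA" by (rule A.rep_cl[OF s])
    then have "((\<lambda>n. \<phi> (rep (A.cl s) n)), (\<lambda>n. \<phi> (s n))) \<in> null_rel B qB"
      using null[OF A.null_C(1)[OF r] s] by simp
    then show ?thesis unfolding \<Phi>_def by (rule B.cl_eq)
  qed
  show "star_hom A.E B.E \<Phi>"
    unfolding star_hom_def
  proof (intro conjI ballI allI)
    fix X Y assume "X \<in> carrier A.E" "Y \<in> carrier A.E"
    then obtain s t where s: "s \<in> A.C" "X = A.cl s" and t: "t \<in> A.C" "Y = A.cl t"
      by (metis A.E_cases)
    note [simp] = A.C_carrier[OF s(1)] A.C_carrier[OF t(1)] s t C cl h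
    show "\<Phi> (X \<boxplus>\<^bsub>A.E\<^esub> Y) = \<Phi> X \<boxplus>\<^bsub>B.E\<^esub> \<Phi> Y" by (simp add: A.E_plus B.E_plus A.C_plus)
    show "\<Phi> (X \<boxtimes>\<^bsub>A.E\<^esub> Y) = \<Phi> X \<boxtimes>\<^bsub>B.E\<^esub> \<Phi> Y" by (simp add: A.E_times B.E_times A.C_times)
  next
    fix X c assume "X \<in> carrier A.E"
    then obtain s where s: "s \<in> A.C" "X = A.cl s" by (metis A.E_cases)
    note [simp] = A.C_carrier[OF s(1)] s C cl h
    show "\<Phi> X \<in> carrier B.E" by (simp add: B.cl_carrier)
    show "\<Phi> (c \<odot>\<^bsub>A.E\<^esub> X) = c \<odot>\<^bsub>B.E\<^esub> \<Phi> X" by (simp add: A.E_scale B.E_scale A.C_scale)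
    show "\<Phi> (X\<^sup>\<star>\<^bsub>A.E\<^esub>) = (\<Phi> X)\<^sup>\<star>\<^bsub>B.E\<^esub>" by (simp add: A.E_star B.E_star A.C_star)
  qed
  show "inj_on \<Phi> (carrier A.E)"
  proof (rule inj_onI)
    fix X Y assume "X \<in> carrier A.E" "Y \<in> carrier A.E" and eq: "\<Phi> X = \<Phi> Y"
    then obtain s t where s: "s \<in> A.C" "X = A.cl s" and t: "t \<in> A.C" "Y = A.cl t"
      by (metis A.E_cases)
    have "((\<lambda>n. \<phi> (s n)), (\<lambda>n. \<phi> (t n))) \<in> null_rel B qB"
      using eq C s t cl by (intro B.cl_eqD) simp_all
    then have "(s, t) \<in> null_rel A qA" using null s t by simp
    then show "X = Y" using s t by (simp add: A.cl_eq)
  qed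
qed

text \<open>
  Compression by \<open>p\<close> fixes the image of \<open>A\<close>, hence termwise also its completion.
\<close>

theorem env_cstar_embeds_corner:
  assumes A: "star_algebra A" "env_finite A" and B: "star_algebra B" "env_finite B"
    and hom: "star_hom A B \<phi>" and iso: "\<And>x. x \<in> carrier A \<Longrightarrow> env_norm B (\<phi> x) = env_norm A x"
    and p: "p \<in> carrier B" "\<And>x. x \<in> carrier A \<Longrightarrow> p \<boxtimes>\<^bsub>B\<^esub> \<phi> x \<boxtimes>\<^bsub>B\<^esub> p = \<phi> x"
  shows "\<exists>\<Phi>. star_hom (env_cstar A) (corner (env_cstar B) (env_map B p)) \<Phi> \<and>
    inj_on \<Phi> (carrier (env_cstar A))"
proof -
  have sA: "seminormed_star_algebra A (env_norm A)" and sB: "seminormed_star_algebra B (env_norm B)"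
    using A B by (auto intro!: seminormed_star_algebraI star_algebra.env_norm_seminorm)
  interpret A: seminormed_star_algebra A "env_norm A" by (rule sA)
  interpret B: seminormed_star_algebra B "env_norm B" by (rule sB)
  define \<Phi> where "\<Phi> X = B.cl (\<lambda>n. \<phi> (rep X n))" for X
  note \<Phi> = completion_isometry[OF sA sB hom iso, folded \<Phi>_def[abs_def]]
  have "\<Phi> X \<in> carrier (corner B.E (B.cl (\<lambda>n. p)))" if X: "X \<in> carrier A.E" for X
  proof -
    obtain s where s: "s \<in> A.C" "X = A.cl s" using X by (rule A.E_cases)
    have r: "rep X \<in> A.C" using A.null_C(1)[OF A.rep_cl[OF s(1)]] s by simp
    then have C: "(\<lambda>n. \<phi> (rep X n)) \<in> B.C"
      using hom iso star_hom_minus[OF hom A(1), symmetric]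
      by (auto simp: cauchy_seqs_def star_hom_def)
    have "B.cl (\<lambda>n. p) \<boxtimes>\<^bsub>B.E\<^esub> \<Phi> X \<boxtimes>\<^bsub>B.E\<^esub> B.cl (\<lambda>n. p) = \<Phi> X"
      using C p A.C_carrier[OF r] by (simp add: \<Phi>_def B.E_times B.C_times B.C_const)
    moreover have "\<Phi> X \<in> carrier B.E" using \<Phi>(1) X by (simp add: star_hom_def)
    ultimately show ?thesis by (auto simp: corner_def intro: sym)
  qed
  then have "star_hom A.E (corner B.E (B.cl (\<lambda>n. p))) \<Phi>"
    using \<Phi>(1) by (simp add: star_hom_def corner_def)
  then show ?thesis unfolding env_cstar_def env_map_def using \<Phi>(2) by blast
qed

section \<open>Comparing \<open>C\<^sup>*\<close>-seminorms by growth\<close>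

text \<open>
  This is \<open>(x\<^sup>\<star> x)\<^bsup>m\<^esup>\<close> for \<open>m = 2\<^bsup>k\<^esup>\<close>.  Every member of the sequence is self-adjoint, so the
  \<open>C\<^sup>*\<close>-identity applies at each step of the squaring.
\<close>

definition iter_sq :: "('a, 'b) star_alg_scheme \<Rightarrow> 'a \<Rightarrow> nat \<Rightarrow> 'a" where
  "iter_sq A x k = ((\<lambda>z. z \<boxtimes>\<^bsub>A\<^esub> z) ^^ k) (x\<^sup>\<star>\<^bsub>A\<^esub> \<boxtimes>\<^bsub>A\<^esub> x)"

lemma iter_sq_0 [simp]: "iter_sq A x 0 = x\<^sup>\<star>\<^bsub>A\<^esub> \<boxtimes>\<^bsub>A\<^esub> x"
  and iter_sq_Suc [simp]: "iter_sq A x (Suc k) = iter_sq A x k \<boxtimes>\<^bsub>A\<^esub> iter_sq A x k"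
  by (simp_all add: iter_sq_def)

lemma (in star_algebra) iter_sq_closed [simp]: "x \<in> carrier A \<Longrightarrow> iter_sq A x k \<in> carrier A"
  by (induction k) simp_all

lemma (in star_algebra) iter_sq_star: "x \<in> carrier A \<Longrightarrow> (iter_sq A x k)\<^sup>\<star> = iter_sq A x k"
  by (induction k) (simp_all add: star_times star_star)

lemma (in seminormed_star_algebra) seminorm_iter_sq:
  assumes x: "x \<in> carrier A" shows "q (iter_sq A x k) = q x ^ 2 ^ Suc k"
proof (induction k)
  case 0 then show ?case using q_cstar[OF x] by simp
next
  case (Suc k)
  have "q (iter_sq A x (Suc k)) = (q (iter_sq A x k))\<^sup>2"
    using q_cstar[of "iter_sq A x k"] x by (simp add: iter_sq_star)
  then show ?case using Suc by (simp add: power_mult [symmetric] mult.commute)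
qed

text \<open>
  Taking \<open>2\<^bsup>k+1\<^esup>\<close>-th roots makes any factor of polynomial growth in \<open>2\<^bsup>k\<^esup>\<close> disappear.
\<close>

lemma polynomial_growth_root:
  fixes u v C :: real
  assumes u: "0 \<le> u" and v: "0 \<le> v"
    and le: "\<And>k. u ^ 2 ^ Suc k \<le> C * (2 ^ k + 1) ^ m * v ^ 2 ^ Suc k"
  shows "u \<le> v"
proof (rule ccontr)
  assume "\<not> u \<le> v"
  then have uv: "v < u" by simp
  then have u0: "0 < u" using v by simp
  define r where "r = v / u"
  have r: "0 \<le> r" "r < 1" using uv v u0 by (simp_all add: r_def)
  define f where "f n = C * (real n + 1) ^ m * r ^ (2 * n)" for n :: nat
  have ge: "1 \<le> f (2 ^ k)" for k
  proof -
    have "C * (2 ^ k + 1) ^ m * v ^ 2 ^ Suc k = f (2 ^ k) * u ^ 2 ^ Suc k"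
      using u0 by (simp add: f_def r_def power_divide)
    with le[of k] have "1 * u ^ 2 ^ Suc k \<le> f (2 ^ k) * u ^ 2 ^ Suc k" by simp
    then show ?thesis using u0 by (subst (asm) mult_le_cancel_right) (auto simp: not_less)
  qed
  have "f \<longlonglongrightarrow> 0"
  proof (cases "r = 0")
    case True
    then have "\<forall>\<^sub>F n in sequentially. f n = 0"
      using True by (auto intro!: eventually_mono[OF eventually_gt_at_top[of 0]] simp: f_def)
    then show ?thesis by (rule tendsto_eventually)
  next
    case False
    then have "0 < r" using r by simp
    then show ?thesis unfolding f_def[abs_def] using r by real_asymp
  qed
  moreover have "filterlim (\<lambda>k. 2 ^ k :: nat) at_top sequentially"
    by (rule filterlim_subseq) (auto simp: strict_mono_def)
  ultimately have "(\<lambda>k. f (2 ^ k)) \<longlonglongrightarrow> 0" by (rule filterlim_compose)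
  then have "(1::real) \<le> 0" by (rule LIMSEQ_le_const) (use ge in blast)
  then show False by simp
qed

section \<open>Representations on finitely supported functions\<close>

definition fin_supp :: "('i \<Rightarrow> complex) \<Rightarrow> bool" where
  "fin_supp \<xi> \<longleftrightarrow> finite {i. \<xi> i \<noteq> 0}"

definition l2_norm :: "('i \<Rightarrow> complex) \<Rightarrow> real" where
  "l2_norm \<xi> = L2_set (\<lambda>i. cmod (\<xi> i)) {i. \<xi> i \<noteq> 0}"

definition l2_inner :: "('i \<Rightarrow> complex) \<Rightarrow> ('i \<Rightarrow> complex) \<Rightarrow> complex" where
  "l2_inner \<xi> \<eta> = (\<Sum>i | \<xi> i \<noteq> 0. \<xi> i * cnj (\<eta> i))"

lemma l2_norm_superset:
  assumes "finite S" "{i. \<xi> i \<noteq> 0} \<subseteq> S" shows "l2_norm \<xi> = L2_set (\<lambda>i. cmod (\<xi> i)) S"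
  unfolding l2_norm_def L2_set_def using assms
  by (intro arg_cong[of _ _ sqrt] sum.mono_neutral_left) auto

lemma l2_inner_superset:
  assumes "finite S" "{i. \<xi> i \<noteq> 0} \<subseteq> S" shows "l2_inner \<xi> \<eta> = (\<Sum>i\<in>S. \<xi> i * cnj (\<eta> i))"
  unfolding l2_inner_def using assms by (intro sum.mono_neutral_left) auto

lemma l2_inner_superset_right:
  assumes "fin_supp \<xi>" "finite S" "{i. \<eta> i \<noteq> 0} \<subseteq> S" shows "l2_inner \<xi> \<eta> = (\<Sum>i\<in>S. \<xi> i * cnj (\<eta> i))"
  unfolding l2_inner_def using assms by (intro sum.mono_neutral_cong) (auto simp: fin_supp_def)

lemma norm_le_l2_norm:
  assumes "fin_supp \<xi>" shows "cmod (\<xi> i) \<le> l2_norm \<xi>"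
proof -
  have "finite (insert i {i. \<xi> i \<noteq> 0})" using assms by (simp add: fin_supp_def)
  then show ?thesis
    by (subst l2_norm_superset[of "insert i {i. \<xi> i \<noteq> 0}"]) (auto intro: member_le_L2_set)
qed

lemma l2_norm_nonneg [simp]: "0 \<le> l2_norm \<xi>"
  by (simp add: l2_norm_def)

lemma l2_inner_self: "l2_inner \<xi> \<xi> = of_real ((l2_norm \<xi>)\<^sup>2)"
proof -
  have "(l2_norm \<xi>)\<^sup>2 = (\<Sum>i | \<xi> i \<noteq> 0. (cmod (\<xi> i))\<^sup>2)"
    unfolding l2_norm_def L2_set_def by (simp add: sum_nonneg)
  then show ?thesis by (simp add: l2_inner_def complex_norm_square del: of_real_power)
qed

lemma fin_supp_plus: "fin_supp \<xi> \<Longrightarrow> fin_supp \<eta> \<Longrightarrow> fin_supp (\<lambda>i. \<xi> i + \<eta> i)"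
  unfolding fin_supp_def by (rule finite_subset[of _ "{i. \<xi> i \<noteq> 0} \<union> {i. \<eta> i \<noteq> 0}"]) auto

lemma fin_supp_scale: "fin_supp \<xi> \<Longrightarrow> fin_supp (\<lambda>i. c * \<xi> i)"
  unfolding fin_supp_def by (rule finite_subset[of _ "{i. \<xi> i \<noteq> 0}"]) auto

lemma l2_norm_triangle:
  assumes "fin_supp \<xi>" "fin_supp \<eta>" shows "l2_norm (\<lambda>i. \<xi> i + \<eta> i) \<le> l2_norm \<xi> + l2_norm \<eta>"
proof -
  let ?S = "{i. \<xi> i \<noteq> 0} \<union> {i. \<eta> i \<noteq> 0}"
  have S: "finite ?S" using assms by (simp add: fin_supp_def)
  have "l2_norm (\<lambda>i. \<xi> i + \<eta> i) = L2_set (\<lambda>i. cmod (\<xi> i + \<eta> i)) ?S" using S by (intro l2_norm_superset) auto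
  also have "\<dots> \<le> L2_set (\<lambda>i. cmod (\<xi> i) + cmod (\<eta> i)) ?S"
    by (intro L2_set_mono norm_triangle_ineq) auto
  also have "\<dots> \<le> L2_set (\<lambda>i. cmod (\<xi> i)) ?S + L2_set (\<lambda>i. cmod (\<eta> i)) ?S"
    by (rule L2_set_triangle_ineq)
  also have "\<dots> = l2_norm \<xi> + l2_norm \<eta>" using S by (simp add: l2_norm_superset[of ?S])
  finally show ?thesis .
qed

lemma l2_norm_scale: "l2_norm (\<lambda>i. c * \<xi> i) = cmod c * l2_norm \<xi>"
proof (cases "c = 0")
  case False
  then show ?thesis by (simp add: l2_norm_def norm_mult L2_set_right_distrib)
qed (simp add: l2_norm_def)

lemma l2_inner_Cauchy_Schwarz:
  assumes "fin_supp \<xi>" "fin_supp \<eta>" shows "cmod (l2_inner \<xi> \<eta>) \<le> l2_norm \<xi> * l2_norm \<eta>"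
proof -
  let ?S = "{i. \<xi> i \<noteq> 0} \<union> {i. \<eta> i \<noteq> 0}"
  have S: "finite ?S" using assms by (simp add: fin_supp_def)
  have "cmod (l2_inner \<xi> \<eta>) \<le> (\<Sum>i\<in>?S. \<bar>cmod (\<xi> i)\<bar> * \<bar>cmod (\<eta> i)\<bar>)"
    unfolding l2_inner_superset[OF S Un_upper1] by (rule order_trans[OF norm_sum]) (simp add: norm_mult)
  also have "\<dots> \<le> l2_norm \<xi> * l2_norm \<eta>"
    unfolding l2_norm_superset[OF S Un_upper1] l2_norm_superset[OF S Un_upper2] by (rule L2_set_mult_ineq)
  finally show ?thesis .
qed

text \<open>
  Operators on the pre-Hilbert space of finitely supported functions.  This space is dense in
  \<open>\<ell>\<^sup>2\<close>, so the supremum over its unit ball is the operator norm on \<open>\<ell>\<^sup>2\<close>.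
\<close>

locale l2_representation = star_algebra A for A (structure) +
  fixes T :: "'a \<Rightarrow> ('i \<Rightarrow> complex) \<Rightarrow> 'i \<Rightarrow> complex"
  assumes T_fin: "x \<in> carrier A \<Longrightarrow> fin_supp \<xi> \<Longrightarrow> fin_supp (T x \<xi>)"
    and T_plus: "x \<in> carrier A \<Longrightarrow> y \<in> carrier A \<Longrightarrow> T (x \<boxplus> y) \<xi> = (\<lambda>i. T x \<xi> i + T y \<xi> i)"
    and T_scale: "x \<in> carrier A \<Longrightarrow> T (c \<odot> x) \<xi> = (\<lambda>i. c * T x \<xi> i)"
    and T_times: "x \<in> carrier A \<Longrightarrow> y \<in> carrier A \<Longrightarrow> T (x \<boxtimes> y) \<xi> = T x (T y \<xi>)"
    and T_homogeneous: "x \<in> carrier A \<Longrightarrow> T x (\<lambda>i. c * \<xi> i) = (\<lambda>i. c * T x \<xi> i)"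
    and T_star: "x \<in> carrier A \<Longrightarrow> fin_supp \<xi> \<Longrightarrow> fin_supp \<eta> \<Longrightarrow> l2_inner (T x \<xi>) \<eta> = l2_inner \<xi> (T (x\<^sup>\<star>) \<eta>)"
    and T_bounded: "x \<in> carrier A \<Longrightarrow> \<exists>C. \<forall>\<xi>. fin_supp \<xi> \<longrightarrow> l2_norm (T x \<xi>) \<le> C * l2_norm \<xi>"
begin

definition rep_norm :: "'a \<Rightarrow> real" where
  "rep_norm x = (SUP \<xi>\<in>{\<xi>. fin_supp \<xi> \<and> l2_norm \<xi> \<le> 1}. l2_norm (T x \<xi>))"

lemma rep_norm_upper:
  assumes x: "x \<in> carrier A" and \<xi>: "fin_supp \<xi>" shows "l2_norm (T x \<xi>) \<le> rep_norm x * l2_norm \<xi>"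
proof -
  obtain C where C: "\<And>\<xi>. fin_supp \<xi> \<Longrightarrow> l2_norm (T x \<xi>) \<le> C * l2_norm \<xi>" using T_bounded[OF x] by blast
  have "l2_norm (T x \<eta>) \<le> max C 0" if "fin_supp \<eta>" "l2_norm \<eta> \<le> 1" for \<eta>
  proof -
    have "C * l2_norm \<eta> \<le> max C 0 * 1" using that by (intro mult_mono) auto
    with C[OF that(1)] show ?thesis by simp
  qed
  then have bdd: "bdd_above ((\<lambda>\<xi>. l2_norm (T x \<xi>)) ` {\<xi>. fin_supp \<xi> \<and> l2_norm \<xi> \<le> 1})" by (auto intro!: bdd_aboveI)
  show ?thesis
  proof (cases "l2_norm \<xi> = 0")
    case True with C[OF \<xi>] show ?thesis by simp
  next
    case False
    then have pos: "0 < l2_norm \<xi>" using l2_norm_nonneg[of \<xi>] by linarith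
    let ?c = "complex_of_real (1 / l2_norm \<xi>)"
    have "l2_norm (\<lambda>i. ?c * \<xi> i) = 1" unfolding l2_norm_scale using pos by (simp add: norm_divide)
    then have "l2_norm (T x (\<lambda>i. ?c * \<xi> i)) \<le> rep_norm x"
      unfolding rep_norm_def using \<xi> by (intro cSUP_upper[OF _ bdd]) (auto simp: fin_supp_scale simp del: of_real_divide)
    then show ?thesis unfolding T_homogeneous[OF x] l2_norm_scale using pos by (simp add: norm_divide field_simps)
  qed
qed

lemma rep_norm_least:
  assumes "0 \<le> C" "\<And>\<xi>. fin_supp \<xi> \<Longrightarrow> l2_norm (T x \<xi>) \<le> C * l2_norm \<xi>" shows "rep_norm x \<le> C"
  unfolding rep_norm_def
proof (rule cSUP_least)
  have "(\<lambda>i::'i. 0) \<in> {\<xi>. fin_supp \<xi> \<and> l2_norm \<xi> \<le> 1}" by (simp add: fin_supp_def l2_norm_def)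
  then show "{\<xi>::'i \<Rightarrow> complex. fin_supp \<xi> \<and> l2_norm \<xi> \<le> 1} \<noteq> {}" by blast
  fix \<xi> :: "'i \<Rightarrow> complex" assume \<xi>: "\<xi> \<in> {\<xi>. fin_supp \<xi> \<and> l2_norm \<xi> \<le> 1}"
  then have "C * l2_norm \<xi> \<le> C * 1" using assms(1) by (intro mult_left_mono) auto
  with assms(2)[of \<xi>] \<xi> show "l2_norm (T x \<xi>) \<le> C" by auto
qed

lemma rep_norm_nonneg: assumes "x \<in> carrier A" shows "0 \<le> rep_norm x"
proof -
  define \<delta> :: "'i \<Rightarrow> complex" where "\<delta> = (\<lambda>i. if i = undefined then 1 else 0)"
  have s: "{i. \<delta> i \<noteq> 0} = {undefined}" by (auto simp: \<delta>_def)
  have "fin_supp \<delta>" by (simp add: fin_supp_def s)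
  from rep_norm_upper[OF assms this] have "l2_norm (T x \<delta>) \<le> rep_norm x"
    by (simp add: l2_norm_def s) (simp add: \<delta>_def L2_set_def)
  with l2_norm_nonneg show ?thesis by (rule order_trans)
qed

text \<open>
  The \<open>C\<^sup>*\<close>-identity comes from \<open>\<parallel>T\<xi>\<parallel>\<^sup>2 = \<langle>\<xi>, T\<^sup>*T\<xi>\<rangle>\<close> and the Cauchy--Schwarz inequality.
\<close>

theorem rep_norm_cstar_seminorm: "cstar_seminorm A rep_norm"
proof -
  have times: "rep_norm (x \<boxtimes> y) \<le> rep_norm x * rep_norm y" if x: "x \<in> carrier A" and y: "y \<in> carrier A" for x y
  proof (rule rep_norm_least)
    fix \<xi> :: "'i \<Rightarrow> complex" assume \<xi>: "fin_supp \<xi>"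
    have "l2_norm (T (x \<boxtimes> y) \<xi>) \<le> rep_norm x * l2_norm (T y \<xi>)"
      using x y \<xi> by (simp add: T_times rep_norm_upper T_fin)
    also have "\<dots> \<le> rep_norm x * (rep_norm y * l2_norm \<xi>)"
      using x y \<xi> by (intro mult_left_mono rep_norm_upper rep_norm_nonneg)
    finally show "l2_norm (T (x \<boxtimes> y) \<xi>) \<le> rep_norm x * rep_norm y * l2_norm \<xi>" by (simp add: mult.assoc)
  qed (simp add: rep_norm_nonneg x y)
  have sq: "(rep_norm x)\<^sup>2 \<le> rep_norm (x\<^sup>\<star> \<boxtimes> x)" if x: "x \<in> carrier A" for x
  proof -
    have "rep_norm x \<le> sqrt (rep_norm (x\<^sup>\<star> \<boxtimes> x))"
    proof (rule rep_norm_least)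
      fix \<xi> :: "'i \<Rightarrow> complex" assume \<xi>: "fin_supp \<xi>"
      have "complex_of_real ((l2_norm (T x \<xi>))\<^sup>2) = l2_inner \<xi> (T (x\<^sup>\<star> \<boxtimes> x) \<xi>)"
        using x \<xi> by (simp add: l2_inner_self[symmetric] T_star T_fin T_times del: of_real_power)
      then have "(l2_norm (T x \<xi>))\<^sup>2 = cmod (l2_inner \<xi> (T (x\<^sup>\<star> \<boxtimes> x) \<xi>))"
        using norm_of_real[where 'a = complex, of "(l2_norm (T x \<xi>))\<^sup>2"] by (simp del: of_real_power)
      also have "\<dots> \<le> l2_norm \<xi> * l2_norm (T (x\<^sup>\<star> \<boxtimes> x) \<xi>)" using x \<xi> by (intro l2_inner_Cauchy_Schwarz T_fin) auto
      also have "\<dots> \<le> l2_norm \<xi> * (rep_norm (x\<^sup>\<star> \<boxtimes> x) * l2_norm \<xi>)" using x \<xi> by (intro mult_left_mono rep_norm_upper) auto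
      also have "\<dots> = (sqrt (rep_norm (x\<^sup>\<star> \<boxtimes> x)) * l2_norm \<xi>)\<^sup>2"
        using x by (simp add: power_mult_distrib rep_norm_nonneg power2_eq_square[of "l2_norm \<xi>"])
      finally show "l2_norm (T x \<xi>) \<le> sqrt (rep_norm (x\<^sup>\<star> \<boxtimes> x)) * l2_norm \<xi>"
        using x by (auto intro: power2_le_imp_le simp: rep_norm_nonneg)
    qed (simp add: rep_norm_nonneg x)
    then show ?thesis using x power_mono[of "rep_norm x" "sqrt (rep_norm (x\<^sup>\<star> \<boxtimes> x))" 2] by (simp add: rep_norm_nonneg)
  qed
  have star_le: "rep_norm x \<le> rep_norm (x\<^sup>\<star>)" if x: "x \<in> carrier A" for x
  proof (cases "rep_norm x = 0")
    case False
    then have "0 < rep_norm x" using rep_norm_nonneg[OF x] by simp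
    moreover have "rep_norm x * rep_norm x \<le> rep_norm (x\<^sup>\<star>) * rep_norm x"
      using sq[OF x] times[of "x\<^sup>\<star>" x] x by (simp add: power2_eq_square)
    ultimately show ?thesis by simp
  qed (simp add: rep_norm_nonneg x)
  have star: "rep_norm (x\<^sup>\<star>) = rep_norm x" if x: "x \<in> carrier A" for x
    using star_le[of x] star_le[of "x\<^sup>\<star>"] x by (simp add: star_star)
  have scale: "rep_norm (c \<odot> x) \<le> cmod c * rep_norm x" if x: "x \<in> carrier A" for c x
  proof (rule rep_norm_least)
    fix \<xi> :: "'i \<Rightarrow> complex" assume "fin_supp \<xi>"
    then have "cmod c * l2_norm (T x \<xi>) \<le> cmod c * (rep_norm x * l2_norm \<xi>)" using x by (intro mult_left_mono rep_norm_upper) auto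
    then show "l2_norm (T (c \<odot> x) \<xi>) \<le> cmod c * rep_norm x * l2_norm \<xi>" using x by (simp add: T_scale l2_norm_scale mult.assoc)
  qed (simp add: rep_norm_nonneg x)
  show ?thesis
    unfolding cstar_seminorm_def
  proof (intro conjI ballI allI)
    fix x y assume x: "x \<in> carrier A" and y: "y \<in> carrier A"
    show "0 \<le> rep_norm x" by (rule rep_norm_nonneg[OF x])
    show "rep_norm (x \<boxplus> y) \<le> rep_norm x + rep_norm y"
    proof (rule rep_norm_least)
      fix \<xi> :: "'i \<Rightarrow> complex" assume \<xi>: "fin_supp \<xi>"
      have "l2_norm (T (x \<boxplus> y) \<xi>) \<le> l2_norm (T x \<xi>) + l2_norm (T y \<xi>)"
        using x y \<xi> by (simp add: T_plus l2_norm_triangle T_fin)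
      also have "\<dots> \<le> rep_norm x * l2_norm \<xi> + rep_norm y * l2_norm \<xi>" using x y \<xi> by (intro add_mono rep_norm_upper)
      finally show "l2_norm (T (x \<boxplus> y) \<xi>) \<le> (rep_norm x + rep_norm y) * l2_norm \<xi>" by (simp add: algebra_simps)
    qed (simp add: rep_norm_nonneg x y)
    show "rep_norm (x \<boxtimes> y) \<le> rep_norm x * rep_norm y" by (rule times[OF x y])
  next
    fix x c assume x: "x \<in> carrier A"
    show "rep_norm (x\<^sup>\<star> \<boxtimes> x) = (rep_norm x)\<^sup>2"
      using sq[OF x] times[of "x\<^sup>\<star>" x] x star[OF x] by (simp add: power2_eq_square)
    show "rep_norm (c \<odot> x) = cmod c * rep_norm x"
    proof (cases "c = 0")
      case False
      then have "cmod c * rep_norm x \<le> rep_norm (c \<odot> x)"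
        using scale[of "c \<odot> x" "inverse c"] x
        by (simp add: scale_scale scale_one norm_divide divide_simps mult.commute)
      then show ?thesis using scale[OF x, of c] by simp
    next
      case True
      then show ?thesis using scale[OF x, of 0] rep_norm_nonneg[of "0 \<odot> x"] x by simp
    qed
  qed
qed

end

section \<open>Crossed products by discrete groups\<close>

lemma linf_simps [simp]:
  "carrier linf = {f. bounded (range f)}" "\<zero>\<^sub>*\<^bsub>linf\<^esub> = (\<lambda>y. 0)"
  "f \<boxplus>\<^bsub>linf\<^esub> h = (\<lambda>y. f y + h y)" "c \<odot>\<^bsub>linf\<^esub> f = (\<lambda>y. c * f y)"
  "f \<boxtimes>\<^bsub>linf\<^esub> h = (\<lambda>y. f y * h y)" "f\<^sup>\<star>\<^bsub>linf\<^esub> = (\<lambda>y. cnj (f y))"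
  "\<parallel>f\<parallel>\<^bsub>linf\<^esub> = (SUP y. cmod (f y))"
  by (simp_all add: linf_def)

lemma linf_norm_le: "(\<And>y. cmod (f y) \<le> e) \<Longrightarrow> \<parallel>f\<parallel>\<^bsub>linf\<^esub> \<le> e"
  by (simp add: cSUP_least)

lemma linf_norm_upper: "f \<in> carrier linf \<Longrightarrow> cmod (f y) \<le> \<parallel>f\<parallel>\<^bsub>linf\<^esub>"
  by (auto intro!: cSUP_upper bdd_aboveI simp: bounded_iff)

lemma linf_minus: "f \<boxminus>\<^bsub>linf\<^esub> h = (\<lambda>y. f y - h y)"
  by (simp add: minus_a_def)

lemma bounded_range_plus:
  fixes f h :: "'y \<Rightarrow> complex"
  assumes "bounded (range f)" "bounded (range h)" shows "bounded (range (\<lambda>y. f y + h y))"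
  using assms by (rule bounded_plus_comp)

lemma bounded_range_times:
  fixes f h :: "'y \<Rightarrow> complex"
  assumes "bounded (range f)" "bounded (range h)" shows "bounded (range (\<lambda>y. f y * h y))"
proof -
  obtain a b where "\<And>y. cmod (f y) \<le> a" "\<And>y. cmod (h y) \<le> b" using assms by (auto simp: bounded_iff)
  then have "cmod (f y * h y) \<le> a * b" for y by (auto simp: norm_mult intro!: mult_mono order_trans[OF norm_ge_zero])
  then show ?thesis by (auto simp: bounded_iff)
qed

text \<open>
  The form in which closedness of \<open>D\<close> is used.
\<close>

lemma linf_subalgebra_uniform_limit:
  assumes D: "cstar_subalgebra linf D" and s: "\<And>n. s n \<in> D" and e: "e \<longlonglongrightarrow> 0"
    and le: "\<And>n y. cmod (s n y - l y) \<le> e n"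
  shows "l \<in> D"
proof -
  have sb: "bounded (range (s n))" for n using D s[of n] by (auto simp: cstar_subalgebra_def)
  obtain a where a: "\<And>y. cmod (s 0 y) \<le> a" using sb[of 0] by (auto simp: bounded_iff)
  have "cmod (l y) \<le> a + e 0" for y
    using norm_triangle_ineq4[of "s 0 y" "s 0 y - l y"] a[of y] le[of 0 y] by simp
  then have lb: "l \<in> carrier linf" by (auto simp: bounded_iff)
  have db: "(\<lambda>y. s n y - l y) \<in> carrier linf" for n using le[of n] by (auto simp: bounded_iff)
  have "(\<lambda>n. \<parallel>s n \<boxminus>\<^bsub>linf\<^esub> l\<parallel>\<^bsub>linf\<^esub>) \<longlonglongrightarrow> 0"
    unfolding linf_minus
  proof (rule tendsto_zero_dominated[OF e])
    show "0 \<le> \<parallel>\<lambda>y. s n y - l y\<parallel>\<^bsub>linf\<^esub>" for n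
      using linf_norm_upper[OF db[of n], of undefined] norm_ge_zero order_trans by blast
  qed (rule linf_norm_le[OF le])
  then show ?thesis using D s lb unfolding cstar_subalgebra_def by blast
qed

text \<open>
  The number \<open>1 - \<surd>(1 - t)\<close> is the smaller fixed point of \<open>s \<mapsto> (t + s\<^sup>2) / 2\<close>.  Below it the map
  increases and contracts with the factor \<open>1 - \<surd>(1 - \<rho>)\<close>, uniformly in \<open>t \<le> \<rho>\<close>.  The iterates are
  polynomials in \<open>t\<close> without constant term, so they exist in an algebra without unit.
\<close>

lemma sqrt_iteration:
  fixes t \<rho> :: real
  assumes t: "0 \<le> t" "t \<le> \<rho>" and \<rho>: "\<rho> \<le> 1"
  defines "\<sigma> \<equiv> 1 - sqrt (1 - t)" and "\<kappa> \<equiv> 1 - sqrt (1 - \<rho>)"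
  shows "\<bar>((\<lambda>s. (t + s\<^sup>2) / 2) ^^ n) 0 - \<sigma>\<bar> \<le> \<kappa> ^ n"
proof -
  define s where "s n = ((\<lambda>s. (t + s\<^sup>2) / 2) ^^ n) 0" for n
  have \<sigma>: "0 \<le> \<sigma>" "\<sigma> \<le> \<kappa>" "\<sigma> \<le> 1" using assms by (auto simp: real_sqrt_le_1_iff)
  have fp: "\<sigma> = (t + \<sigma>\<^sup>2) / 2"
    using t \<rho> by (simp add: \<sigma>_def power2_diff)
  have "0 \<le> s n \<and> s n \<le> \<sigma> \<and> \<sigma> - s n \<le> \<kappa> ^ n"
  proof (induction n)
    case 0 then show ?case using \<sigma> by (simp add: s_def)
  next
    case (Suc n)
    have sS: "s (Suc n) = (t + (s n)\<^sup>2) / 2" by (simp add: s_def)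
    have d: "\<sigma> - s (Suc n) = (\<sigma> - s n) * ((\<sigma> + s n) / 2)"
      using fp unfolding sS by (simp add: power2_eq_square algebra_simps)
    have "\<sigma> - s (Suc n) \<le> \<kappa> ^ n * \<kappa>" unfolding d using Suc \<sigma> by (intro mult_mono) auto
    moreover have "0 \<le> \<sigma> - s (Suc n)" unfolding d using Suc \<sigma> by (intro mult_nonneg_nonneg) auto
    moreover have "0 \<le> s (Suc n)" using t by (simp add: sS)
    ultimately show ?case by (simp add: mult.commute)
  qed
  then show ?thesis unfolding s_def by (simp add: abs_if)
qed

locale crossed_system = group G for G (structure) +
  fixes act :: "'g \<Rightarrow> 'y \<Rightarrow> 'y" and D :: "('y \<Rightarrow> complex) set"
  assumes D_subalgebra: "cstar_subalgebra linf D"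
    and act_one [simp]: "act \<one> y = y"
    and act_mult: "g \<in> carrier G \<Longrightarrow> h \<in> carrier G \<Longrightarrow> act (g \<otimes> h) y = act g (act h y)"
    and D_act: "f \<in> D \<Longrightarrow> g \<in> carrier G \<Longrightarrow> f \<circ> act g \<in> D"
begin

abbreviation "CA \<equiv> crossed_alg G D (\<lambda>g f. f \<circ> act (inv g))"

abbreviation "supp F \<equiv> {g. F g \<noteq> (\<lambda>y. 0 :: complex)}"

lemma D_zero: "(\<lambda>y. 0) \<in> D"
  and D_plus: "f \<in> D \<Longrightarrow> h \<in> D \<Longrightarrow> (\<lambda>y. f y + h y) \<in> D"
  and D_scale: "f \<in> D \<Longrightarrow> (\<lambda>y. c * f y) \<in> D"
  and D_times: "f \<in> D \<Longrightarrow> h \<in> D \<Longrightarrow> (\<lambda>y. f y * h y) \<in> D"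
  and D_cnj: "f \<in> D \<Longrightarrow> (\<lambda>y. cnj (f y)) \<in> D"
  and D_bounded: "f \<in> D \<Longrightarrow> bounded (range f)"
  using D_subalgebra by (auto simp: cstar_subalgebra_def)

lemma D_act': "f \<in> D \<Longrightarrow> g \<in> carrier G \<Longrightarrow> (\<lambda>y. f (act g y)) \<in> D"
  using D_act[of f g] by (simp add: comp_def)

lemma D_sum: "finite S \<Longrightarrow> (\<And>i. i \<in> S \<Longrightarrow> f i \<in> D) \<Longrightarrow> (\<lambda>y. \<Sum>i\<in>S. f i y) \<in> D"
  by (induction rule: finite_induct) (auto simp: D_zero D_plus)

lemma D_bound: assumes "f \<in> D" obtains B where "0 \<le> B" "\<And>y. cmod (f y) \<le> B"
proof -
  obtain B where B: "\<And>y. cmod (f y) \<le> B" using D_bounded[OF assms] by (auto simp: bounded_iff)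
  then have "0 \<le> B" using order_trans[OF norm_ge_zero] by blast
  with B that show ?thesis by blast
qed

lemma act_inv: "g \<in> carrier G \<Longrightarrow> act (inv g) (act g y) = y" "g \<in> carrier G \<Longrightarrow> act g (act (inv g) y) = y"
  by (simp_all flip: act_mult)

lemma CA_I:
  assumes "\<And>g. g \<in> carrier G \<Longrightarrow> F g \<in> D" "\<And>g. g \<notin> carrier G \<Longrightarrow> F g = (\<lambda>y. 0)" "finite (supp F)"
  shows "F \<in> carrier CA"
  using assms by (simp add: crossed_alg_def)

lemma CA_D: "F \<in> carrier CA \<Longrightarrow> F g \<in> D"
  by (cases "g \<in> carrier G") (simp_all add: crossed_alg_def D_zero)

lemma CA_outside: "F \<in> carrier CA \<Longrightarrow> g \<notin> carrier G \<Longrightarrow> F g = (\<lambda>y. 0)"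
  by (simp add: crossed_alg_def)

lemma CA_finite: "F \<in> carrier CA \<Longrightarrow> finite (supp F)"
  by (simp add: crossed_alg_def)

lemma CA_supp: "F \<in> carrier CA \<Longrightarrow> supp F \<subseteq> carrier G"
  by (auto dest: CA_outside)

lemma CA_simps:
  "\<zero>\<^sub>*\<^bsub>CA\<^esub> = (\<lambda>g y. 0)" "F \<boxplus>\<^bsub>CA\<^esub> H = (\<lambda>g y. F g y + H g y)" "c \<odot>\<^bsub>CA\<^esub> F = (\<lambda>g y. c * F g y)"
  by (simp_all add: crossed_alg_def)

lemma CA_star: "F\<^sup>\<star>\<^bsub>CA\<^esub> = (\<lambda>g y. if g \<in> carrier G then cnj (F (inv g) (act (inv g) y)) else 0)"
  by (auto simp: crossed_alg_def fun_eq_iff)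

lemma CA_times:
  assumes F: "F \<in> carrier CA" and S: "finite S" "supp F \<subseteq> S" and g: "g \<in> carrier G"
  shows "(F \<boxtimes>\<^bsub>CA\<^esub> H) g y = (\<Sum>h\<in>S. F h y * H (inv h \<otimes> g) (act (inv h) y))"
proof -
  have "(F \<boxtimes>\<^bsub>CA\<^esub> H) g y = (\<Sum>h\<in>{h \<in> carrier G. F h \<noteq> (\<lambda>y. 0)}. F h y * H (inv h \<otimes> g) (act (inv h) y))"
    using g by (simp add: crossed_alg_def)
  also have "\<dots> = (\<Sum>h\<in>S. F h y * H (inv h \<otimes> g) (act (inv h) y))"
    using S CA_outside[OF F] by (intro sum.mono_neutral_left) (auto simp: fun_eq_iff)
  finally show ?thesis .
qed

lemma CA_times_outside: "g \<notin> carrier G \<Longrightarrow> (F \<boxtimes>\<^bsub>CA\<^esub> H) g = (\<lambda>y. 0)"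
  by (simp add: crossed_alg_def)

abbreviation "setprod \<equiv> \<lambda>S T. (\<lambda>(h, v). h \<otimes> v) ` (S \<times> T)"

lemma supp_times:
  assumes F: "F \<in> carrier CA" and H: "H \<in> carrier CA"
  shows "supp (F \<boxtimes>\<^bsub>CA\<^esub> H) \<subseteq> setprod (supp F) (supp H)"
proof
  fix g assume g: "g \<in> supp (F \<boxtimes>\<^bsub>CA\<^esub> H)"
  then have gG: "g \<in> carrier G" using CA_times_outside by blast
  obtain y where "(F \<boxtimes>\<^bsub>CA\<^esub> H) g y \<noteq> 0" using g by (auto simp: fun_eq_iff)
  then have "(\<Sum>h\<in>supp F. F h y * H (inv h \<otimes> g) (act (inv h) y)) \<noteq> 0"
    using CA_times[OF F CA_finite[OF F] subset_refl gG] by simp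
  then obtain h where h: "h \<in> supp F" "F h y * H (inv h \<otimes> g) (act (inv h) y) \<noteq> 0"
    by (metis (no_types, lifting) sum.neutral)
  have "h \<in> carrier G" using CA_supp[OF F] h by blast
  then have "g = h \<otimes> (inv h \<otimes> g)" using gG by (simp flip: m_assoc)
  moreover have "inv h \<otimes> g \<in> supp H" using h by auto
  ultimately show "g \<in> setprod (supp F) (supp H)" using h(1) by (auto intro!: image_eqI[of _ _ "(h, inv h \<otimes> g)"])
qed

lemma CA_plus_closed: "F \<in> carrier CA \<Longrightarrow> H \<in> carrier CA \<Longrightarrow> F \<boxplus>\<^bsub>CA\<^esub> H \<in> carrier CA"
  by (rule CA_I) (auto simp: CA_simps CA_D D_plus CA_outside
    intro: finite_subset[of _ "supp F \<union> supp H"] dest: CA_finite)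

lemma CA_scale_closed: "F \<in> carrier CA \<Longrightarrow> c \<odot>\<^bsub>CA\<^esub> F \<in> carrier CA"
  by (rule CA_I) (auto simp: CA_simps CA_D D_scale CA_outside
    intro: finite_subset[of _ "supp F"] dest: CA_finite)

lemma CA_zero_closed: "\<zero>\<^sub>*\<^bsub>CA\<^esub> \<in> carrier CA"
  by (rule CA_I) (auto simp: CA_simps D_zero)

lemma CA_times_closed:
  assumes F: "F \<in> carrier CA" and H: "H \<in> carrier CA" shows "F \<boxtimes>\<^bsub>CA\<^esub> H \<in> carrier CA"
proof (rule CA_I)
  show "(F \<boxtimes>\<^bsub>CA\<^esub> H) g \<in> D" if g: "g \<in> carrier G" for g
  proof -
    have "(F \<boxtimes>\<^bsub>CA\<^esub> H) g = (\<lambda>y. \<Sum>h\<in>supp F. F h y * H (inv h \<otimes> g) (act (inv h) y))"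
      using CA_times[OF F CA_finite[OF F] subset_refl g] by (simp add: fun_eq_iff)
    moreover have "(\<lambda>y. F h y * H (inv h \<otimes> g) (act (inv h) y)) \<in> D" if "h \<in> supp F" for h
      using that CA_supp[OF F] by (intro D_times D_act' CA_D[OF F] CA_D[OF H] inv_closed) auto
    ultimately show ?thesis using D_sum[OF CA_finite[OF F]] by simp
  qed
  show "finite (supp (F \<boxtimes>\<^bsub>CA\<^esub> H))"
    using F H by (intro finite_subset[OF supp_times[OF F H]] finite_imageI finite_cartesian_product CA_finite)
qed (rule CA_times_outside)

lemma CA_star_closed:
  assumes F: "F \<in> carrier CA" shows "F\<^sup>\<star>\<^bsub>CA\<^esub> \<in> carrier CA"
proof (rule CA_I)
  have "supp (F\<^sup>\<star>\<^bsub>CA\<^esub>) \<subseteq> (\<lambda>g. inv g) ` supp F"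
  proof
    fix g assume "g \<in> supp (F\<^sup>\<star>\<^bsub>CA\<^esub>)"
    then have "g \<in> carrier G" "inv g \<in> supp F" by (auto simp: CA_star fun_eq_iff split: if_splits)
    then show "g \<in> (\<lambda>g. inv g) ` supp F" by (intro image_eqI[of _ _ "inv g"]) auto
  qed
  then show "finite (supp (F\<^sup>\<star>\<^bsub>CA\<^esub>))" using CA_finite[OF F] finite_subset by blast
qed (auto simp: CA_star F CA_D D_act' D_cnj)

text \<open>
  Convolving with \<open>F H\<close> is convolving with \<open>H\<close> and then with \<open>F\<close>.  The weight \<open>Z\<close> is arbitrary, so that
  the same computation gives associativity of the product and multiplicativity of the regular
  representations.
\<close>

lemma conv_assoc:
  assumes F: "F \<in> carrier CA" and H: "H \<in> carrier CA" and U: "finite U" "supp (F \<boxtimes>\<^bsub>CA\<^esub> H) \<subseteq> U"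
  shows "(\<Sum>u\<in>U. (F \<boxtimes>\<^bsub>CA\<^esub> H) u y * Z u) =
    (\<Sum>h\<in>supp F. F h y * (\<Sum>v\<in>supp H. H v (act (inv h) y) * Z (h \<otimes> v)))"
proof -
  let ?V = "setprod (supp F) (supp H)"
  have V: "finite ?V" using F H by (intro finite_imageI finite_cartesian_product CA_finite)
  have VG: "?V \<subseteq> carrier G" using CA_supp[OF F] CA_supp[OF H] by auto
  have "(\<Sum>u\<in>U. (F \<boxtimes>\<^bsub>CA\<^esub> H) u y * Z u) = (\<Sum>u\<in>U \<inter> ?V. (F \<boxtimes>\<^bsub>CA\<^esub> H) u y * Z u)"
    using U supp_times[OF F H] by (intro sum.mono_neutral_right) (auto simp: fun_eq_iff)
  also have "\<dots> = (\<Sum>u\<in>?V. (F \<boxtimes>\<^bsub>CA\<^esub> H) u y * Z u)"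
    using U V by (intro sum.mono_neutral_left) (auto simp: fun_eq_iff)
  also have "\<dots> = (\<Sum>u\<in>?V. \<Sum>h\<in>supp F. F h y * H (inv h \<otimes> u) (act (inv h) y) * Z u)"
  proof (rule sum.cong[OF refl])
    fix u assume "u \<in> ?V"
    then have "u \<in> carrier G" using VG by blast
    then show "(F \<boxtimes>\<^bsub>CA\<^esub> H) u y * Z u = (\<Sum>h\<in>supp F. F h y * H (inv h \<otimes> u) (act (inv h) y) * Z u)"
      by (simp add: CA_times[OF F CA_finite[OF F] subset_refl] sum_distrib_right)
  qed
  also have "\<dots> = (\<Sum>h\<in>supp F. F h y * (\<Sum>u\<in>?V. H (inv h \<otimes> u) (act (inv h) y) * Z u))"
    by (subst sum.swap) (simp add: sum_distrib_left mult.assoc)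
  also have "\<dots> = (\<Sum>h\<in>supp F. F h y * (\<Sum>v\<in>supp H. H v (act (inv h) y) * Z (h \<otimes> v)))"
  proof (rule sum.cong[OF refl], rule arg_cong2[of _ _ _ _ "(*)", OF refl])
    fix h assume h: "h \<in> supp F"
    then have hG: "h \<in> carrier G" using CA_supp[OF F] by blast
    have inj: "inj_on (\<lambda>v. h \<otimes> v) (supp H)"
      by (rule inj_on_subset[OF inj_on_cmult[OF hG] CA_supp[OF H]])
    have "(\<Sum>u\<in>?V. H (inv h \<otimes> u) (act (inv h) y) * Z u) =
        (\<Sum>u\<in>(\<lambda>v. h \<otimes> v) ` supp H. H (inv h \<otimes> u) (act (inv h) y) * Z u)"
    proof (intro sum.mono_neutral_right V ballI)
      show "(\<lambda>v. h \<otimes> v) ` supp H \<subseteq> ?V" using h by auto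
      fix u assume u: "u \<in> ?V - (\<lambda>v. h \<otimes> v) ` supp H"
      then have "u = h \<otimes> (inv h \<otimes> u)" using VG hG by (auto simp flip: m_assoc)
      then have "inv h \<otimes> u \<notin> supp H" using u by blast
      then show "H (inv h \<otimes> u) (act (inv h) y) * Z u = 0" by simp
    qed
    also have "\<dots> = (\<Sum>v\<in>supp H. H v (act (inv h) y) * Z (h \<otimes> v))"
      unfolding sum.reindex[OF inj] using CA_supp[OF H] hG
      by (intro sum.cong refl) (auto simp flip: m_assoc)
    finally show "(\<Sum>u\<in>?V. H (inv h \<otimes> u) (act (inv h) y) * Z u) = (\<Sum>v\<in>supp H. H v (act (inv h) y) * Z (h \<otimes> v))" .
  qed
  finally show ?thesis .
qed

lemma inv_mult_assoc:
  "h \<in> carrier G \<Longrightarrow> v \<in> carrier G \<Longrightarrow> g \<in> carrier G \<Longrightarrow> inv (h \<otimes> v) \<otimes> g = inv v \<otimes> (inv h \<otimes> g)"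
  by (simp add: inv_mult_group m_assoc)

lemma act_inv_mult: "h \<in> carrier G \<Longrightarrow> v \<in> carrier G \<Longrightarrow> act (inv (h \<otimes> v)) y = act (inv v) (act (inv h) y)"
  by (simp add: inv_mult_group act_mult)

lemma CA_times_assoc:
  assumes F: "F \<in> carrier CA" and H: "H \<in> carrier CA" and K: "K \<in> carrier CA"
  shows "F \<boxtimes>\<^bsub>CA\<^esub> H \<boxtimes>\<^bsub>CA\<^esub> K = F \<boxtimes>\<^bsub>CA\<^esub> (H \<boxtimes>\<^bsub>CA\<^esub> K)"
proof (intro ext)
  fix g y
  note FH = CA_times_closed[OF F H]
  show "(F \<boxtimes>\<^bsub>CA\<^esub> H \<boxtimes>\<^bsub>CA\<^esub> K) g y = (F \<boxtimes>\<^bsub>CA\<^esub> (H \<boxtimes>\<^bsub>CA\<^esub> K)) g y"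
  proof (cases "g \<in> carrier G")
    case g: True
    have "(F \<boxtimes>\<^bsub>CA\<^esub> H \<boxtimes>\<^bsub>CA\<^esub> K) g y =
      (\<Sum>h\<in>supp F. F h y * (\<Sum>v\<in>supp H. H v (act (inv h) y) *
        K (inv (h \<otimes> v) \<otimes> g) (act (inv (h \<otimes> v)) y)))"
      unfolding CA_times[OF FH CA_finite[OF FH] subset_refl g]
      by (rule conv_assoc[OF F H CA_finite[OF FH] subset_refl])
    also have "\<dots> = (\<Sum>h\<in>supp F. F h y * (H \<boxtimes>\<^bsub>CA\<^esub> K) (inv h \<otimes> g) (act (inv h) y))"
    proof (intro sum.cong refl arg_cong2[of _ _ _ _ "(*)"])
      fix h assume "h \<in> supp F"
      then have h: "h \<in> carrier G" using CA_supp[OF F] by blast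
      then have "inv h \<otimes> g \<in> carrier G" using g by simp
      from CA_times[OF H CA_finite[OF H] subset_refl this]
      show "(\<Sum>v\<in>supp H. H v (act (inv h) y) * K (inv (h \<otimes> v) \<otimes> g) (act (inv (h \<otimes> v)) y))
        = (H \<boxtimes>\<^bsub>CA\<^esub> K) (inv h \<otimes> g) (act (inv h) y)"
        using CA_supp[OF H] h g by (auto simp: inv_mult_assoc act_inv_mult intro!: sum.cong)
    qed
    also have "\<dots> = (F \<boxtimes>\<^bsub>CA\<^esub> (H \<boxtimes>\<^bsub>CA\<^esub> K)) g y"
      using CA_times[OF F CA_finite[OF F] subset_refl g] by simp
    finally show ?thesis .
  qed (simp add: CA_times_outside)
qed

lemma CA_star_times:
  assumes F: "F \<in> carrier CA" and H: "H \<in> carrier CA"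
  shows "(F \<boxtimes>\<^bsub>CA\<^esub> H)\<^sup>\<star>\<^bsub>CA\<^esub> = H\<^sup>\<star>\<^bsub>CA\<^esub> \<boxtimes>\<^bsub>CA\<^esub> F\<^sup>\<star>\<^bsub>CA\<^esub>"
proof (intro ext)
  fix g y
  note Hs = CA_star_closed[OF H]
  show "((F \<boxtimes>\<^bsub>CA\<^esub> H)\<^sup>\<star>\<^bsub>CA\<^esub>) g y = (H\<^sup>\<star>\<^bsub>CA\<^esub> \<boxtimes>\<^bsub>CA\<^esub> F\<^sup>\<star>\<^bsub>CA\<^esub>) g y"
  proof (cases "g \<in> carrier G")
    case g: True
    let ?f = "\<lambda>k. cnj (F k (act (inv g) y)) * cnj (H (inv k \<otimes> inv g) (act (inv k) (act (inv g) y)))"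
    have inj: "inj_on (\<lambda>k. g \<otimes> k) (supp F)"
      by (rule inj_on_subset[OF inj_on_cmult[OF g] CA_supp[OF F]])
    have fin: "finite ((\<lambda>k. g \<otimes> k) ` supp F \<union> supp (H\<^sup>\<star>\<^bsub>CA\<^esub>))" (is "finite ?S")
      using CA_finite[OF F] CA_finite[OF Hs] by simp
    have "(H\<^sup>\<star>\<^bsub>CA\<^esub> \<boxtimes>\<^bsub>CA\<^esub> F\<^sup>\<star>\<^bsub>CA\<^esub>) g y =
      (\<Sum>j\<in>?S. (H\<^sup>\<star>\<^bsub>CA\<^esub>) j y * (F\<^sup>\<star>\<^bsub>CA\<^esub>) (inv j \<otimes> g) (act (inv j) y))"
      by (rule CA_times[OF Hs fin _ g]) simp
    also have "\<dots> = (\<Sum>j\<in>(\<lambda>k. g \<otimes> k) ` supp F. (H\<^sup>\<star>\<^bsub>CA\<^esub>) j y * (F\<^sup>\<star>\<^bsub>CA\<^esub>) (inv j \<otimes> g) (act (inv j) y))"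
    proof (intro sum.mono_neutral_right fin ballI)
      fix j assume j: "j \<in> ?S - (\<lambda>k. g \<otimes> k) ` supp F"
      then have jG: "j \<in> carrier G" using CA_supp[OF Hs] by blast
      then have "j = g \<otimes> (inv g \<otimes> j)" using g by (simp flip: m_assoc)
      then have "inv g \<otimes> j \<notin> supp F" using j by blast
      moreover have "inv (inv j \<otimes> g) = inv g \<otimes> j" using jG g by (simp add: inv_mult_group)
      ultimately show "(H\<^sup>\<star>\<^bsub>CA\<^esub>) j y * (F\<^sup>\<star>\<^bsub>CA\<^esub>) (inv j \<otimes> g) (act (inv j) y) = 0"
        by (simp add: CA_star)
    qed auto
    also have "\<dots> = (\<Sum>k\<in>supp F. ?f k)"
      unfolding sum.reindex[OF inj]
    proof (intro sum.cong refl)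
      fix k assume "k \<in> supp F"
      then have k: "k \<in> carrier G" using CA_supp[OF F] by blast
      have e: "inv (g \<otimes> k) \<otimes> g = inv k" "act (inv (g \<otimes> k)) y = act (inv k) (act (inv g) y)"
        using k g by (simp_all add: inv_mult_group m_assoc act_mult)
      show "((\<lambda>j. (H\<^sup>\<star>\<^bsub>CA\<^esub>) j y * (F\<^sup>\<star>\<^bsub>CA\<^esub>) (inv j \<otimes> g) (act (inv j) y)) \<circ> (\<otimes>) g) k = ?f k"
        using k g by (simp add: e CA_star act_inv) (simp add: inv_mult_group mult.commute)
    qed
    also have "\<dots> = ((F \<boxtimes>\<^bsub>CA\<^esub> H)\<^sup>\<star>\<^bsub>CA\<^esub>) g y"
      using g CA_times[OF F CA_finite[OF F] subset_refl, of "inv g"] by (simp add: CA_star)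
    finally show ?thesis by simp
  qed (simp add: CA_times_outside CA_star)
qed

lemma CA_times_eqI:
  assumes "\<And>g y. g \<in> carrier G \<Longrightarrow> (F \<boxtimes>\<^bsub>CA\<^esub> H) g y = K g y" "\<And>g. g \<notin> carrier G \<Longrightarrow> K g = (\<lambda>y. 0)"
  shows "F \<boxtimes>\<^bsub>CA\<^esub> H = K"
proof (intro ext)
  show "(F \<boxtimes>\<^bsub>CA\<^esub> H) g y = K g y" for g y
    using assms CA_times_outside by (cases "g \<in> carrier G") auto
qed

lemma CA_star_algebra: "star_algebra CA"
proof (unfold_locales, goal_cases)
  case (15 F H K)
  note c = CA_times_closed[OF 15(1,3)] CA_times_closed[OF 15(2,3)]
  have fin: "finite (supp F \<union> supp H)" using 15 CA_finite by simp
  show ?case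
  proof (rule CA_times_eqI)
    fix g y assume g: "g \<in> carrier G"
    show "((F \<boxplus>\<^bsub>CA\<^esub> H) \<boxtimes>\<^bsub>CA\<^esub> K) g y = ((F \<boxtimes>\<^bsub>CA\<^esub> K) \<boxplus>\<^bsub>CA\<^esub> (H \<boxtimes>\<^bsub>CA\<^esub> K)) g y"
      by (subst CA_times[OF CA_plus_closed[OF 15(1,2)] fin _ g])
        (auto simp: CA_simps CA_times[OF 15(1) fin _ g] CA_times[OF 15(2) fin _ g] distrib_right sum.distrib)
  qed (simp add: CA_simps CA_outside[OF c(1)] CA_outside[OF c(2)])
next
  case (16 F H K)
  note c = CA_times_closed[OF 16(3,1)] CA_times_closed[OF 16(3,2)]
  note t = CA_times[OF 16(3) CA_finite[OF 16(3)] subset_refl]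
  show ?case
    by (rule CA_times_eqI)
      (simp_all add: t CA_outside[OF c(1)] CA_outside[OF c(2)], simp_all add: CA_simps t distrib_left sum.distrib
        CA_outside[OF c(1)] CA_outside[OF c(2)])
next
  case (17 F H c)
  have fin: "finite (supp F)" using 17 CA_finite by simp
  show ?case
  proof (rule CA_times_eqI)
    fix g y assume g: "g \<in> carrier G"
    show "((c \<odot>\<^bsub>CA\<^esub> F) \<boxtimes>\<^bsub>CA\<^esub> H) g y = (c \<odot>\<^bsub>CA\<^esub> (F \<boxtimes>\<^bsub>CA\<^esub> H)) g y"
      by (subst CA_times[OF CA_scale_closed[OF 17(1)] fin _ g])
        (auto simp: CA_simps CA_times[OF 17(1) fin _ g] sum_distrib_left mult.assoc)
  qed (simp add: CA_simps CA_outside[OF CA_times_closed[OF 17]])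
next
  case (18 F H c)
  note t = CA_times[OF 18(1) CA_finite[OF 18(1)] subset_refl]
  show ?case
    by (rule CA_times_eqI)
      (simp_all add: t, simp_all add: CA_simps t sum_distrib_left mult.left_commute CA_outside[OF CA_times_closed[OF 18]])
next
  case (19 F)
  then show ?case using CA_outside[OF 19] by (auto simp: CA_star act_inv fun_eq_iff)
qed (auto simp: CA_zero_closed CA_plus_closed CA_scale_closed CA_times_closed CA_star_closed
  CA_times_assoc CA_star_times, auto simp: CA_simps CA_star fun_eq_iff algebra_simps)

subsection \<open>The regular representations\<close>

text \<open>
  The representation induced from evaluation at \<open>y\<close>: on \<open>\<ell>\<^sup>2(G)\<close>, a function \<open>f \<in> D\<close> multiplies by its values
  along the orbit of \<open>y\<close>, and \<open>G\<close> acts by left translation.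
\<close>

definition regular_rep :: "'y \<Rightarrow> ('g \<Rightarrow> 'y \<Rightarrow> complex) \<Rightarrow> ('g \<Rightarrow> complex) \<Rightarrow> 'g \<Rightarrow> complex" where
  "regular_rep y F \<xi> = (\<lambda>g. if g \<in> carrier G then \<Sum>k\<in>supp F. F k (act g y) * \<xi> (inv k \<otimes> g) else 0)"

lemma regular_rep_superset:
  assumes "finite S" "supp F \<subseteq> S" "g \<in> carrier G"
  shows "regular_rep y F \<xi> g = (\<Sum>k\<in>S. F k (act g y) * \<xi> (inv k \<otimes> g))"
  unfolding regular_rep_def using assms by (auto intro!: sum.mono_neutral_left)

lemma inv_shift: "k \<in> carrier G \<Longrightarrow> g \<in> carrier G \<Longrightarrow> k \<otimes> (inv k \<otimes> g) = g"
    "k \<in> carrier G \<Longrightarrow> g \<in> carrier G \<Longrightarrow> inv k \<otimes> (k \<otimes> g) = g"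
  by (simp_all flip: m_assoc)

lemma inj_on_inv: "S \<subseteq> carrier G \<Longrightarrow> inj_on (\<lambda>k. inv k) S"
  by (intro inj_onI) (metis inv_inv subsetD)

lemma shift_finite:
  assumes "finite {i. \<xi> i \<noteq> 0}" "k \<in> carrier G"
  shows "finite {g \<in> carrier G. \<xi> (inv k \<otimes> g) \<noteq> 0}"
proof (rule finite_subset)
  show "{g \<in> carrier G. \<xi> (inv k \<otimes> g) \<noteq> 0} \<subseteq> (\<lambda>g. k \<otimes> g) ` {i. \<xi> i \<noteq> 0}"
    using assms(2) by (auto intro!: image_eqI[of _ _ "inv k \<otimes> _"] simp: inv_shift)
qed (simp add: assms)

lemma regular_rep_fin:
  assumes F: "F \<in> carrier CA" and \<xi>: "fin_supp \<xi>" shows "fin_supp (regular_rep y F \<xi>)"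
  unfolding fin_supp_def
proof (rule finite_subset)
  show "{g. regular_rep y F \<xi> g \<noteq> 0} \<subseteq> (\<Union>k\<in>supp F. {g \<in> carrier G. \<xi> (inv k \<otimes> g) \<noteq> 0})"
  proof
    fix g assume "g \<in> {g. regular_rep y F \<xi> g \<noteq> 0}"
    then have g: "g \<in> carrier G" "(\<Sum>k\<in>supp F. F k (act g y) * \<xi> (inv k \<otimes> g)) \<noteq> 0"
      by (auto simp: regular_rep_def split: if_splits)
    then obtain k where "k \<in> supp F" "F k (act g y) * \<xi> (inv k \<otimes> g) \<noteq> 0"
      by (metis (no_types, lifting) sum.neutral)
    then show "g \<in> (\<Union>k\<in>supp F. {g \<in> carrier G. \<xi> (inv k \<otimes> g) \<noteq> 0})" using g by auto
  qed
  show "finite (\<Union>k\<in>supp F. {g \<in> carrier G. \<xi> (inv k \<otimes> g) \<noteq> 0})"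
    using CA_finite[OF F] CA_supp[OF F] \<xi> by (intro finite_UN_I shift_finite) (auto simp: fin_supp_def)
qed

lemma regular_rep_star:
  assumes F: "F \<in> carrier CA" and \<xi>: "fin_supp \<xi>" and \<eta>: "fin_supp \<eta>"
  shows "l2_inner (regular_rep y F \<xi>) \<eta> = l2_inner \<xi> (regular_rep y (F\<^sup>\<star>\<^bsub>CA\<^esub>) \<eta>)"
proof -
  let ?A = "{g \<in> carrier G. \<eta> g \<noteq> 0}" and ?B = "{g \<in> carrier G. \<xi> g \<noteq> 0}"
  have fin: "finite ?A" "finite ?B" using \<xi> \<eta> by (auto simp: fin_supp_def)
  note Fs = CA_star_closed[OF F]
  have "l2_inner (regular_rep y F \<xi>) \<eta> = (\<Sum>g | \<eta> g \<noteq> 0. regular_rep y F \<xi> g * cnj (\<eta> g))"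
    using \<eta> regular_rep_fin[OF F \<xi>] by (intro l2_inner_superset_right) (auto simp: fin_supp_def)
  also have "\<dots> = (\<Sum>g\<in>?A. regular_rep y F \<xi> g * cnj (\<eta> g))"
    using \<eta> by (intro sum.mono_neutral_right) (auto simp: fin_supp_def regular_rep_def)
  also have "\<dots> = (\<Sum>g\<in>?A. \<Sum>k\<in>supp F. F k (act g y) * \<xi> (inv k \<otimes> g) * cnj (\<eta> g))"
    by (intro sum.cong refl) (simp add: regular_rep_def sum_distrib_right)
  also have "\<dots> = (\<Sum>k\<in>supp F. \<Sum>g\<in>?A. F k (act g y) * \<xi> (inv k \<otimes> g) * cnj (\<eta> g))"
    by (rule sum.swap)
  also have "\<dots> = (\<Sum>k\<in>supp F. \<Sum>g\<in>?B. F k (act (k \<otimes> g) y) * \<xi> g * cnj (\<eta> (k \<otimes> g)))"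
  proof (rule sum.cong[OF refl])
    fix k assume "k \<in> supp F"
    then have k: "k \<in> carrier G" using CA_supp[OF F] by blast
    have fin': "finite {g \<in> ?A. \<xi> (inv k \<otimes> g) = 0}" "finite {g \<in> ?B. \<eta> (k \<otimes> g) = 0}"
      by (rule finite_subset[OF _ fin(1)], blast) (rule finite_subset[OF _ fin(2)], blast)
    show "(\<Sum>g\<in>?A. F k (act g y) * \<xi> (inv k \<otimes> g) * cnj (\<eta> g)) =
        (\<Sum>g\<in>?B. F k (act (k \<otimes> g) y) * \<xi> g * cnj (\<eta> (k \<otimes> g)))"
      using k
      by (intro sum.reindex_bij_witness_not_neutral[OF fin', where i = "\<lambda>g. k \<otimes> g" and j = "\<lambda>g. inv k \<otimes> g"])
        (auto simp: inv_shift)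
  qed
  also have "\<dots> = (\<Sum>k\<in>(\<lambda>k. inv k) ` supp F. \<Sum>g\<in>?B. \<xi> g * cnj ((F\<^sup>\<star>\<^bsub>CA\<^esub>) k (act g y) * \<eta> (inv k \<otimes> g)))"
  proof -
    have "F k (act (k \<otimes> g) y) * \<xi> g * cnj (\<eta> (k \<otimes> g)) =
        \<xi> g * cnj ((F\<^sup>\<star>\<^bsub>CA\<^esub>) (inv k) (act g y) * \<eta> (inv (inv k) \<otimes> g))"
      if "k \<in> supp F" "g \<in> ?B" for k g
    proof -
      have "k \<in> carrier G" "g \<in> carrier G" using that CA_supp[OF F] by auto
      then show ?thesis by (simp add: CA_star act_mult)
    qed
    then show ?thesis
      unfolding sum.reindex[OF inj_on_inv[OF CA_supp[OF F]]] o_apply by (intro sum.cong refl)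
  qed
  also have "\<dots> = (\<Sum>g\<in>?B. \<xi> g * cnj (regular_rep y (F\<^sup>\<star>\<^bsub>CA\<^esub>) \<eta> g))"
  proof (subst sum.swap, rule sum.cong[OF refl])
    fix g assume g: "g \<in> ?B"
    have "supp (F\<^sup>\<star>\<^bsub>CA\<^esub>) \<subseteq> (\<lambda>k. inv k) ` supp F"
    proof
      fix k assume k: "k \<in> supp (F\<^sup>\<star>\<^bsub>CA\<^esub>)"
      then have "k \<in> carrier G" "inv k \<in> supp F" by (auto simp: CA_star fun_eq_iff split: if_splits)
      then show "k \<in> (\<lambda>k. inv k) ` supp F" by (intro image_eqI[of _ _ "inv k"]) auto
    qed
    then show "(\<Sum>k\<in>(\<lambda>k. inv k) ` supp F. \<xi> g * cnj ((F\<^sup>\<star>\<^bsub>CA\<^esub>) k (act g y) * \<eta> (inv k \<otimes> g))) =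
        \<xi> g * cnj (regular_rep y (F\<^sup>\<star>\<^bsub>CA\<^esub>) \<eta> g)"
      using g by (subst regular_rep_superset[of "(\<lambda>k. inv k) ` supp F"])
        (auto simp: CA_finite[OF F] sum_distrib_left)
  qed
  also have "\<dots> = l2_inner \<xi> (regular_rep y (F\<^sup>\<star>\<^bsub>CA\<^esub>) \<eta>)"
    unfolding l2_inner_def using \<xi> by (intro sum.mono_neutral_left) (auto simp: fin_supp_def regular_rep_def)
  finally show ?thesis .
qed

lemma l2_norm_shift_le:
  assumes \<xi>: "fin_supp \<xi>" and k: "k \<in> carrier G" and B: "0 \<le> B" "\<And>g. cmod (f g) \<le> B"
  defines "\<zeta> \<equiv> \<lambda>g. if g \<in> carrier G then f g * \<xi> (inv k \<otimes> g) else 0"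
  shows "fin_supp \<zeta>" "l2_norm \<zeta> \<le> B * l2_norm \<xi>"
proof -
  let ?S = "{g \<in> carrier G. \<xi> (inv k \<otimes> g) \<noteq> 0}"
  have S: "finite ?S" using \<xi> k by (intro shift_finite) (auto simp: fin_supp_def)
  have sub: "{g. \<zeta> g \<noteq> 0} \<subseteq> ?S" by (auto simp: \<zeta>_def split: if_splits)
  show "fin_supp \<zeta>" unfolding fin_supp_def by (rule finite_subset[OF sub S])
  have "l2_norm \<zeta> = L2_set (\<lambda>g. cmod (\<zeta> g)) ?S" by (rule l2_norm_superset[OF S sub])
  also have "\<dots> \<le> L2_set (\<lambda>g. B * cmod (\<xi> (inv k \<otimes> g))) ?S"
    using B by (intro L2_set_mono) (auto simp: \<zeta>_def norm_mult intro!: mult_right_mono)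
  also have "\<dots> = B * L2_set (\<lambda>g. cmod (\<xi> (inv k \<otimes> g))) ?S" using B by (simp add: L2_set_right_distrib)
  also have "L2_set (\<lambda>g. cmod (\<xi> (inv k \<otimes> g))) ?S = L2_set (\<lambda>g. cmod (\<xi> g)) {g \<in> carrier G. \<xi> g \<noteq> 0}"
    unfolding L2_set_def using k
    by (intro arg_cong[of _ _ sqrt] sum.reindex_bij_witness[of _ "\<lambda>g. k \<otimes> g" "\<lambda>g. inv k \<otimes> g"])
      (auto simp: inv_shift)
  also have "\<dots> \<le> l2_norm \<xi>"
    unfolding l2_norm_def L2_set_def using \<xi> by (intro real_sqrt_le_mono sum_mono2) (auto simp: fin_supp_def)
  finally show "l2_norm \<zeta> \<le> B * l2_norm \<xi>" using B by (simp add: mult_left_mono)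
qed

lemma regular_rep_bounded:
  assumes F: "F \<in> carrier CA"
  shows "\<exists>C. \<forall>\<xi>. fin_supp \<xi> \<longrightarrow> l2_norm (regular_rep y F \<xi>) \<le> C * l2_norm \<xi>"
proof -
  have "\<exists>B. 0 \<le> B \<and> (\<forall>x. cmod (F k x) \<le> B)" for k using D_bound[OF CA_D[OF F]] by metis
  then obtain B where B: "\<And>k. 0 \<le> B k" "\<And>k x. cmod (F k x) \<le> B k" by metis
  define t where "t k \<xi> g = (if g \<in> carrier G then F k (act g y) * \<xi> (inv k \<otimes> g) else 0)" for k \<xi> g
  have "fin_supp (\<lambda>g. \<Sum>k\<in>S. t k \<xi> g) \<and> l2_norm (\<lambda>g. \<Sum>k\<in>S. t k \<xi> g) \<le> (\<Sum>k\<in>S. B k) * l2_norm \<xi>"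
    if "finite S" "S \<subseteq> carrier G" and \<xi>: "fin_supp \<xi>" for S \<xi>
    using that(1,2)
  proof (induction rule: finite_induct)
    case empty then show ?case by (simp add: fin_supp_def l2_norm_def)
  next
    case (insert k S)
    have k: "fin_supp (t k \<xi>)" "l2_norm (t k \<xi>) \<le> B k * l2_norm \<xi>"
      unfolding t_def using l2_norm_shift_le[OF \<xi>, of k "B k" "\<lambda>g. F k (act g y)"] B insert by auto
    with insert l2_norm_triangle[OF k(1), of "\<lambda>g. \<Sum>k\<in>S. t k \<xi> g"] show ?case
      by (simp add: fin_supp_plus algebra_simps)
  qed
  moreover have "regular_rep y F \<xi> = (\<lambda>g. \<Sum>k\<in>supp F. t k \<xi> g)" for \<xi>
    by (auto simp: regular_rep_def t_def)
  ultimately show ?thesis using CA_finite[OF F] CA_supp[OF F] by metis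
qed

lemma regular_rep_times:
  assumes F: "F \<in> carrier CA" and H: "H \<in> carrier CA"
  shows "regular_rep y (F \<boxtimes>\<^bsub>CA\<^esub> H) \<xi> = regular_rep y F (regular_rep y H \<xi>)"
proof
  fix g
  show "regular_rep y (F \<boxtimes>\<^bsub>CA\<^esub> H) \<xi> g = regular_rep y F (regular_rep y H \<xi>) g"
  proof (cases "g \<in> carrier G")
    case g: True
    have "regular_rep y (F \<boxtimes>\<^bsub>CA\<^esub> H) \<xi> g =
      (\<Sum>h\<in>supp F. F h (act g y) * (\<Sum>v\<in>supp H. H v (act (inv h) (act g y)) * \<xi> (inv (h \<otimes> v) \<otimes> g)))"
      using conv_assoc[OF F H CA_finite[OF CA_times_closed[OF F H]] subset_refl, of "act g y" "\<lambda>u. \<xi> (inv u \<otimes> g)"] g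
      by (simp add: regular_rep_def)
    also have "\<dots> = (\<Sum>h\<in>supp F. F h (act g y) * regular_rep y H \<xi> (inv h \<otimes> g))"
    proof (rule sum.cong[OF refl], rule arg_cong2[of _ _ _ _ "(*)", OF refl])
      fix h assume "h \<in> supp F"
      then have h: "h \<in> carrier G" using CA_supp[OF F] by blast
      show "(\<Sum>v\<in>supp H. H v (act (inv h) (act g y)) * \<xi> (inv (h \<otimes> v) \<otimes> g)) = regular_rep y H \<xi> (inv h \<otimes> g)"
        using g h CA_supp[OF H]
        by (auto simp: regular_rep_def act_mult inv_mult_assoc intro!: sum.cong)
    qed
    also have "\<dots> = regular_rep y F (regular_rep y H \<xi>) g"
      using g by (simp add: regular_rep_def)
    finally show ?thesis .
  qed (simp add: regular_rep_def)
qed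

lemma regular_rep_l2: "l2_representation CA (regular_rep y)"
proof (intro l2_representation.intro CA_star_algebra l2_representation_axioms.intro)
  fix F H and \<xi> :: "'g \<Rightarrow> complex" and c
  assume F: "F \<in> carrier CA"
  show "fin_supp (regular_rep y F \<xi>)" if "fin_supp \<xi>" using F that by (rule regular_rep_fin)
  show "\<exists>C. \<forall>\<xi>. fin_supp \<xi> \<longrightarrow> l2_norm (regular_rep y F \<xi>) \<le> C * l2_norm \<xi>" using F by (rule regular_rep_bounded)
  show "regular_rep y F (\<lambda>i. c * \<xi> i) = (\<lambda>i. c * regular_rep y F \<xi> i)"
    by (auto simp: regular_rep_def sum_distrib_left mult.left_commute)
  show "regular_rep y (c \<odot>\<^bsub>CA\<^esub> F) \<xi> = (\<lambda>i. c * regular_rep y F \<xi> i)"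
  proof
    fix g show "regular_rep y (c \<odot>\<^bsub>CA\<^esub> F) \<xi> g = c * regular_rep y F \<xi> g"
    proof (cases "g \<in> carrier G")
      case True
      then show ?thesis using CA_finite[OF F]
        by (subst regular_rep_superset[of "supp F"])
          (auto simp: CA_simps regular_rep_def sum_distrib_left mult.assoc)
    qed (simp add: regular_rep_def)
  qed
  show "l2_inner (regular_rep y F \<xi>) \<eta> = l2_inner \<xi> (regular_rep y (F\<^sup>\<star>\<^bsub>CA\<^esub>) \<eta>)" if "fin_supp \<xi>" "fin_supp \<eta>" for \<eta>
    using F that by (rule regular_rep_star)
  assume H: "H \<in> carrier CA"
  show "regular_rep y (F \<boxtimes>\<^bsub>CA\<^esub> H) \<xi> = regular_rep y F (regular_rep y H \<xi>)"
    using F H by (rule regular_rep_times)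
  show "regular_rep y (F \<boxplus>\<^bsub>CA\<^esub> H) \<xi> = (\<lambda>i. regular_rep y F \<xi> i + regular_rep y H \<xi> i)"
  proof
    fix g
    have fin: "finite (supp F \<union> supp H)" using F H CA_finite by simp
    show "regular_rep y (F \<boxplus>\<^bsub>CA\<^esub> H) \<xi> g = regular_rep y F \<xi> g + regular_rep y H \<xi> g"
    proof (cases "g \<in> carrier G")
      case True
      note t = regular_rep_superset[OF fin _ True]
      show ?thesis
        by (subst t, force simp: CA_simps, subst t, force, subst t, force)
          (simp add: CA_simps distrib_right sum.distrib)
    qed (simp add: regular_rep_def)
  qed
qed

subsection \<open>The norm of homogeneous elements\<close>

definition homogeneous :: "'g \<Rightarrow> ('y \<Rightarrow> complex) \<Rightarrow> 'g \<Rightarrow> 'y \<Rightarrow> complex" where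
  "homogeneous k f = (\<lambda>g. if g = k then f else (\<lambda>y. 0))"

lemma homogeneous_closed: "f \<in> D \<Longrightarrow> k \<in> carrier G \<Longrightarrow> homogeneous k f \<in> carrier CA"
  by (rule CA_I) (auto simp: homogeneous_def D_zero)

lemma homogeneous_times_one:
  assumes "f \<in> D" "k \<in> carrier G"
  shows "homogeneous \<one> f \<boxtimes>\<^bsub>CA\<^esub> homogeneous k h = homogeneous k (\<lambda>y. f y * h y)"
proof (rule CA_times_eqI)
  fix g y assume "g \<in> carrier G"
  then show "(homogeneous \<one> f \<boxtimes>\<^bsub>CA\<^esub> homogeneous k h) g y = homogeneous k (\<lambda>y. f y * h y) g y"
    by (subst CA_times[of _ "{\<one>}"]) (auto simp: homogeneous_closed assms, auto simp: homogeneous_def)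
qed (auto simp: homogeneous_def assms)

lemma homogeneous_star_one: "(homogeneous \<one> f)\<^sup>\<star>\<^bsub>CA\<^esub> = homogeneous \<one> (\<lambda>y. cnj (f y))"
  by (auto simp: CA_star homogeneous_def fun_eq_iff inv_eq_1_iff)

lemma homogeneous_star_times:
  assumes f: "f \<in> D" and k: "k \<in> carrier G"
  shows "(homogeneous k f)\<^sup>\<star>\<^bsub>CA\<^esub> \<boxtimes>\<^bsub>CA\<^esub> homogeneous k f = homogeneous \<one> (\<lambda>y. of_real ((cmod (f (act k y)))\<^sup>2))"
proof (rule CA_times_eqI)
  fix g y assume g: "g \<in> carrier G"
  have 1: "supp ((homogeneous k f)\<^sup>\<star>\<^bsub>CA\<^esub>) \<subseteq> {inv k}"
    using k inv_inv by (fastforce simp: CA_star homogeneous_def fun_eq_iff split: if_splits)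
  show "((homogeneous k f)\<^sup>\<star>\<^bsub>CA\<^esub> \<boxtimes>\<^bsub>CA\<^esub> homogeneous k f) g y = homogeneous \<one> (\<lambda>y. of_real ((cmod (f (act k y)))\<^sup>2)) g y"
    using g k
    by (subst CA_times[OF CA_star_closed[OF homogeneous_closed[OF f k]] _ 1 g])
      (auto simp: CA_star homogeneous_def act_inv complex_norm_square mult.commute simp del: of_real_power)
qed (auto simp: homogeneous_def)

text \<open>
  \<open>D\<close> has no unit in general, so the square root \<open>\<surd>(1 - f)\<close> is represented by its difference to 1.
\<close>

lemma D_one_minus_sqrt:
  assumes f: "f \<in> D" and t: "\<And>y. f y = of_real (t y)" "\<And>y. 0 \<le> t y" "\<And>y. t y \<le> \<rho>" and \<rho>: "\<rho> < 1"
  shows "(\<lambda>y. of_real (1 - sqrt (1 - t y))) \<in> D"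
proof -
  define s where "s n y = ((\<lambda>s. (t y + s\<^sup>2) / 2) ^^ n) 0" for n y
  have "0 \<le> \<rho>" using t(2,3) order_trans by blast
  show ?thesis
  proof (rule linf_subalgebra_uniform_limit[OF D_subalgebra])
    show "(\<lambda>y. of_real (s n y)) \<in> D" for n
    proof (induction n)
      case 0 then show ?case by (simp add: s_def D_zero)
    next
      case (Suc n)
      have "(\<lambda>y. (1 / 2) * (f y + of_real (s n y) * of_real (s n y))) \<in> D"
        by (intro D_scale D_plus D_times f Suc)
      then show ?case by (simp add: s_def t power2_eq_square)
    qed
    show "(\<lambda>n. (1 - sqrt (1 - \<rho>)) ^ n) \<longlonglongrightarrow> 0"
      using \<rho> \<open>0 \<le> \<rho>\<close> by (intro LIMSEQ_realpow_zero) (auto simp: real_sqrt_le_1_iff)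
    show "cmod (complex_of_real (s n y) - of_real (1 - sqrt (1 - t y))) \<le> (1 - sqrt (1 - \<rho>)) ^ n" for n y
      using sqrt_iteration[OF t(2)[of y] t(3)[of y], of n] \<rho>
      unfolding s_def of_real_diff[symmetric] norm_of_real by simp
  qed
qed

text \<open>
  With \<open>c = \<surd>(1 - f\<^sup>2)\<close> the functions \<open>f \<plusminus> \<i> c\<close> are unitary, so multiplication by them preserves \<open>q\<close>.  Their
  average is \<open>f\<close>, whence \<open>q (f\<^sup>2) \<le> q (f)\<close>.  As \<open>c\<close> itself need not lie in \<open>D\<close>, the unitaries occur only
  multiplied by \<open>f\<close>.
\<close>

lemma seminorm_contraction_le:
  assumes q: "cstar_seminorm CA q" and f: "f \<in> D" and a: "\<And>y. f y = of_real (a y)" "\<And>y. \<bar>a y\<bar> \<le> r" and r: "r < 1"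
  shows "q (homogeneous \<one> f) \<le> 1"
proof -
  interpret seminormed_star_algebra CA q by (rule seminormed_star_algebraI[OF CA_star_algebra q])
  let ?e = "homogeneous \<one>"
  have a1: "(a y)\<^sup>2 \<le> r\<^sup>2" "(a y)\<^sup>2 < 1" for y
  proof -
    show *: "(a y)\<^sup>2 \<le> r\<^sup>2" using a(2)[of y] by (simp add: abs_le_square_iff[symmetric])
    have "0 \<le> r" using a(2)[of y] by linarith
    then have "r\<^sup>2 < 1" using r by (simp add: power_less_one_iff abs_square_less_1)
    with * show "(a y)\<^sup>2 < 1" by simp
  qed
  have "0 \<le> r" using a(2)[of undefined] by linarith
  then have r1: "r\<^sup>2 < 1" using r by (simp add: abs_square_less_1)
  define c where "c y = sqrt (1 - (a y)\<^sup>2)" for y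
  have c: "(c y)\<^sup>2 = 1 - (a y)\<^sup>2" for y using a1(2)[of y] by (simp add: c_def)
  have "(\<lambda>y. of_real (1 - c y)) \<in> D"
    unfolding c_def
  proof (rule D_one_minus_sqrt[of "\<lambda>y. f y * f y" _ "r\<^sup>2"])
    show "(\<lambda>y. f y * f y) \<in> D" by (intro D_times f)
    show "f y * f y = complex_of_real ((a y)\<^sup>2)" for y by (simp add: a(1) power2_eq_square)
  qed (auto simp: a1 r1)
  then have s: "(\<lambda>y. of_real (1 - c y)) \<in> D" .
  \<comment> \<open>The product of the unitary \<open>f + \<epsilon> c\<close>, where \<open>\<epsilon> = \<plusminus>\<i>\<close>, with \<open>f\<close>; written with \<open>1 - c\<close>, which lies in \<open>D\<close>.\<close>
  define w where "w \<epsilon> y = f y * f y + \<epsilon> * (f y + (-1) * (of_real (1 - c y) * f y))" for \<epsilon> y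
  have wD: "w \<epsilon> \<in> D" for \<epsilon>
    unfolding w_def[abs_def] by (intro D_plus D_times D_scale f s)
  have w: "w \<epsilon> y = of_real (a y) * (of_real (a y) + \<epsilon> * of_real (c y))" for \<epsilon> y
    by (simp add: w_def a(1) algebra_simps)
  have ww: "cnj (w \<epsilon> y) * w \<epsilon> y = cnj (f y) * f y" if "\<epsilon> = \<i> \<or> \<epsilon> = - \<i>" for \<epsilon> y
  proof -
    have "(complex_of_real (c y))\<^sup>2 = 1 - (complex_of_real (a y))\<^sup>2"
      using arg_cong[OF c[of y], of complex_of_real] by simp
    moreover have "cnj (w \<epsilon> y) * w \<epsilon> y = (of_real (a y))\<^sup>2 * ((of_real (a y))\<^sup>2 + (of_real (c y))\<^sup>2)"
      using that by (auto simp: w power2_eq_square algebra_simps)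
    ultimately show ?thesis by (simp add: a(1) power2_eq_square)
  qed
  have qw: "q (?e (w \<epsilon>)) = q (?e f)" if "\<epsilon> = \<i> \<or> \<epsilon> = - \<i>" for \<epsilon>
  proof -
    have "(q (?e (w \<epsilon>)))\<^sup>2 = q (?e (\<lambda>y. cnj (w \<epsilon> y) * w \<epsilon> y))"
      using q_cstar[OF homogeneous_closed[OF wD one_closed]] by (simp add: homogeneous_star_one homogeneous_times_one D_cnj wD)
    also have "\<dots> = (q (?e f))\<^sup>2"
      using q_cstar[OF homogeneous_closed[OF f one_closed]] that by (simp add: homogeneous_star_one homogeneous_times_one D_cnj f ww)
    finally show ?thesis
      using q_nonneg[OF homogeneous_closed[OF f one_closed]] q_nonneg[OF homogeneous_closed[OF wD one_closed]] by (simp add: power2_eq_iff_nonneg)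
  qed
  have "(q (?e f))\<^sup>2 = q (?e (\<lambda>y. cnj (f y) * f y))"
    using q_cstar[OF homogeneous_closed[OF f one_closed]] by (simp add: homogeneous_star_one homogeneous_times_one D_cnj f)
  also have "?e (\<lambda>y. cnj (f y) * f y) = (1/2) \<odot>\<^bsub>CA\<^esub> (?e (w \<i>) \<boxplus>\<^bsub>CA\<^esub> ?e (w (- \<i>)))"
    by (auto simp: CA_simps homogeneous_def fun_eq_iff w a(1) field_simps)
  also have "q \<dots> \<le> 1/2 * (q (?e (w \<i>)) + q (?e (w (- \<i>))))"
    using homogeneous_closed[OF wD one_closed] by (simp add: q_scale q_triangle norm_divide)
  also have "\<dots> = q (?e f)" by (simp add: qw)
  finally have "q (?e f) * q (?e f) \<le> q (?e f) * 1" by (simp add: power2_eq_square)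
  then show ?thesis using q_nonneg[OF homogeneous_closed[OF f one_closed]]
    by (cases "q (?e f) = 0") (auto simp: mult_le_cancel_left)
qed

text \<open>
  The bound holds for every \<open>C > B\<close> by scaling \<open>f\<close> to supremum norm less than 1.
\<close>

lemma seminorm_real_le:
  assumes q: "cstar_seminorm CA q" and f: "f \<in> D" and a: "\<And>y. f y = of_real (a y)" "\<And>y. \<bar>a y\<bar> \<le> B"
  shows "q (homogeneous \<one> f) \<le> B"
proof (rule dense_ge)
  interpret seminormed_star_algebra CA q by (rule seminormed_star_algebraI[OF CA_star_algebra q])
  fix C assume C: "B < C"
  have B0: "0 \<le> B" using a(2)[of undefined] by linarith
  with C have C0: "0 < C" by simp
  have "q (homogeneous \<one> (\<lambda>y. of_real (1 / C) * f y)) \<le> 1"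
    using C C0 a(2) by (intro seminorm_contraction_le[OF q, where r = "B / C" and a = "\<lambda>y. a y / C"] D_scale f)
      (auto simp: a(1) abs_div divide_right_mono)
  moreover have "homogeneous \<one> (\<lambda>y. of_real (1 / C) * f y) = of_real (1 / C) \<odot>\<^bsub>CA\<^esub> homogeneous \<one> f"
    by (auto simp: CA_simps homogeneous_def fun_eq_iff)
  ultimately show "q (homogeneous \<one> f) \<le> C"
    using C0 by (simp add: q_scale homogeneous_closed f norm_divide field_simps)
qed

lemma seminorm_homogeneous_le:
  assumes q: "cstar_seminorm CA q" and f: "f \<in> D" and k: "k \<in> carrier G" and B: "\<And>y. cmod (f y) \<le> B"
  shows "q (homogeneous k f) \<le> B"
proof -
  interpret seminormed_star_algebra CA q by (rule seminormed_star_algebraI[OF CA_star_algebra q])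
  have B0: "0 \<le> B" using B order_trans[OF norm_ge_zero] by blast
  have "(\<lambda>y. cnj (f (act k y)) * f (act k y)) \<in> D" by (intro D_times D_cnj D_act' f k)
  then have "(\<lambda>y. complex_of_real ((cmod (f (act k y)))\<^sup>2)) \<in> D"
    by (simp add: complex_norm_square mult.commute del: of_real_power)
  then have "q (homogeneous \<one> (\<lambda>y. of_real ((cmod (f (act k y)))\<^sup>2))) \<le> B\<^sup>2"
    by (rule seminorm_real_le[OF q, where a = "\<lambda>y. (cmod (f (act k y)))\<^sup>2"]) (auto intro: power_mono B)
  then have "(q (homogeneous k f))\<^sup>2 \<le> B\<^sup>2"
    using q_cstar[OF homogeneous_closed[OF f k]] homogeneous_star_times[OF f k] by simp
  then show ?thesis using B0 by (rule power2_le_imp_le)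
qed

lemma seminorm_bounded:
  assumes "finite S" "F \<in> carrier CA" "supp F \<subseteq> S"
  shows "\<exists>B. \<forall>q. cstar_seminorm CA q \<longrightarrow> q F \<le> B"
  using assms
proof (induction S arbitrary: F rule: finite_induct)
  case empty
  then have F: "F = homogeneous \<one> (\<lambda>y. 0)" by (auto simp: homogeneous_def fun_eq_iff)
  have "q F \<le> 0" if "cstar_seminorm CA q" for q
    unfolding F by (rule seminorm_homogeneous_le[OF that D_zero one_closed]) simp
  then show ?case by blast
next
  case (insert k S F)
  let ?F = "\<lambda>g. if g = k then (\<lambda>y. 0) else F g"
  have F': "?F \<in> carrier CA"
  proof (rule CA_I)
    show "finite (supp ?F)" using CA_finite[OF insert(4)] by (rule rev_finite_subset) auto
  qed (use CA_D[OF insert(4)] CA_outside[OF insert(4)] D_zero in auto)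
  obtain B where B: "\<And>q. cstar_seminorm CA q \<Longrightarrow> q ?F \<le> B"
  proof -
    have "supp ?F \<subseteq> S" using insert(5) by auto
    from insert(3)[OF F' this] that show thesis by blast
  qed
  show ?case
  proof (cases "k \<in> carrier G")
    case k: True
    obtain C where C: "\<And>y. cmod (F k y) \<le> C" using D_bound[OF CA_D[OF insert(4)]] by metis
    have eq: "F = ?F \<boxplus>\<^bsub>CA\<^esub> homogeneous k (F k)" by (auto simp: CA_simps homogeneous_def fun_eq_iff)
    have "q F \<le> B + C" if q: "cstar_seminorm CA q" for q
    proof -
      interpret seminormed_star_algebra CA q by (rule seminormed_star_algebraI[OF CA_star_algebra q])
      have "q F \<le> q ?F + q (homogeneous k (F k))"
        by (subst eq) (intro q_triangle F' homogeneous_closed CA_D insert(4) k)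
      also have "\<dots> \<le> B + C" by (intro add_mono B q seminorm_homogeneous_le CA_D insert(4) k C)
      finally show ?thesis .
    qed
    then show ?thesis by blast
  next
    case False
    then have "?F = F" using CA_outside[OF insert(4)] by (auto simp: fun_eq_iff)
    then show ?thesis using B by metis
  qed
qed

theorem CA_env_finite: "env_finite CA"
  unfolding env_finite_def
proof (intro ballI)
  fix F assume F: "F \<in> carrier CA"
  obtain B where "\<forall>q. cstar_seminorm CA q \<longrightarrow> q F \<le> B" using seminorm_bounded[OF CA_finite[OF F] F] by auto
  then show "bdd_above ((\<lambda>q. q F) ` {q. cstar_seminorm CA q})" by (intro bdd_aboveI[of _ B]) blast
qed

text \<open>
  \<open>F(k)(y)\<close> is the matrix entry at \<open>(1, k\<^sup>-\<^sup>1)\<close> of \<open>F\<close> in the regular representation attached to \<open>y\<close>.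
\<close>

theorem coeff_le_env_norm:
  assumes F: "F \<in> carrier CA" shows "cmod (F k y) \<le> env_norm CA F"
proof (cases "k \<in> carrier G")
  case k: True
  interpret l2_representation CA "regular_rep y" by (rule regular_rep_l2)
  define \<delta> :: "'g \<Rightarrow> complex" where "\<delta> = (\<lambda>g. if g = inv k then 1 else 0)"
  have s: "{g. \<delta> g \<noteq> 0} = {inv k}" by (auto simp: \<delta>_def)
  have \<delta>: "fin_supp \<delta>" "l2_norm \<delta> = 1" unfolding fin_supp_def l2_norm_def s by (auto simp: \<delta>_def L2_set_def)
  have "regular_rep y F \<delta> \<one> = (\<Sum>h\<in>supp F \<union> {k}. F h y * \<delta> (inv h))"
    using CA_finite[OF F] by (subst regular_rep_superset[of "supp F \<union> {k}"])
      (use CA_supp[OF F] k in \<open>auto intro!: sum.cong\<close>)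
  also have "\<dots> = (\<Sum>h\<in>supp F \<union> {k}. if h = k then F k y else 0)"
  proof (rule sum.cong[OF refl])
    fix h assume "h \<in> supp F \<union> {k}"
    then have "inv h = inv k \<longleftrightarrow> h = k" using CA_supp[OF F] k by (metis inv_inv UnE singletonD subsetD)
    then show "F h y * \<delta> (inv h) = (if h = k then F k y else 0)" by (auto simp: \<delta>_def)
  qed
  also have "\<dots> = F k y" using CA_finite[OF F] by simp
  finally have "cmod (F k y) \<le> l2_norm (regular_rep y F \<delta>)"
    using norm_le_l2_norm[OF regular_rep_fin[OF F \<delta>(1)], of y \<one>] by simp
  also have "\<dots> \<le> rep_norm F" using rep_norm_upper[OF F \<delta>(1)] \<delta>(2) by simp
  also have "\<dots> \<le> env_norm CA F" by (rule env_norm_upper[OF CA_env_finite rep_norm_cstar_seminorm F])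
  finally show ?thesis .
next
  case False
  have "0 \<le> env_norm CA F" using env_norm_upper[OF CA_env_finite zero_seminorm F] .
  then show ?thesis using CA_outside[OF F False] by simp
qed

theorem env_norm_homogeneous_le:
  assumes "F \<in> carrier CA" "supp F \<subseteq> {k}" "k \<in> carrier G" "\<And>y. cmod (F k y) \<le> B"
  shows "env_norm CA F \<le> B"
proof -
  have "F = homogeneous k (F k)" using assms(2) by (auto simp: homogeneous_def fun_eq_iff)
  then show ?thesis using seminorm_homogeneous_le[OF _ CA_D[OF assms(1)] assms(3,4)] by (metis env_norm_least)
qed

end

section \<open>Sums over cosets\<close>

definition add_subgroup :: "'a::ab_group_add set \<Rightarrow> bool" where
  "add_subgroup L \<longleftrightarrow> 0 \<in> L \<and> (\<forall>x\<in>L. \<forall>y\<in>L. x - y \<in> L)"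

definition periodic :: "'a::ab_group_add set \<Rightarrow> ('a \<Rightarrow> 'b) \<Rightarrow> bool" where
  "periodic L g \<longleftrightarrow> (\<forall>x. \<forall>l\<in>L. g (x + l) = g x)"

definition transversal :: "'a::ab_group_add set \<Rightarrow> 'a set \<Rightarrow> 'a set \<Rightarrow> bool" where
  "transversal L X Y \<longleftrightarrow> finite Y \<and> (\<forall>x\<in>X. \<exists>!y. y \<in> Y \<and> x - y \<in> L)"

text \<open>
  The sum over \<open>K/L\<close> of an \<open>L\<close>-periodic function that is supported on finitely many cosets of \<open>L\<close>.  It is
  summed over a set of representatives of the cosets that meet the support.
\<close>

definition coset_sum :: "'a::ab_group_add set \<Rightarrow> ('a \<Rightarrow> complex) \<Rightarrow> complex" where
  "coset_sum L g = (\<Sum>y\<in>(SOME Y. transversal L {x. g x \<noteq> 0} Y). g y)"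

definition index :: "'a::ab_group_add set \<Rightarrow> 'a set \<Rightarrow> nat" where
  "index L I = card ((\<lambda>x. (+) x ` I) ` L)"

lemma add_subgroup_uminus: "add_subgroup L \<Longrightarrow> x \<in> L \<Longrightarrow> - x \<in> L"
  unfolding add_subgroup_def by (metis diff_0)

lemma add_subgroup_add: "add_subgroup L \<Longrightarrow> x \<in> L \<Longrightarrow> y \<in> L \<Longrightarrow> x + y \<in> L"
  unfolding add_subgroup_def by (metis diff_0 diff_minus_eq_add)

lemma add_subgroup_diff_commute: "add_subgroup L \<Longrightarrow> x - y \<in> L \<longleftrightarrow> y - x \<in> L"
  using add_subgroup_uminus[of L "x - y"] add_subgroup_uminus[of L "y - x"] by auto

lemma add_subgroup_diff_trans:
  "add_subgroup L \<Longrightarrow> x - y \<in> L \<Longrightarrow> y - z \<in> L \<Longrightarrow> x - z \<in> L"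
  using add_subgroup_add[of L "x - y" "y - z"] by simp

lemma periodic_diff: "periodic L g \<Longrightarrow> x - y \<in> L \<Longrightarrow> g x = g y"
  unfolding periodic_def by (metis add.commute diff_add_cancel)

lemma transversal_mono: "transversal L X Y \<Longrightarrow> X' \<subseteq> X \<Longrightarrow> transversal L X' Y"
  unfolding transversal_def by blast

text \<open>
  Group the elements of \<open>X\<close> by the members of \<open>F\<close> to which they are congruent; these groups are
  finite in number and are the congruence classes.
\<close>

lemma transversal_exists:
  assumes L: "add_subgroup L" and F: "finite F" "\<And>x. x \<in> X \<Longrightarrow> \<exists>y\<in>F. x - y \<in> L"
  obtains Y where "transversal L X Y" "Y \<subseteq> X"
proof -
  define cl where "cl x = {y \<in> F. x - y \<in> L}" for x
  define r where "r c = (SOME x. x \<in> X \<and> cl x = c)" for c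
  have r: "r (cl x) \<in> X" "cl (r (cl x)) = cl x" if "x \<in> X" for x
    using someI[of "\<lambda>x'. x' \<in> X \<and> cl x' = cl x" x] that by (auto simp: r_def)
  have cl: "cl x = cl x' \<longleftrightarrow> x - x' \<in> L" if x: "x \<in> X" for x x'
  proof
    assume eq: "cl x = cl x'"
    obtain y where "y \<in> F" "x - y \<in> L" using F(2)[OF x] by blast
    then have "x - y \<in> L" "x' - y \<in> L" using eq by (auto simp: cl_def)
    then show "x - x' \<in> L" using L by (metis add_subgroup_diff_commute add_subgroup_diff_trans)
  next
    assume "x - x' \<in> L"
    then have "x - y \<in> L \<longleftrightarrow> x' - y \<in> L" for y
      using L by (metis add_subgroup_diff_commute add_subgroup_diff_trans)
    then show "cl x = cl x'" by (auto simp: cl_def)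
  qed
  have fin: "finite (cl ` X)" by (rule finite_subset[of _ "Pow F"]) (auto simp: cl_def F)
  have "transversal L X (r ` cl ` X)"
    unfolding transversal_def
  proof (intro conjI ballI)
    fix x assume x: "x \<in> X"
    show "\<exists>!y. y \<in> r ` cl ` X \<and> x - y \<in> L"
    proof (rule ex1I[of _ "r (cl x)"])
      show "r (cl x) \<in> r ` cl ` X \<and> x - r (cl x) \<in> L" using x r[OF x] cl[OF x] by auto
      fix y assume y: "y \<in> r ` cl ` X \<and> x - y \<in> L"
      then obtain x' where x': "x' \<in> X" "y = r (cl x')" by blast
      then have "cl y = cl x'" using r by simp
      moreover have "cl x = cl y" using y cl[OF x] by blast
      ultimately show "y = r (cl x)" using x' by simp
    qed
  qed (use fin in simp)
  moreover have "r ` cl ` X \<subseteq> X" using r by auto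
  ultimately show thesis by (rule that)
qed

lemma sum_transversal_unique:
  assumes L: "add_subgroup L" and g: "periodic L g"
    and Y: "transversal L {x. g x \<noteq> 0} Y" and Y': "transversal L {x. g x \<noteq> 0} Y'"
  shows "sum g Y = sum (g :: _ \<Rightarrow> complex) Y'"
proof -
  define j where "j Z x = (THE y. y \<in> Z \<and> x - y \<in> L)" for Z x
  have j: "j Z x \<in> Z" "x - j Z x \<in> L" "\<And>z. z \<in> Z \<Longrightarrow> x - z \<in> L \<Longrightarrow> j Z x = z"
    if "transversal L {x. g x \<noteq> 0} Z" "g x \<noteq> 0" for Z x
  proof -
    have ex: "\<exists>!y. y \<in> Z \<and> x - y \<in> L" using that by (simp add: transversal_def)
    from theI'[OF ex] show "j Z x \<in> Z" "x - j Z x \<in> L" by (simp_all add: j_def)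
    with ex show "\<And>z. z \<in> Z \<Longrightarrow> x - z \<in> L \<Longrightarrow> j Z x = z" by blast
  qed
  have gj: "g (j Z x) = g x" if "transversal L {x. g x \<noteq> 0} Z" "g x \<noteq> 0" for Z x
    using periodic_diff[OF g j(2)[OF that]] by simp
  have jj: "j W (j Z x) = x" if "transversal L {x. g x \<noteq> 0} Z" "transversal L {x. g x \<noteq> 0} W" "g x \<noteq> 0" "x \<in> W" for Z W x
    using j(3)[OF that(2), of "j Z x" x] gj[OF that(1,3)] that(3,4) j(2)[OF that(1,3)]
      add_subgroup_diff_commute[OF L] by metis
  have fin: "finite Y" "finite Y'" using Y Y' by (auto simp: transversal_def)
  have "sum g Y = sum g {y \<in> Y. g y \<noteq> 0}" using fin by (intro sum.mono_neutral_right) auto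
  also have "\<dots> = sum g {y \<in> Y'. g y \<noteq> 0}"
    by (rule sum.reindex_bij_witness[where i = "j Y" and j = "j Y'"])
      (auto simp: jj[OF Y' Y] jj[OF Y Y'] j(1)[OF Y] j(1)[OF Y'] gj[OF Y] gj[OF Y'])
  also have "\<dots> = sum g Y'" using fin by (intro sum.mono_neutral_left) auto
  finally show ?thesis .
qed

lemma coset_sum_eq:
  assumes L: "add_subgroup L" and g: "periodic L g" and Y: "transversal L X Y" "{x. g x \<noteq> 0} \<subseteq> X"
  shows "coset_sum L g = sum g Y"
proof -
  have Y': "transversal L {x. g x \<noteq> 0} Y" using transversal_mono[OF Y] .
  then have "transversal L {x. g x \<noteq> 0} (SOME Y. transversal L {x. g x \<noteq> 0} Y)" by (rule someI)
  from sum_transversal_unique[OF L g this Y'] show ?thesis by (simp add: coset_sum_def)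
qed

lemma card_transversal:
  assumes I: "add_subgroup I" and Z: "transversal I L Z" "Z \<subseteq> L"
  shows "card Z = index L I"
proof -
  have mem: "(+) x ` I = (+) y ` I \<longleftrightarrow> x - y \<in> I" for x y
  proof
    assume eq: "(+) x ` I = (+) y ` I"
    have "x \<in> (+) x ` I" using I by (force simp: add_subgroup_def)
    then show "x - y \<in> I" unfolding eq by auto
  next
    have *: "(+) x ` I \<subseteq> (+) y ` I" if "x - y \<in> I" for x y
    proof
      fix z assume "z \<in> (+) x ` I"
      then obtain i where "i \<in> I" "z = x + i" by blast
      then have "z = y + ((x - y) + i)" "(x - y) + i \<in> I" using that add_subgroup_add[OF I] by auto
      then show "z \<in> (+) y ` I" by blast
    qed
    assume "x - y \<in> I" then show "(+) x ` I = (+) y ` I" using * add_subgroup_diff_commute[OF I] by blast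
  qed
  have "bij_betw (\<lambda>x. (+) x ` I) Z ((\<lambda>x. (+) x ` I) ` L)"
    unfolding bij_betw_def
  proof
    show "inj_on (\<lambda>x. (+) x ` I) Z"
    proof (rule inj_onI)
      fix x y assume xy: "x \<in> Z" "y \<in> Z" "(+) x ` I = (+) y ` I"
      then have "x - y \<in> I" "x - x \<in> I" "x \<in> L" using mem Z I by (auto simp: add_subgroup_def)
      then show "x = y" using Z xy unfolding transversal_def by blast
    qed
    show "(\<lambda>x. (+) x ` I) ` Z = (\<lambda>x. (+) x ` I) ` L"
    proof (intro equalityI subsetI)
      fix C assume "C \<in> (\<lambda>x. (+) x ` I) ` L"
      then obtain x where x: "x \<in> L" "C = (+) x ` I" by blast
      then obtain y where "y \<in> Z" "x - y \<in> I" using Z unfolding transversal_def by blast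
      then show "C \<in> (\<lambda>x. (+) x ` I) ` Z" using mem x by blast
    qed (use Z in auto)
  qed
  then show ?thesis unfolding index_def by (rule bij_betw_same_card)
qed

text \<open>
  Every coset of \<open>L\<close> consists of \<open>[L : I]\<close> cosets of \<open>I\<close>.
\<close>

lemma coset_sum_index:
  assumes L: "add_subgroup L" and I: "add_subgroup I" "I \<subseteq> L" and g: "periodic L g"
    and Z: "transversal I L Z" "Z \<subseteq> L" and Y: "transversal L {x. g x \<noteq> 0} Y" "Y \<subseteq> {x. g x \<noteq> 0}"
  shows "coset_sum I g = of_nat (index L I) * coset_sum L g"
proof -
  let ?W = "(\<lambda>(y, z). y + z) ` (Y \<times> Z)"
  have gI: "periodic I g" using g I by (auto simp: periodic_def)
  have fin: "finite Y" "finite Z" using Y Z by (auto simp: transversal_def)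
  have uY: "y = y'" if "y \<in> Y" "y' \<in> Y" "x - y \<in> L" "x - y' \<in> L" "g x \<noteq> 0" for x y y'
    using Y(1) that unfolding transversal_def by blast
  have uZ: "z = z'" if "z \<in> Z" "z' \<in> Z" "x - z \<in> I" "x - z' \<in> I" "x \<in> L" for x z z'
    using Z(1) that unfolding transversal_def by blast
  have inj: "inj_on (\<lambda>(y, z). y + z) (Y \<times> Z)"
  proof (rule inj_onI, clarify)
    fix y z y' z' assume yz: "y \<in> Y" "z \<in> Z" "y' \<in> Y" "z' \<in> Z" and eq: "y + z = y' + z'"
    then have "y - y' = z' - z" by (simp add: algebra_simps)
    moreover have "z' - z \<in> L" using yz Z L unfolding add_subgroup_def by blast
    ultimately have "y - y' \<in> L" "y - y \<in> L" using L by (auto simp: add_subgroup_def)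
    then have "y = y'" using uY[of y y' y] yz Y(2) by blast
    then show "y = y' \<and> z = z'" using eq by simp
  qed
  have "transversal I {x. g x \<noteq> 0} ?W"
    unfolding transversal_def
  proof (intro conjI ballI)
    fix x assume x: "x \<in> {x. g x \<noteq> 0}"
    obtain y where y: "y \<in> Y" "x - y \<in> L" using Y(1) x unfolding transversal_def by blast
    then obtain z where z: "z \<in> Z" "x - y - z \<in> I" using Z(1) unfolding transversal_def by blast
    show "\<exists>!w. w \<in> ?W \<and> x - w \<in> I"
    proof (rule ex1I[of _ "y + z"])
      show "y + z \<in> ?W \<and> x - (y + z) \<in> I" using y z by (auto simp: diff_diff_eq)
      fix w assume w: "w \<in> ?W \<and> x - w \<in> I"
      then obtain y' z' where w': "y' \<in> Y" "z' \<in> Z" "w = y' + z'" by auto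
      have "x - y' = (x - w) + z'" using w' by (simp add: algebra_simps)
      moreover have "(x - w) + z' \<in> L" using w w' I(2) Z(2) by (intro add_subgroup_add[OF L]) blast+
      ultimately have "x - y' \<in> L" by (simp only:)
      then have yy: "y' = y" using uY y w' x by blast
      then have "x - y - z' \<in> I" using w w' by (simp add: diff_diff_eq)
      then have "z' = z" using uZ z w' y by blast
      then show "w = y + z" using yy w' by simp
    qed
  qed (use fin in simp)
  then have "coset_sum I g = sum g ?W" using I(1) gI by (intro coset_sum_eq) auto
  also have "\<dots> = (\<Sum>(y, z)\<in>Y \<times> Z. g (y + z))"
    unfolding sum.reindex[OF inj] by (simp add: case_prod_unfold comp_def)
  also have "\<dots> = (\<Sum>(y, z)\<in>Y \<times> Z. g y)"
    using g Z(2) by (intro sum.cong) (auto simp: periodic_def)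
  also have "\<dots> = of_nat (card Z) * sum g Y"
    by (simp add: sum.cartesian_product[symmetric] sum_distrib_left)
  also have "\<dots> = of_nat (index L I) * coset_sum L g"
    using L g Y by (simp add: card_transversal[OF I(1) Z] coset_sum_eq)
  finally show ?thesis .
qed

section \<open>Fourier analysis of a self-dual order\<close>

text \<open>
  A subring \<open>M\<close> of \<open>K\<close> with field of fractions \<open>K\<close> and finite quotients \<open>M/nM\<close>, together with a
  unitary character \<open>\<psi>\<close> of \<open>K\<close> for which \<open>M\<close> is its own annihilator.
\<close>

locale self_dual_order =
  fixes M :: "'k::field_char_0 set" and \<psi> :: "'k \<Rightarrow> complex"
  assumes one_M: "1 \<in> M"
    and diff_M: "x \<in> M \<Longrightarrow> y \<in> M \<Longrightarrow> x - y \<in> M"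
    and mult_M: "x \<in> M \<Longrightarrow> y \<in> M \<Longrightarrow> x * y \<in> M"
    and denominator: "\<exists>n::nat. 0 < n \<and> of_nat n * x \<in> M"
    and finite_quotient: "0 < (n::nat) \<Longrightarrow> \<exists>F. finite F \<and> (\<forall>x\<in>M. \<exists>y\<in>F. \<exists>z\<in>M. x = y + of_nat n * z)"
    and char_add: "\<psi> (x + y) = \<psi> x * \<psi> y"
    and char_norm: "cmod (\<psi> x) = 1"
    and char_dual: "(\<forall>m\<in>M. \<psi> (x * m) = 1) \<longleftrightarrow> x \<in> M"
begin

lemma M_subgroup: "add_subgroup M"
  using one_M diff_M by (auto simp: add_subgroup_def intro: diff_M[of 1 1, simplified])

lemma zero_M: "0 \<in> M"
  using M_subgroup by (simp add: add_subgroup_def)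

lemma add_M: "x \<in> M \<Longrightarrow> y \<in> M \<Longrightarrow> x + y \<in> M"
  using add_subgroup_add[OF M_subgroup] .

lemma uminus_M: "x \<in> M \<Longrightarrow> - x \<in> M"
  using add_subgroup_uminus[OF M_subgroup] .

lemma uminus_M_iff: "- x \<in> M \<longleftrightarrow> x \<in> M"
  using uminus_M[of x] uminus_M[of "- x"] by auto

lemma of_nat_M: "of_nat n \<in> M"
  by (induction n) (auto simp: zero_M one_M add_M)

lemma char_M: "x \<in> M \<Longrightarrow> \<psi> x = 1"
  using char_dual[of x] one_M by fastforce

lemma char_uminus: "\<psi> (- x) = cnj (\<psi> x)"
proof -
  have "\<psi> x * \<psi> (- x) = 1" using char_add[of x "- x"] char_M[OF zero_M] by simp
  moreover have "\<psi> x * cnj (\<psi> x) = 1" using complex_norm_square[of "\<psi> x"] char_norm[of x] by simp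
  moreover have "\<psi> x \<noteq> 0" using char_norm[of x] by auto
  ultimately show ?thesis by (metis mult_cancel_left)
qed

definition dil :: "'k \<Rightarrow> 'k set" where
  "dil b = (*) b ` M"

lemma dil_iff: "b \<noteq> 0 \<Longrightarrow> x \<in> dil b \<longleftrightarrow> x / b \<in> M"
  by (force simp: dil_def)

lemma dil_1 [simp]: "dil 1 = M"
  by (simp add: dil_def)

lemma dil_subgroup: "add_subgroup (dil b)"
  unfolding add_subgroup_def dil_def
  using zero_M diff_M by (force simp: right_diff_distrib[symmetric])

definition bounded_denominators :: "('k \<Rightarrow> complex) \<Rightarrow> bool" where
  "bounded_denominators g \<longleftrightarrow> (\<exists>N::nat. 0 < N \<and> (\<forall>x. g x \<noteq> 0 \<longrightarrow> of_nat N * x \<in> M))"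

lemma bounded_denominators_mono:
  "bounded_denominators g \<Longrightarrow> (\<And>x. h x \<noteq> 0 \<Longrightarrow> g x \<noteq> 0) \<Longrightarrow> bounded_denominators h"
  unfolding bounded_denominators_def by blast

lemma of_nat_mult_M: "of_nat N * x \<in> M \<Longrightarrow> of_nat (N * N') * x \<in> M" "of_nat N * x \<in> M \<Longrightarrow> of_nat (N' * N) * x \<in> M"
  using mult_M[OF of_nat_M[of N'], of "of_nat N * x"] by (simp_all add: ac_simps)

lemma bounded_denominators_common:
  assumes "finite I" "\<And>i. i \<in> I \<Longrightarrow> bounded_denominators (g i)"
  shows "\<exists>N::nat. 0 < N \<and> (\<forall>i\<in>I. \<forall>x. g i x \<noteq> 0 \<longrightarrow> of_nat N * x \<in> M)"
  using assms
proof (induction rule: finite_induct)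
  case (insert i I)
  obtain N :: nat where N: "0 < N" "\<forall>i\<in>I. \<forall>x. g i x \<noteq> 0 \<longrightarrow> of_nat N * x \<in> M"
    using insert.IH insert.prems by blast
  obtain N' :: nat where N': "0 < N'" "\<And>x. g i x \<noteq> 0 \<Longrightarrow> of_nat N' * x \<in> M"
    using insert.prems[of i] unfolding bounded_denominators_def by blast
  show ?case using N N' by (intro exI[of _ "N * N'"]) (auto intro: of_nat_mult_M simp del: of_nat_mult)
qed auto

lemma bounded_denominators_affine:
  assumes g: "bounded_denominators g" and c: "c \<noteq> 0"
  shows "bounded_denominators (\<lambda>x. g (c * x + d))"
proof -
  obtain N :: nat where N: "0 < N" "\<And>x. g x \<noteq> 0 \<Longrightarrow> of_nat N * x \<in> M"
    using g by (auto simp: bounded_denominators_def)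
  obtain n :: nat where n: "0 < n" "of_nat n * d \<in> M" using denominator by blast
  obtain n' :: nat where n': "0 < n'" "of_nat n' * (1 / c) \<in> M" using denominator by blast
  have "of_nat (N * n * n') * x \<in> M" if "g (c * x + d) \<noteq> 0" for x
  proof -
    have "of_nat n * (of_nat N * (c * x + d)) - of_nat N * (of_nat n * d) \<in> M"
      using N(2)[OF that] n by (simp add: diff_M mult_M of_nat_M)
    then have "(of_nat n' * (1 / c)) * (of_nat n * (of_nat N * (c * x + d)) - of_nat N * (of_nat n * d)) \<in> M"
      using n'(2) by (rule mult_M[rotated])
    also have "(of_nat n' * (1 / c)) * (of_nat n * (of_nat N * (c * x + d)) - of_nat N * (of_nat n * d)) = of_nat (N * n * n') * x"
      using c by (simp add: field_simps)
    finally show ?thesis .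
  qed
  then show ?thesis unfolding bounded_denominators_def using N n n' by (intro exI[of _ "N * n * n'"]) auto
qed

lemma dil_transversal:
  assumes b: "b \<noteq> 0" and N: "0 < N"
  obtains Y where "transversal (dil b) {x. of_nat N * x \<in> M} Y" "Y \<subseteq> {x. of_nat N * x \<in> M}"
proof -
  obtain d :: nat where d: "0 < d" "of_nat d * (1 / b) \<in> M" using denominator by blast
  have "0 < N * d" using N d by simp
  from finite_quotient[OF this] obtain F where F: "finite F" "\<And>x. x \<in> M \<Longrightarrow> \<exists>y\<in>F. \<exists>z\<in>M. x = y + of_nat (N * d) * z"
    by blast
  have "\<exists>y\<in>(\<lambda>y. y / of_nat N) ` F. x - y \<in> dil b" if x: "x \<in> {x. of_nat N * x \<in> M}" for x
  proof -
    obtain y z where yz: "y \<in> F" "z \<in> M" "of_nat N * x = y + of_nat (N * d) * z" using F(2)[of "of_nat N * x"] x by auto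
    have "x = (of_nat N * x) / of_nat N" using N by simp
    also have "\<dots> = y / of_nat N + of_nat d * z" unfolding yz(3) using N by (simp add: field_simps)
    finally have "(x - y / of_nat N) / b = (of_nat d * (1 / b)) * z" by simp
    also have "\<dots> \<in> M" by (rule mult_M[OF d(2) yz(2)])
    finally show ?thesis using yz b by (auto simp: dil_iff)
  qed
  with F(1) show thesis using that by (elim transversal_exists[OF dil_subgroup finite_imageI])
qed

lemma support_transversal:
  assumes b: "b \<noteq> 0" and g: "bounded_denominators g"
  obtains Y where "transversal (dil b) {x. g x \<noteq> 0} Y" "Y \<subseteq> {x. g x \<noteq> 0}"
proof -
  obtain N :: nat where N: "0 < N" "{x. g x \<noteq> 0} \<subseteq> {x. of_nat N * x \<in> M}"
    using g by (auto simp: bounded_denominators_def)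
  obtain Y where Y: "transversal (dil b) {x. of_nat N * x \<in> M} Y" using dil_transversal[OF b N(1)] .
  then have F: "finite Y" "\<And>x. x \<in> {x. g x \<noteq> 0} \<Longrightarrow> \<exists>y\<in>Y. x - y \<in> dil b"
    using N(2) by (auto simp: transversal_def)
  show thesis by (rule transversal_exists[OF dil_subgroup F that])
qed

lemma coset_sum_sum:
  assumes b: "b \<noteq> 0" and I: "finite I"
    and g: "\<And>i. i \<in> I \<Longrightarrow> periodic (dil b) (g i)" "\<And>i. i \<in> I \<Longrightarrow> bounded_denominators (g i)"
  shows "coset_sum (dil b) (\<lambda>x. \<Sum>i\<in>I. g i x) = (\<Sum>i\<in>I. coset_sum (dil b) (g i))"
proof -
  have "\<exists>N::nat. 0 < N \<and> (\<forall>i\<in>I. \<forall>x. g i x \<noteq> 0 \<longrightarrow> of_nat N * x \<in> M)"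
    by (rule bounded_denominators_common[OF I]) (rule g(2))
  then obtain N :: nat where N: "0 < N" "\<And>i x. i \<in> I \<Longrightarrow> g i x \<noteq> 0 \<Longrightarrow> of_nat N * x \<in> M"
    by metis
  obtain Y where Y: "transversal (dil b) {x. of_nat N * x \<in> M} Y" using dil_transversal[OF b N(1)] .
  have "coset_sum (dil b) (\<lambda>x. \<Sum>i\<in>I. g i x) = (\<Sum>y\<in>Y. \<Sum>i\<in>I. g i y)"
  proof (rule coset_sum_eq[OF dil_subgroup _ Y])
    show "periodic (dil b) (\<lambda>x. \<Sum>i\<in>I. g i x)" using g(1) by (auto simp: periodic_def intro!: sum.cong)
    show "{x. (\<Sum>i\<in>I. g i x) \<noteq> 0} \<subseteq> {x. of_nat N * x \<in> M}"
    proof clarify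
      fix x assume "(\<Sum>i\<in>I. g i x) \<noteq> 0"
      then obtain i where "i \<in> I" "g i x \<noteq> 0" by (metis sum.neutral)
      then show "of_nat N * x \<in> M" by (rule N(2))
    qed
  qed
  also have "\<dots> = (\<Sum>i\<in>I. \<Sum>y\<in>Y. g i y)" by (rule sum.swap)
  also have "\<dots> = (\<Sum>i\<in>I. coset_sum (dil b) (g i))"
    using N(2) by (intro sum.cong refl coset_sum_eq[OF dil_subgroup g(1) Y, symmetric]) auto
  finally show ?thesis .
qed

lemma coset_sum_scale:
  assumes b: "b \<noteq> 0" and g: "periodic (dil b) g" "bounded_denominators g"
  shows "coset_sum (dil b) (\<lambda>x. c * g x) = c * coset_sum (dil b) g"
proof -
  obtain Y where Y: "transversal (dil b) {x. g x \<noteq> 0} Y" using support_transversal[OF b g(2)] .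
  have "periodic (dil b) (\<lambda>x. c * g x)" using g(1) by (simp add: periodic_def)
  then show ?thesis using g(1)
    by (subst (1 2) coset_sum_eq[OF dil_subgroup _ Y]) (auto simp: sum_distrib_left)
qed

lemma coset_sum_cnj:
  assumes b: "b \<noteq> 0" and g: "periodic (dil b) g" "bounded_denominators g"
  shows "coset_sum (dil b) (\<lambda>x. cnj (g x)) = cnj (coset_sum (dil b) g)"
proof -
  obtain Y where Y: "transversal (dil b) {x. g x \<noteq> 0} Y" using support_transversal[OF b g(2)] .
  have "periodic (dil b) (\<lambda>x. cnj (g x))" using g(1) by (simp add: periodic_def)
  then show ?thesis using g(1)
    by (subst (1 2) coset_sum_eq[OF dil_subgroup _ Y]) auto
qed

lemma coset_sum_affine:
  assumes c: "c \<noteq> 0" and b: "b \<noteq> 0" and g: "periodic (dil (c * b)) g" "bounded_denominators g"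
  shows "coset_sum (dil (c * b)) g = coset_sum (dil b) (\<lambda>x. g (c * x + d))"
proof -
  let ?h = "\<lambda>x. g (c * x + d)"
  have ph: "periodic (dil b) ?h"
    using g(1) by (auto simp: periodic_def dil_def algebra_simps) (metis add.assoc add.commute mult.assoc)
  obtain Y where Y: "transversal (dil b) {x. ?h x \<noteq> 0} Y"
    using support_transversal[OF b bounded_denominators_affine[OF g(2) c]] .
  have inj: "inj_on (\<lambda>x. c * x + d) Y" using c by (auto intro!: inj_onI)
  have "transversal (dil (c * b)) {x. g x \<noteq> 0} ((\<lambda>x. c * x + d) ` Y)"
    unfolding transversal_def
  proof (intro conjI ballI)
    fix x assume "x \<in> {x. g x \<noteq> 0}"
    then have "?h ((x - d) / c) \<noteq> 0" using c by simp
    then have ex: "\<exists>!y. y \<in> Y \<and> (x - d) / c - y \<in> dil b" using Y unfolding transversal_def by blast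
    have eq: "x - (c * y + d) \<in> dil (c * b) \<longleftrightarrow> (x - d) / c - y \<in> dil b" for y
    proof -
      have "(x - (c * y + d)) / (c * b) = ((x - d) / c - y) / b" using c b by (simp add: field_simps)
      then show ?thesis using c b by (simp add: dil_iff)
    qed
    from ex obtain y where y: "y \<in> Y" "(x - d) / c - y \<in> dil b" by blast
    show "\<exists>!w. w \<in> (\<lambda>x. c * x + d) ` Y \<and> x - w \<in> dil (c * b)"
    proof (rule ex1I[of _ "c * y + d"])
      fix w assume "w \<in> (\<lambda>x. c * x + d) ` Y \<and> x - w \<in> dil (c * b)"
      then obtain y' where "y' \<in> Y" "w = c * y' + d" "(x - d) / c - y' \<in> dil b" using eq by auto
      then show "w = c * y + d" using ex y by blast
    qed (use y eq in auto)
  qed (use Y in \<open>simp add: transversal_def\<close>)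
  then have "coset_sum (dil (c * b)) g = sum g ((\<lambda>x. c * x + d) ` Y)"
    using g(1) by (intro coset_sum_eq dil_subgroup) auto
  also have "\<dots> = sum ?h Y" unfolding sum.reindex[OF inj] by simp
  also have "\<dots> = coset_sum (dil b) ?h" using ph Y by (intro coset_sum_eq[OF dil_subgroup, symmetric]) auto
  finally show ?thesis .
qed

text \<open>
  The conditions satisfied by the part of degree \<open>b\<close> of an element of the Hecke algebra, as a function
  of the translation.
\<close>

definition lattice_periodic :: "'k \<Rightarrow> ('k \<Rightarrow> complex) \<Rightarrow> bool" where
  "lattice_periodic b g \<longleftrightarrow> periodic M g \<and> periodic (dil b) g \<and> bounded_denominators g"

lemma lattice_periodic_D: "lattice_periodic b g \<Longrightarrow> m \<in> M \<Longrightarrow> g (x + m) = g x" "lattice_periodic b g \<Longrightarrow> m \<in> M \<Longrightarrow> g (x + b * m) = g x"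
  "lattice_periodic b g \<Longrightarrow> bounded_denominators g"
  by (auto simp: lattice_periodic_def periodic_def dil_def)

lemma lattice_periodic_I:
  assumes "\<And>x m. m \<in> M \<Longrightarrow> g (x + m) = g x" "\<And>x m. m \<in> M \<Longrightarrow> g (x + b * m) = g x" "bounded_denominators g"
  shows "lattice_periodic b g"
  using assms by (auto simp: lattice_periodic_def periodic_def dil_def)

text \<open>
  The Fourier transform on \<open>K\<close>, normalized so that \<open>b M\<close> has volume 1.  The summand is \<open>b M\<close>-periodic
  only for \<open>b t \<in> M\<close>; for other \<open>t\<close> it has mean 0 on every coset of \<open>b M\<close>, whence the value 0.
\<close>

definition fourier :: "'k \<Rightarrow> ('k \<Rightarrow> complex) \<Rightarrow> 'k \<Rightarrow> complex" where
  "fourier b g t = (if b * t \<in> M then coset_sum (dil b) (\<lambda>y. g y * \<psi> (y * t)) else 0)"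

lemma char_shift: "b * t \<in> M \<Longrightarrow> m \<in> M \<Longrightarrow> \<psi> ((x + b * m) * t) = \<psi> (x * t)"
  using char_M[OF mult_M[of "b * t" m]] char_add[of "x * t" "(b * t) * m"] by (simp add: algebra_simps)

lemma periodic_char: "lattice_periodic b g \<Longrightarrow> b * t \<in> M \<Longrightarrow> periodic (dil b) (\<lambda>y. g y * \<psi> (y * t))"
  unfolding periodic_def dil_def using lattice_periodic_D(2)[of b g] char_shift[of b t] by auto

lemma bounded_char: "lattice_periodic b g \<Longrightarrow> bounded_denominators (\<lambda>y. g y * \<psi> (y * t))"
  by (rule bounded_denominators_mono[OF lattice_periodic_D(3)]) auto

text \<open>
  A translation by \<open>m \<in> M\<close> multiplies the transform by \<open>\<psi> (t m)\<close> but leaves \<open>g\<close> unchanged.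
\<close>

lemma fourier_support:
  assumes b: "b \<noteq> 0" and g: "lattice_periodic b g" and nz: "fourier b g t \<noteq> 0"
  shows "t \<in> M" "b * t \<in> M"
proof -
  show bt: "b * t \<in> M" using nz by (auto simp: fourier_def split: if_splits)
  let ?c = "coset_sum (dil b) (\<lambda>y. g y * \<psi> (y * t))"
  have c: "?c \<noteq> 0" using nz bt by (simp add: fourier_def)
  have "\<psi> (t * m) = 1" if m: "m \<in> M" for m
  proof -
    have "?c = coset_sum (dil b) (\<lambda>y. g (1 * y + m) * \<psi> ((1 * y + m) * t))"
      using coset_sum_affine[of 1 b "\<lambda>y. g y * \<psi> (y * t)" m] periodic_char[OF g bt] bounded_char[OF g] b by simp
    also have "\<dots> = coset_sum (dil b) (\<lambda>y. \<psi> (t * m) * (g y * \<psi> (y * t)))"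
    proof -
      have "\<psi> ((1 * y + m) * t) = \<psi> (t * m) * \<psi> (y * t)" for y
        using char_add[of "t * m" "y * t"] by (simp add: algebra_simps)
      then show ?thesis using lattice_periodic_D(1)[OF g m] by (simp add: mult.left_commute)
    qed
    also have "\<dots> = \<psi> (t * m) * ?c"
      by (rule coset_sum_scale[OF b periodic_char[OF g bt] bounded_char[OF g]])
    finally show ?thesis using c by simp
  qed
  then show "t \<in> M" using char_dual by blast
qed

lemma fourier_sum:
  assumes b: "b \<noteq> 0" and I: "finite I" and g: "\<And>i. i \<in> I \<Longrightarrow> lattice_periodic b (g i)"
  shows "fourier b (\<lambda>x. \<Sum>i\<in>I. g i x) t = (\<Sum>i\<in>I. fourier b (g i) t)"
proof (cases "b * t \<in> M")
  case True
  have "coset_sum (dil b) (\<lambda>x. \<Sum>i\<in>I. g i x * \<psi> (x * t)) = (\<Sum>i\<in>I. coset_sum (dil b) (\<lambda>x. g i x * \<psi> (x * t)))"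
    using g True by (intro coset_sum_sum b I periodic_char bounded_char)
  then show ?thesis using True by (simp add: fourier_def sum_distrib_right)
qed (simp add: fourier_def)

lemma fourier_scale:
  assumes b: "b \<noteq> 0" and g: "lattice_periodic b g"
  shows "fourier b (\<lambda>x. c * g x) t = c * fourier b g t"
  using coset_sum_scale[OF b periodic_char[OF g] bounded_char[OF g], of t c]
  by (simp add: fourier_def mult.assoc)

lemma fourier_plus:
  assumes b: "b \<noteq> 0" and g: "lattice_periodic b g" "lattice_periodic b h"
  shows "fourier b (\<lambda>x. g x + h x) t = fourier b g t + fourier b h t"
  using fourier_sum[OF b, of "UNIV :: bool set" "\<lambda>i. if i then g else h" t] g
  by (simp add: UNIV_bool add.commute)

text \<open>
  Orthogonality of characters on \<open>M/NM\<close>, obtained by invariance under a translation on which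
  the character is not trivial.
\<close>

lemma coset_sum_char_orthogonality:
  assumes N: "0 < N" and u: "of_nat N * u \<in> M" and T: "transversal (dil (of_nat N)) M T" "T \<subseteq> M"
  shows "(\<Sum>t\<in>T. \<psi> (u * t)) = (if u \<in> M then of_nat (card T) else 0)"
proof (cases "u \<in> M")
  case True
  then show ?thesis using T(2) by (simp add: char_M mult_M subset_eq)
next
  case False
  let ?G = "\<lambda>t. if t \<in> M then \<psi> (u * t) else 0"
  have N0: "(of_nat N :: 'k) \<noteq> 0" using N by simp
  have p: "periodic (dil (of_nat N)) ?G"
    unfolding periodic_def
  proof (intro allI ballI)
    fix x l assume "l \<in> dil (of_nat N)"
    then obtain m where m: "m \<in> M" "l = of_nat N * m" by (auto simp: dil_def)
    then have l: "l \<in> M" by (simp add: mult_M of_nat_M)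
    have "x + l \<in> M \<longleftrightarrow> x \<in> M" using l add_M[of x l] diff_M[of "x + l" l] by auto
    moreover have "\<psi> (u * (x + l)) = \<psi> (u * x)"
      using char_M[OF mult_M[OF u m(1)]] m(2) by (simp add: distrib_left char_add ac_simps)
    ultimately show "?G (x + l) = ?G x" by simp
  qed
  have bd: "bounded_denominators ?G"
    unfolding bounded_denominators_def by (intro exI[of _ 1]) auto
  have eq: "coset_sum (dil (of_nat N)) ?G = (\<Sum>t\<in>T. \<psi> (u * t))"
    using T(2) by (subst coset_sum_eq[OF dil_subgroup p T(1)]) (auto intro!: sum.cong split: if_splits)
  obtain m where m: "m \<in> M" "\<psi> (u * m) \<noteq> 1" using False char_dual by blast
  have "coset_sum (dil (of_nat N)) ?G = coset_sum (dil (of_nat N)) (\<lambda>t. ?G (1 * t + m))"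
    using coset_sum_affine[of 1 "of_nat N" ?G m] p bd N0 by simp
  also have "(\<lambda>t. ?G (1 * t + m)) = (\<lambda>t. \<psi> (u * m) * ?G t)"
  proof
    fix t
    have "t + m \<in> M \<longleftrightarrow> t \<in> M" using m(1) add_M[of t m] diff_M[of "t + m" m] by auto
    then show "?G (1 * t + m) = \<psi> (u * m) * ?G t" by (simp add: distrib_left char_add)
  qed
  also have "coset_sum (dil (of_nat N)) \<dots> = \<psi> (u * m) * coset_sum (dil (of_nat N)) ?G"
    by (rule coset_sum_scale[OF N0 p bd])
  finally have "coset_sum (dil (of_nat N)) ?G = 0" using m(2) by simp
  then show ?thesis using eq False by simp
qed

lemma M_transversal:
  assumes "0 < N" obtains T where "transversal (dil (of_nat N)) M T" "T \<subseteq> M" "T \<noteq> {}"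
proof -
  have "(of_nat N :: 'k) \<noteq> 0" using assms by simp
  then obtain T where T: "transversal (dil (of_nat N)) {x. of_nat 1 * x \<in> M} T" "T \<subseteq> {x. of_nat 1 * x \<in> M}"
    by (rule dil_transversal[OF _ zero_less_one])
  have "T \<noteq> {}" using T(1) zero_M unfolding transversal_def by auto
  with T that show thesis by simp
qed

text \<open>
  Choose \<open>N\<close> such that \<open>x\<close> and the support of \<open>g\<close> lie in \<open>N\<^sup>-\<^sup>1 M\<close>.  Then \<open>g\<close> is a function on the finite group
  \<open>N\<^sup>-\<^sup>1 M / M\<close>, whose dual is \<open>M / N M\<close>, and \<open>g(x)\<close> is the average of its transform against a
  unimodular function.
\<close>

lemma fourier_inversion_1:
  assumes g: "lattice_periodic 1 g" and B: "\<And>t. cmod (fourier 1 g t) \<le> B"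
  shows "cmod (g x) \<le> B"
proof -
  obtain N' :: nat where N': "0 < N'" "\<And>x. g x \<noteq> 0 \<Longrightarrow> of_nat N' * x \<in> M"
    using lattice_periodic_D(3)[OF g] by (auto simp: bounded_denominators_def)
  obtain n :: nat where n: "0 < n" "of_nat n * x \<in> M" using denominator by blast
  define N where "N = N' * n"
  have N: "0 < N" "\<And>x. g x \<noteq> 0 \<Longrightarrow> of_nat N * x \<in> M" "of_nat N * x \<in> M"
    using N' n unfolding N_def by (auto intro: of_nat_mult_M simp del: of_nat_mult)
  obtain Y where Y: "transversal (dil 1) {x. of_nat N * x \<in> M} Y" "Y \<subseteq> {x. of_nat N * x \<in> M}"
    using dil_transversal[OF one_neq_zero N(1)] .
  obtain T where T: "transversal (dil (of_nat N)) M T" "T \<subseteq> M" "T \<noteq> {}" using M_transversal[OF N(1)] .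
  have fin: "finite Y" "finite T" using Y T by (auto simp: transversal_def)
  have four: "fourier 1 g t = (\<Sum>y\<in>Y. g y * \<psi> (y * t))" if t: "t \<in> T" for t
  proof -
    have t1: "1 * t \<in> M" using t T by auto
    then show ?thesis using N(2)
      by (auto simp: fourier_def intro!: coset_sum_eq[OF M_subgroup periodic_char[OF g t1, simplified] Y(1)[simplified]])
  qed
  have "(\<Sum>t\<in>T. fourier 1 g t * \<psi> (- (x * t))) = (\<Sum>t\<in>T. \<Sum>y\<in>Y. g y * \<psi> ((y - x) * t))"
    by (intro sum.cong refl) (simp add: four sum_distrib_right left_diff_distrib char_add mult.assoc flip: diff_conv_add_uminus char_add)
  also have "\<dots> = (\<Sum>y\<in>Y. g y * (\<Sum>t\<in>T. \<psi> ((y - x) * t)))"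
    by (subst sum.swap) (simp add: sum_distrib_left)
  also have "\<dots> = (\<Sum>y\<in>Y. if y - x \<in> M then g x * of_nat (card T) else 0)"
  proof (intro sum.cong refl)
    fix y assume "y \<in> Y"
    then have "of_nat N * (y - x) \<in> M" using Y(2) N(3) diff_M by (auto simp: right_diff_distrib)
    moreover have "y - x \<in> M \<Longrightarrow> g y = g x" using periodic_diff g by (auto simp: lattice_periodic_def)
    ultimately show "g y * (\<Sum>t\<in>T. \<psi> ((y - x) * t)) = (if y - x \<in> M then g x * of_nat (card T) else 0)"
      by (simp add: coset_sum_char_orthogonality[OF N(1) _ T(1,2)])
  qed
  also have "\<dots> = g x * of_nat (card T)"
  proof -
    obtain y0 where y0: "y0 \<in> Y" "x - y0 \<in> M" "\<And>y. y \<in> Y \<Longrightarrow> x - y \<in> M \<Longrightarrow> y = y0"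
      using Y(1) N(3) unfolding transversal_def dil_1 by blast
    have "(\<Sum>y\<in>Y. if y - x \<in> M then g x * of_nat (card T) else 0) =
        (\<Sum>y\<in>Y. if y = y0 then g x * of_nat (card T) else 0)"
      using y0 add_subgroup_diff_commute[OF M_subgroup] by (intro sum.cong refl) metis
    then show ?thesis using y0(1) fin by simp
  qed
  finally have "cmod (g x) * card T = cmod (\<Sum>t\<in>T. fourier 1 g t * \<psi> (- (x * t)))"
    by (simp add: norm_mult)
  also have "\<dots> \<le> (\<Sum>t\<in>T. B)"
    by (rule sum_norm_le) (simp add: norm_mult char_norm B)
  finally show ?thesis using T(3) fin by (simp add: card_gt_0_iff mult.commute)
qed

lemma fourier_inversion:
  assumes b: "b \<noteq> 0" and g: "lattice_periodic b g" and B: "\<And>t. cmod (fourier b g t) \<le> B"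
  shows "cmod (g x) \<le> B"
proof -
  let ?h = "\<lambda>x. g (b * x + 0)"
  have h: "lattice_periodic 1 ?h"
    using lattice_periodic_D(2)[OF g] bounded_denominators_affine[OF lattice_periodic_D(3)[OF g] b, of 0]
    by (intro lattice_periodic_I) (auto simp: distrib_left)
  have eq: "fourier 1 ?h s = fourier b g (s / b)" for s
  proof (cases "s \<in> M")
    case True
    then have s: "b * (s / b) \<in> M" using b by simp
    have "coset_sum (dil (b * 1)) (\<lambda>y. g y * \<psi> (y * (s / b))) =
        coset_sum (dil 1) (\<lambda>y. g (b * y + 0) * \<psi> ((b * y + 0) * (s / b)))"
      using coset_sum_affine[of b 1 "\<lambda>y. g y * \<psi> (y * (s / b))" 0] periodic_char[OF g s]
        bounded_char[OF g, of "s / b"] b by simp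
    then show ?thesis using True b by (simp add: fourier_def)
  qed (simp add: fourier_def b)
  have "cmod (?h (x / b)) \<le> B" by (rule fourier_inversion_1[OF h]) (simp only: eq B)
  then show ?thesis using b by simp
qed

text \<open>
  The contribution of degree \<open>b\<close> of the left factor to a product in the Hecke algebra.
\<close>

definition conv :: "'k \<Rightarrow> ('k \<Rightarrow> complex) \<Rightarrow> ('k \<Rightarrow> complex) \<Rightarrow> 'k \<Rightarrow> complex" where
  "conv b g h x = coset_sum (dil b) (\<lambda>y. g y * h ((x - y) / b))"

lemma conv_periodic:
  assumes b: "b \<noteq> 0" and g: "lattice_periodic b g" and h: "lattice_periodic c h"
  shows "periodic (dil b) (\<lambda>y. g y * h ((x - y) / b))" "bounded_denominators (\<lambda>y. g y * h ((x - y) / b))"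
proof -
  have "h ((x - (y + b * m)) / b) = h ((x - y) / b)" if "m \<in> M" for y m
  proof -
    have "(x - (y + b * m)) / b = (x - y) / b + (- m)" using b by (simp add: field_simps)
    then show ?thesis using lattice_periodic_D(1)[OF h uminus_M[OF that]] by (simp only:)
  qed
  then show "periodic (dil b) (\<lambda>y. g y * h ((x - y) / b))"
    using lattice_periodic_D(2)[OF g] by (auto simp: periodic_def dil_def)
  show "bounded_denominators (\<lambda>y. g y * h ((x - y) / b))"
    by (rule bounded_denominators_mono[OF lattice_periodic_D(3)[OF g]]) auto
qed

lemma conv_nonzero:
  assumes b: "b \<noteq> 0" and g: "lattice_periodic b g" and h: "lattice_periodic c h" and nz: "conv b g h x \<noteq> 0"
  shows "\<exists>y. g y \<noteq> 0 \<and> h ((x - y) / b) \<noteq> 0"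
proof (rule ccontr)
  assume "\<nexists>y. g y \<noteq> 0 \<and> h ((x - y) / b) \<noteq> 0"
  then have "(\<lambda>y. g y * h ((x - y) / b)) = (\<lambda>y. 0)" by auto
  moreover have "coset_sum (dil b) (\<lambda>y. 0) = 0" by (simp add: coset_sum_def)
  ultimately show False using nz by (simp add: conv_def)
qed

lemma conv_lattice_periodic:
  assumes b: "b \<noteq> 0" and c: "c \<noteq> 0" and g: "lattice_periodic b g" and h: "lattice_periodic c h"
  shows "lattice_periodic (b * c) (conv b g h)"
proof (rule lattice_periodic_I)
  fix x m assume m: "m \<in> M"
  have "conv b g h (x + m) = coset_sum (dil (1 * b)) (\<lambda>y. g y * h ((x + m - y) / b))" by (simp add: conv_def)
  also have "\<dots> = coset_sum (dil b) (\<lambda>y. g (1 * y + m) * h ((x + m - (1 * y + m)) / b))"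
    using conv_periodic[OF b g h] b by (intro coset_sum_affine) auto
  finally show "conv b g h (x + m) = conv b g h x" using lattice_periodic_D(1)[OF g m] by (simp add: conv_def)
  have "h ((x + b * c * m - y) / b) = h ((x - y) / b)" for y
  proof -
    have "(x + b * c * m - y) / b = (x - y) / b + c * m" using b by (simp add: field_simps)
    then show ?thesis using lattice_periodic_D(2)[OF h m] by (simp only:)
  qed
  then show "conv b g h (x + b * c * m) = conv b g h x" by (simp add: conv_def)
next
  obtain N :: nat where N: "0 < N" "\<And>x. g x \<noteq> 0 \<Longrightarrow> of_nat N * x \<in> M"
    using lattice_periodic_D(3)[OF g] by (auto simp: bounded_denominators_def)
  obtain N' :: nat where N': "0 < N'" "\<And>x. h x \<noteq> 0 \<Longrightarrow> of_nat N' * x \<in> M"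
    using lattice_periodic_D(3)[OF h] by (auto simp: bounded_denominators_def)
  obtain n :: nat where n: "0 < n" "of_nat n * b \<in> M" using denominator by blast
  show "bounded_denominators (conv b g h)"
    unfolding bounded_denominators_def
  proof (intro exI[of _ "N * N' * n"] conjI allI impI)
    fix x assume "conv b g h x \<noteq> 0"
    then obtain y where y: "g y \<noteq> 0" "h ((x - y) / b) \<noteq> 0" using conv_nonzero[OF b g h] by blast
    have "of_nat (N' * n) * (of_nat N * y) + of_nat N * ((of_nat n * b) * (of_nat N' * ((x - y) / b))) \<in> M"
      by (rule add_M[OF mult_M[OF of_nat_M N(2)[OF y(1)]]
            mult_M[OF of_nat_M mult_M[OF n(2) N'(2)[OF y(2)]]]])
    also have "of_nat (N' * n) * (of_nat N * y) + of_nat N * ((of_nat n * b) * (of_nat N' * ((x - y) / b))) = of_nat (N * N' * n) * x"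
      using b by (simp add: field_simps)
    finally show "of_nat (N * N' * n) * x \<in> M" .
  qed (use N N' n in auto)
qed

text \<open>
  Substitute \<open>x = y + b z\<close> in the double sum over \<open>x\<close> and \<open>y\<close>.  If \<open>b t \<notin> M\<close>, both sides vanish because the
  transform of \<open>h\<close> is supported in \<open>M\<close>.
\<close>

lemma fourier_conv:
  assumes b: "b \<noteq> 0" and c: "c \<noteq> 0" and g: "lattice_periodic b g" and h: "lattice_periodic c h"
  shows "fourier (b * c) (conv b g h) t = fourier b g t * fourier c h (b * t)"
proof (cases "b * c * t \<in> M")
  case bct: True
  have ct: "c * (b * t) \<in> M" using bct by (simp add: ac_simps)
  obtain Y where Y: "transversal (dil b) {x. g x \<noteq> 0} Y" using support_transversal[OF b lattice_periodic_D(3)[OF g]] .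
  have conv: "conv b g h x = (\<Sum>y\<in>Y. g y * h ((x - y) / b))" for x
    unfolding conv_def by (rule coset_sum_eq[OF dil_subgroup conv_periodic(1)[OF b g h] Y]) auto
  have fin: "finite Y" using Y by (simp add: transversal_def)
  define k where "k y x = h ((x - y) / b) * \<psi> (x * t)" for y x
  have k: "periodic (dil (b * c)) (k y)" "bounded_denominators (k y)" for y
  proof -
    have "k y (x + b * c * m) = k y x" if "m \<in> M" for x m
    proof -
      have "(x + b * c * m - y) / b = (x - y) / b + c * m" using b by (simp add: field_simps)
      then show ?thesis unfolding k_def using lattice_periodic_D(2)[OF h that] char_shift[OF bct that, of x] by (simp only:)
    qed
    then show "periodic (dil (b * c)) (k y)" by (auto simp: periodic_def dil_def)
    have "bounded_denominators (\<lambda>x. h ((1 / b) * x + (- y / b)))"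
      using b by (intro bounded_denominators_affine lattice_periodic_D(3)[OF h]) auto
    then show "bounded_denominators (k y)"
      by (rule bounded_denominators_mono) (auto simp: k_def diff_divide_distrib)
  qed
  have ks: "coset_sum (dil (b * c)) (k y) = \<psi> (y * t) * fourier c h (b * t)" for y
  proof -
    have "coset_sum (dil (b * c)) (k y) = coset_sum (dil c) (\<lambda>z. k y (b * z + y))"
      by (rule coset_sum_affine[OF b c k])
    also have "(\<lambda>z. k y (b * z + y)) = (\<lambda>z. \<psi> (y * t) * (h z * \<psi> (z * (b * t))))"
    proof
      fix z
      have "\<psi> ((b * z + y) * t) = \<psi> (y * t) * \<psi> (z * (b * t))"
        using char_add[of "y * t" "z * (b * t)"] by (simp add: algebra_simps)
      then show "k y (b * z + y) = \<psi> (y * t) * (h z * \<psi> (z * (b * t)))" using b by (simp add: k_def)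
    qed
    also have "coset_sum (dil c) \<dots> = \<psi> (y * t) * coset_sum (dil c) (\<lambda>z. h z * \<psi> (z * (b * t)))"
      by (rule coset_sum_scale[OF c periodic_char[OF h ct] bounded_char[OF h]])
    finally show ?thesis using ct by (simp add: fourier_def)
  qed
  have "fourier (b * c) (conv b g h) t = coset_sum (dil (b * c)) (\<lambda>x. \<Sum>y\<in>Y. g y * k y x)"
    using bct by (simp add: fourier_def conv k_def sum_distrib_right mult.assoc)
  also have "\<dots> = (\<Sum>y\<in>Y. coset_sum (dil (b * c)) (\<lambda>x. g y * k y x))"
  proof (rule coset_sum_sum[OF _ fin])
    show "periodic (dil (b * c)) (\<lambda>x. g y * k y x)" for y using k(1)[of y] by (simp add: periodic_def)
    show "bounded_denominators (\<lambda>x. g y * k y x)" for y by (rule bounded_denominators_mono[OF k(2)[of y]]) simp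
  qed (use b c in simp)
  also have "\<dots> = (\<Sum>y\<in>Y. g y * \<psi> (y * t)) * fourier c h (b * t)"
    using b c by (simp add: coset_sum_scale k ks sum_distrib_right mult.assoc)
  also have "\<dots> = fourier b g t * fourier c h (b * t)"
  proof (cases "b * t \<in> M")
    case True
    have "coset_sum (dil b) (\<lambda>y. g y * \<psi> (y * t)) = (\<Sum>y\<in>Y. g y * \<psi> (y * t))"
      by (rule coset_sum_eq[OF dil_subgroup periodic_char[OF g True] Y]) auto
    then show ?thesis using True by (simp add: fourier_def)
  next
    case False
    then have "fourier c h (b * t) = 0" using fourier_support(1)[OF c h] by blast
    then show ?thesis by simp
  qed
  finally show ?thesis .
next
  case False
  then have "\<not> c * (b * t) \<in> M" by (simp add: ac_simps)
  with False show ?thesis by (simp add: fourier_def)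
qed

lemma intersection_transversal:
  assumes "L = M \<or> L = dil b" "b \<noteq> 0"
  obtains Z where "transversal (M \<inter> dil b) L Z" "Z \<subseteq> L"
proof -
  obtain n :: nat where n: "0 < n" "of_nat n * b \<in> M" using denominator by blast
  obtain n' :: nat where n': "0 < n'" "of_nat n' * (1 / b) \<in> M" using denominator by blast
  define N where "N = n * n'"
  have Nb: "of_nat N * b \<in> M" "of_nat N * (1 / b) \<in> M"
    using of_nat_mult_M(1)[OF n(2), of n'] of_nat_mult_M(2)[OF n'(2), of n] by (simp_all add: N_def)
  have N: "0 < N" using n n' by (simp add: N_def)
  then have N0: "(of_nat N :: 'k) \<noteq> 0" by simp
  obtain F where F: "finite F" "\<And>x. x \<in> M \<Longrightarrow> \<exists>y\<in>F. \<exists>z\<in>M. x = y + of_nat N * z"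
    using finite_quotient[OF N] by blast
  define c where "c = (if L = M then 1 else b)"
  have c0: "c \<noteq> 0" using assms by (simp add: c_def)
  have L: "L = dil c" using assms by (auto simp: c_def)
  have sub: "c * (of_nat N * z) \<in> M \<inter> dil b" if z: "z \<in> M" for z
  proof -
    have "z * of_nat N \<in> M" "z * (of_nat N * b) \<in> M" "z * (of_nat N * (1 / b)) \<in> M"
      using z Nb of_nat_M by (auto intro: mult_M simp del: times_divide_eq_right)
    then show ?thesis using assms(2) by (auto simp: c_def dil_iff ac_simps)
  qed
  have cov: "\<exists>y\<in>(*) c ` F. x - y \<in> M \<inter> dil b" if x: "x \<in> L" for x
  proof -
    obtain m where m: "m \<in> M" "x = c * m" using x L by (auto simp: dil_def)
    obtain y z where "y \<in> F" "z \<in> M" "m = y + of_nat N * z" using F(2)[OF m(1)] by blast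
    then show ?thesis using sub[of z] m by (intro bexI[of _ "c * y"]) (auto simp: algebra_simps)
  qed
  have I: "add_subgroup (M \<inter> dil b)"
    using M_subgroup dil_subgroup[of b] by (auto simp: add_subgroup_def)
  show thesis by (rule transversal_exists[OF I finite_imageI[OF F(1)] cov that])
qed

text \<open>
  The modular function of the Hecke pair at \<open>(x, b)\<^sup>-\<^sup>1\<close>, see \<open>hecke_Delta_affine\<close> below.
\<close>

definition modular :: "'k \<Rightarrow> real" where
  "modular b = real (index (dil b) (M \<inter> dil b)) / real (index M (M \<inter> dil b))"

lemma index_nonzero:
  assumes "L = M \<or> L = dil b" "b \<noteq> 0" shows "index L (M \<inter> dil b) \<noteq> 0"
proof -
  obtain Z where Z: "transversal (M \<inter> dil b) L Z" "Z \<subseteq> L" using intersection_transversal[OF assms] .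
  have I: "add_subgroup (M \<inter> dil b)"
    using M_subgroup dil_subgroup[of b] by (auto simp: add_subgroup_def)
  have "0 \<in> L" using assms zero_M dil_subgroup[of b] by (auto simp: add_subgroup_def)
  then have "Z \<noteq> {}" using Z(1) unfolding transversal_def by blast
  then show ?thesis using Z card_transversal[OF I Z] unfolding transversal_def by auto
qed

text \<open>
  Both sums are compared with the sum over the cosets of \<open>M \<inter> b M\<close>.
\<close>

lemma modular_coset_sum:
  assumes b: "b \<noteq> 0" and g: "periodic M g" "periodic (dil b) g" "bounded_denominators g"
  shows "of_real (modular b) * coset_sum (dil b) g = coset_sum M g"
proof -
  have I: "add_subgroup (M \<inter> dil b)"
    using M_subgroup dil_subgroup[of b] by (auto simp: add_subgroup_def)
  obtain Z where Z: "transversal (M \<inter> dil b) M Z" "Z \<subseteq> M" using intersection_transversal[of M b] b by blast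
  obtain Z' where Z': "transversal (M \<inter> dil b) (dil b) Z'" "Z' \<subseteq> dil b" using intersection_transversal[of "dil b" b] b by blast
  obtain Y where Y: "transversal (dil 1) {x. g x \<noteq> 0} Y" "Y \<subseteq> {x. g x \<noteq> 0}"
    using support_transversal[OF one_neq_zero g(3)] .
  obtain Y' where Y': "transversal (dil b) {x. g x \<noteq> 0} Y'" "Y' \<subseteq> {x. g x \<noteq> 0}" using support_transversal[OF b g(3)] .
  have "of_nat (index M (M \<inter> dil b)) * coset_sum M g = of_nat (index (dil b) (M \<inter> dil b)) * coset_sum (dil b) g"
    using coset_sum_index[OF M_subgroup I _ g(1) Z Y[unfolded dil_1]]
      coset_sum_index[OF dil_subgroup I _ g(2) Z' Y'] by simp
  then show ?thesis
    using index_nonzero[of M b] b by (simp add: modular_def field_simps)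
qed

text \<open>
  The modular function converts the volume normalized on \<open>b M\<close> into the one normalized on \<open>M\<close>, which
  is what the substitution \<open>y \<mapsto> - b y\<close> makes of the volume normalized on \<open>b\<^sup>-\<^sup>1 M\<close>.
\<close>

lemma fourier_star:
  assumes b: "b \<noteq> 0" and g: "lattice_periodic (1 / b) g"
  defines "h \<equiv> \<lambda>y. of_real (modular b) * cnj (g (- y / b))"
  shows "lattice_periodic b h" "fourier b h t = cnj (fourier (1 / b) g (b * t))"
proof -
  define k where "k y = cnj (g (- y / b))" for y
  have k: "lattice_periodic b k"
  proof (rule lattice_periodic_I)
    fix x m assume m: "m \<in> M"
    have "- (x + m) / b = - x / b + (1 / b) * (- m)" "- (x + b * m) / b = - x / b + (- m)"
      using b by (simp_all add: field_simps)
    then show "k (x + m) = k x" "k (x + b * m) = k x"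
      unfolding k_def using lattice_periodic_D(1,2)[OF g uminus_M[OF m], of "- x / b"] by (simp_all only:)
  next
    have "bounded_denominators (\<lambda>y. g ((- 1 / b) * y + 0))"
      using b by (intro bounded_denominators_affine lattice_periodic_D(3)[OF g]) auto
    then show "bounded_denominators k" by (rule bounded_denominators_mono) (simp add: k_def)
  qed
  have h: "h = (\<lambda>y. of_real (modular b) * k y)" by (simp add: h_def k_def)
  show hn: "lattice_periodic b h" using k unfolding h lattice_periodic_def
    by (auto simp: periodic_def intro: bounded_denominators_mono)
  have "1 / b \<noteq> 0" using b by simp
  note supp = fourier_support[OF this g, of "b * t"]
  have s2: "fourier b h t \<noteq> 0 \<Longrightarrow> t \<in> M \<and> b * t \<in> M" using fourier_support[OF b hn] by blast
  show "fourier b h t = cnj (fourier (1 / b) g (b * t))"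
  proof (cases "t \<in> M \<and> b * t \<in> M")
    case False
    then have "fourier b h t = 0" "fourier (1 / b) g (b * t) = 0" using s2 supp b by auto
    then show ?thesis by simp
  next
    case True
    then have t: "t \<in> M" "b * t \<in> M" by auto
    have t1: "1 / b * (b * t) \<in> M" using t b by simp
    have p: "periodic M (\<lambda>y. k y * \<psi> (y * t))"
      using lattice_periodic_D(1)[OF k] char_shift[of 1 t] t(1) by (auto simp: periodic_def)
    have "fourier b h t = of_real (modular b) * coset_sum (dil b) (\<lambda>y. k y * \<psi> (y * t))"
      unfolding h fourier_scale[OF b k] using t by (simp add: fourier_def)
    also have "\<dots> = coset_sum M (\<lambda>y. k y * \<psi> (y * t))"
      by (rule modular_coset_sum[OF b p periodic_char[OF k t(2)] bounded_char[OF k]])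
    also have "\<dots> = coset_sum (dil (- b * (- 1 / b))) (\<lambda>y. k y * \<psi> (y * t))"
      using b by simp
    also have "\<dots> = coset_sum (dil (- 1 / b)) (\<lambda>x. k (- b * x + 0) * \<psi> ((- b * x + 0) * t))"
      using b p bounded_char[OF k] by (intro coset_sum_affine) auto
    also have "\<dots> = coset_sum (dil (1 / b)) (\<lambda>x. cnj (g x * \<psi> (x * (b * t))))"
    proof -
      have "dil (- 1 / b) = dil (1 / b)"
      proof (rule Set.set_eqI)
        fix x
        have "x / (- 1 / b) = - (x / (1 / b))" by simp
        then show "x \<in> dil (- 1 / b) \<longleftrightarrow> x \<in> dil (1 / b)"
          using b uminus_M_iff[of "x / (1 / b)"] by (subst (1 2) dil_iff) (simp_all only:, simp_all)
      qed
      moreover have "k (- b * x + 0) * \<psi> ((- b * x + 0) * t) = cnj (g x * \<psi> (x * (b * t)))" for x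
        using b by (simp add: k_def ac_simps flip: char_uminus)
      ultimately show ?thesis by (simp only:)
    qed
    also have "\<dots> = cnj (fourier (1 / b) g (b * t))"
      using coset_sum_cnj[OF _ periodic_char[OF g t1] bounded_char[OF g]] b t1 by (simp add: fourier_def t)
    finally show ?thesis .
  qed
qed

lemma fourier_periodic:
  assumes b: "b \<noteq> 0" and g: "lattice_periodic b g"
  obtains d :: nat where "0 < d" "\<And>t m. m \<in> M \<Longrightarrow> fourier b g (t + of_nat d * m) = fourier b g t"
proof -
  obtain N :: nat where N: "0 < N" "\<And>x. g x \<noteq> 0 \<Longrightarrow> of_nat N * x \<in> M"
    using lattice_periodic_D(3)[OF g] by (auto simp: bounded_denominators_def)
  obtain n :: nat where n: "0 < n" "of_nat n * b \<in> M" using denominator by blast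
  have "fourier b g (t + of_nat (N * n) * m) = fourier b g t" if m: "m \<in> M" for t m
  proof -
    have "(of_nat n * b) * (of_nat N * m) \<in> M" using n m by (intro mult_M[OF n(2)] mult_M of_nat_M)
    also have "(of_nat n * b) * (of_nat N * m) = b * (of_nat (N * n) * m)" by (simp add: ac_simps)
    finally have bm: "b * (of_nat (N * n) * m) \<in> M" .
    then have iff: "b * (t + of_nat (N * n) * m) \<in> M \<longleftrightarrow> b * t \<in> M"
      using add_M[of "b * t" "b * (of_nat (N * n) * m)"]
        diff_M[of "b * (t + of_nat (N * n) * m)" "b * (of_nat (N * n) * m)"]
      by (auto simp: distrib_left simp del: of_nat_mult)
    have "g y * \<psi> (y * (t + of_nat (N * n) * m)) = g y * \<psi> (y * t)" for y
    proof (cases "g y = 0")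
      case False
      have "(of_nat N * y) * (of_nat n * m) \<in> M" using N(2)[OF False] m by (intro mult_M[OF N(2)[OF False]] mult_M of_nat_M)
      then have "\<psi> (y * (of_nat (N * n) * m)) = 1" using char_M by (simp add: ac_simps)
      then show ?thesis by (simp add: distrib_left char_add del: of_nat_mult)
    qed simp
    then have "(\<lambda>y. g y * \<psi> (y * (t + of_nat (N * n) * m))) = (\<lambda>y. g y * \<psi> (y * t))" by (rule ext)
    then show ?thesis unfolding fourier_def iff by (simp only:)
  qed
  moreover have "0 < N * n" using N n by simp
  ultimately show thesis using that by blast
qed

text \<open>
  This puts the transform in the span of the generators of \<open>D\<close>.
\<close>

lemma fourier_step_function:
  assumes b: "b \<noteq> 0" and g: "lattice_periodic b g"
  obtains T d where "finite T" "d \<noteq> 0" "fourier b g = (\<lambda>t. \<Sum>s\<in>T. fourier b g s * indicator ((\<lambda>m. s + d * m) ` M) t)"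
proof -
  obtain d :: nat where d: "0 < d" "\<And>t m. m \<in> M \<Longrightarrow> fourier b g (t + of_nat d * m) = fourier b g t"
    using fourier_periodic[OF b g] by blast
  have d0: "(of_nat d :: 'k) \<noteq> 0" using d by simp
  obtain T where T: "transversal (dil (of_nat d)) M T" "T \<subseteq> M" using M_transversal[OF d(1)] by blast
  have fin: "finite T" using T by (simp add: transversal_def)
  have ind: "t \<in> (\<lambda>m. s + of_nat d * m) ` M \<longleftrightarrow> t - s \<in> dil (of_nat d)" for s t
    unfolding dil_def image_iff by (simp add: diff_eq_eq add.commute)
  have "fourier b g t = (\<Sum>s\<in>T. fourier b g s * indicator ((\<lambda>m. s + of_nat d * m) ` M) t)" for t
  proof -
    have eq: "fourier b g s * indicator ((\<lambda>m. s + of_nat d * m) ` M) t =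
        (if t - s \<in> dil (of_nat d) then fourier b g t else 0)" for s
    proof (cases "t - s \<in> dil (of_nat d)")
      case True
      then obtain m where "m \<in> M" "t = s + of_nat d * m" by (auto simp: dil_def algebra_simps)
      then have "fourier b g s = fourier b g t" using d(2) by simp
      then show ?thesis using True ind by simp
    qed (simp add: ind)
    show ?thesis
    proof (cases "t \<in> M")
      case True
      then obtain s0 where s0: "s0 \<in> T" "t - s0 \<in> dil (of_nat d)" "\<And>s. s \<in> T \<Longrightarrow> t - s \<in> dil (of_nat d) \<Longrightarrow> s = s0"
        using T(1) unfolding transversal_def by blast
      have "(\<Sum>s\<in>T. fourier b g s * indicator ((\<lambda>m. s + of_nat d * m) ` M) t) = (\<Sum>s\<in>T. if s = s0 then fourier b g t else 0)"
        unfolding eq using s0 by (intro sum.cong refl) metis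
      then show ?thesis using s0(1) fin by simp
    next
      case False
      then have "fourier b g t = 0" using fourier_support(1)[OF b g] by blast
      then show ?thesis unfolding eq by (simp cong: if_cong)
    qed
  qed
  then show thesis by (rule that[OF fin d0 ext])
qed

end

section \<open>The algebra generated by the cosets\<close>

lemma cstar_subalgebra_linf: "cstar_subalgebra linf (carrier linf)"
  unfolding cstar_subalgebra_def
proof (intro conjI ballI allI impI)
  fix f h :: "'y \<Rightarrow> complex" and c assume f: "f \<in> carrier linf"
  show "c \<odot>\<^bsub>linf\<^esub> f \<in> carrier linf"
    using bounded_range_times[of "\<lambda>y. c" f] f by simp
  show "f\<^sup>\<star>\<^bsub>linf\<^esub> \<in> carrier linf" using f by (simp add: bounded_iff)
  assume h: "h \<in> carrier linf"
  show "f \<boxplus>\<^bsub>linf\<^esub> h \<in> carrier linf" "f \<boxtimes>\<^bsub>linf\<^esub> h \<in> carrier linf"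
    using f h by (simp_all add: bounded_range_plus bounded_range_times)
qed auto

lemma cstar_generated_subalgebra:
  assumes X: "X \<subseteq> carrier linf" shows "cstar_subalgebra linf (cstar_generated linf X)"
proof -
  let ?F = "{S. cstar_subalgebra linf S \<and> X \<subseteq> S}"
  have "carrier linf \<in> ?F" using X cstar_subalgebra_linf by blast
  then have sub: "\<Inter>?F \<subseteq> carrier linf" by blast
  have S: "\<zero>\<^sub>*\<^bsub>linf\<^esub> \<in> S \<and> (\<forall>x\<in>S. \<forall>y\<in>S. x \<boxplus>\<^bsub>linf\<^esub> y \<in> S) \<and> (\<forall>c. \<forall>x\<in>S. c \<odot>\<^bsub>linf\<^esub> x \<in> S) \<and>
     (\<forall>x\<in>S. \<forall>y\<in>S. x \<boxtimes>\<^bsub>linf\<^esub> y \<in> S) \<and> (\<forall>x\<in>S. x\<^sup>\<star>\<^bsub>linf\<^esub> \<in> S) \<and>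
     (\<forall>s l. (\<forall>n. s n \<in> S) \<longrightarrow> l \<in> carrier linf \<longrightarrow>
        (\<lambda>n::nat. \<parallel>s n \<boxminus>\<^bsub>linf\<^esub> l\<parallel>\<^bsub>linf\<^esub>) \<longlonglongrightarrow> 0 \<longrightarrow> l \<in> S)" if "S \<in> ?F" for S
    using that unfolding cstar_subalgebra_def by blast
  show ?thesis
    unfolding cstar_generated_def
    unfolding cstar_subalgebra_def[of linf "\<Inter>?F"]
  proof (intro conjI ballI allI impI)
    show "\<Inter>?F \<subseteq> carrier linf" by (rule sub)
    show "\<zero>\<^sub>*\<^bsub>linf\<^esub> \<in> \<Inter>?F" using S by (intro InterI) blast
    fix x assume x: "x \<in> \<Inter>?F"
    show "c \<odot>\<^bsub>linf\<^esub> x \<in> \<Inter>?F" for c using S x by (intro InterI) (meson InterD)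
    show "x\<^sup>\<star>\<^bsub>linf\<^esub> \<in> \<Inter>?F" using S x by (intro InterI) (meson InterD)
    fix y assume y: "y \<in> \<Inter>?F"
    show "x \<boxplus>\<^bsub>linf\<^esub> y \<in> \<Inter>?F" using S x y by (intro InterI) (meson InterD)
    show "x \<boxtimes>\<^bsub>linf\<^esub> y \<in> \<Inter>?F" using S x y by (intro InterI) (meson InterD)
  next
    fix s l assume sl: "\<forall>n::nat. s n \<in> \<Inter>?F" "l \<in> carrier linf" "(\<lambda>n. \<parallel>s n \<boxminus>\<^bsub>linf\<^esub> l\<parallel>\<^bsub>linf\<^esub>) \<longlonglongrightarrow> 0"
    show "l \<in> \<Inter>?F"
    proof (rule InterI)
      fix T assume T: "T \<in> ?F"
      then have "\<forall>n. s n \<in> T" using sl(1) by blast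
      then show "l \<in> T" using S[OF T] sl(2,3) by blast
    qed
  qed
qed

lemma cstar_generated_incl: "X \<subseteq> cstar_generated A X"
  by (auto simp: cstar_generated_def)

lemma cstar_generated_least: "cstar_subalgebra A S \<Longrightarrow> X \<subseteq> S \<Longrightarrow> cstar_generated A X \<subseteq> S"
  by (auto simp: cstar_generated_def)

lemma bounded_indicator: "bounded (range (indicator S :: 'a \<Rightarrow> complex))"
  by (auto simp: bounded_iff indicator_def intro!: exI[of _ 1])

lemma coset_algebra_subalgebra: "cstar_subalgebra linf (coset_algebra M)"
  unfolding coset_algebra_def by (rule cstar_generated_subalgebra) (auto simp: bounded_indicator)

lemma indicator_coset_algebra: "a \<noteq> 0 \<Longrightarrow> indicator ((\<lambda>m. x + a * m) ` M) \<in> coset_algebra M"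
  unfolding coset_algebra_def by (rule subsetD[OF cstar_generated_incl]) blast

text \<open>
  The preimage of \<open>D\<close> under the substitution is a \<open>C\<^sup>*\<close>-subalgebra that contains the generators.
\<close>

lemma coset_algebra_affine:
  assumes c: "c \<noteq> 0" and f: "f \<in> coset_algebra M"
  shows "(\<lambda>y. f (z + c * y)) \<in> coset_algebra M"
proof -
  let ?D = "coset_algebra M"
  note D = coset_algebra_subalgebra[of M]
  define S where "S = {f \<in> carrier linf. (\<lambda>y. f (z + c * y)) \<in> ?D}"
  have "cstar_subalgebra linf S"
    unfolding cstar_subalgebra_def
  proof (intro conjI ballI allI impI)
    show "S \<subseteq> carrier linf" by (auto simp: S_def)
    show "\<zero>\<^sub>*\<^bsub>linf\<^esub> \<in> S" using D by (auto simp: S_def cstar_subalgebra_def)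
    fix f h k assume f: "f \<in> S"
    show "k \<odot>\<^bsub>linf\<^esub> f \<in> S" "f\<^sup>\<star>\<^bsub>linf\<^esub> \<in> S"
      using f D cstar_subalgebra_linf unfolding S_def cstar_subalgebra_def by auto
    assume h: "h \<in> S"
    show "f \<boxplus>\<^bsub>linf\<^esub> h \<in> S" "f \<boxtimes>\<^bsub>linf\<^esub> h \<in> S"
      using f h D cstar_subalgebra_linf unfolding S_def cstar_subalgebra_def by auto
  next
    fix s l assume s: "\<forall>n. s n \<in> S" and l: "l \<in> carrier linf"
      and lim: "(\<lambda>n::nat. \<parallel>s n \<boxminus>\<^bsub>linf\<^esub> l\<parallel>\<^bsub>linf\<^esub>) \<longlonglongrightarrow> 0"
    have "(\<lambda>y. l (z + c * y)) \<in> ?D"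
    proof (rule linf_subalgebra_uniform_limit[OF D _ lim])
      show "(\<lambda>y. s n (z + c * y)) \<in> ?D" for n using s by (simp add: S_def)
      fix n y
      have "s n \<in> carrier linf" using s by (simp add: S_def)
      then have "(\<lambda>y. s n y + (-1) * l y) \<in> carrier linf"
        using l bounded_range_plus[of "s n" "\<lambda>y. -1 * l y"] bounded_range_times[of "\<lambda>y. -1" l] by simp
      then have "(\<lambda>y. s n y - l y) \<in> carrier linf" by simp
      from linf_norm_upper[OF this, of "z + c * y"]
      show "cmod (s n (z + c * y) - l (z + c * y)) \<le> \<parallel>s n \<boxminus>\<^bsub>linf\<^esub> l\<parallel>\<^bsub>linf\<^esub>"
        unfolding linf_minus by simp
    qed
    then show "l \<in> S" using l by (simp add: S_def)
  qed
  moreover have "{indicator ((\<lambda>m. x + a * m) ` M) | x a. a \<noteq> 0} \<subseteq> S"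
  proof clarify
    fix x a :: 'a assume a: "a \<noteq> 0"
    have "z + c * y \<in> (\<lambda>m. x + a * m) ` M \<longleftrightarrow> y \<in> (\<lambda>m. (x - z) / c + (a / c) * m) ` M" for y
    proof -
      have "z + c * y = x + a * m \<longleftrightarrow> y = (x - z) / c + (a / c) * m" for m
      proof -
        have e: "(x - z) / c + (a / c) * m = (x + a * m - z) / c"
          by (simp add: add_divide_distrib diff_divide_distrib)
        show ?thesis unfolding e using c by (auto simp: eq_divide_eq algebra_simps)
      qed
      then show ?thesis by (simp add: image_iff)
    qed
    then have "(\<lambda>y. indicator ((\<lambda>m. x + a * m) ` M) (z + c * y)) =
        (indicator ((\<lambda>m. (x - z) / c + (a / c) * m) ` M) :: 'a \<Rightarrow> complex)"
      by (auto simp: indicator_def fun_eq_iff)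
    then show "indicator ((\<lambda>m. x + a * m) ` M) \<in> S"
      unfolding S_def using a c indicator_coset_algebra[of "a / c" "(x - z) / c" M] by (simp add: bounded_indicator)
  qed
  ultimately have "?D \<subseteq> S" unfolding coset_algebra_def by (rule cstar_generated_least)
  then show ?thesis using f by (auto simp: S_def)
qed

section \<open>The Hecke algebra of the affine group\<close>

lemma affine_group_simps [simp]:
  "carrier affine_group = UNIV \<times> (UNIV - {0})" "(x, a) \<otimes>\<^bsub>affine_group\<^esub> (y, b) = (x + a * y, a * b)"
  "\<one>\<^bsub>affine_group\<^esub> = (0, 1)"
  by (simp_all add: affine_group_def)

lemma affine_group_inv [simp]: "a \<noteq> 0 \<Longrightarrow> inv\<^bsub>affine_group\<^esub> (x, a) = (- x / a, 1 / a)"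
  by (rule group.inv_equality[OF group_affine_group]) auto

lemma crossed_system_affine: "crossed_system affine_group aff_act (coset_algebra M)"
proof (intro crossed_system.intro crossed_system_axioms.intro group_affine_group coset_algebra_subalgebra)
  fix g h :: "'a \<times> 'a" and y :: 'a
  show "aff_act \<one>\<^bsub>affine_group\<^esub> y = y" by (simp add: aff_act_def)
  show "aff_act (g \<otimes>\<^bsub>affine_group\<^esub> h) y = aff_act g (aff_act h y)"
    by (cases g; cases h) (simp add: aff_act_def algebra_simps)
  show "f \<circ> aff_act g \<in> coset_algebra M" if "f \<in> coset_algebra M" "g \<in> carrier affine_group" for f
    using coset_algebra_affine[OF _ that(1), of "snd g" "fst g"] that(2)
    by (cases g) (auto simp: aff_act_def comp_def)
qed

lemma (in crossed_system) homogeneous_one_times: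
  assumes d: "d \<in> D" and F: "F \<in> carrier CA"
  shows "homogeneous \<one> d \<boxtimes>\<^bsub>CA\<^esub> F = (\<lambda>g y. d y * F g y)" "F \<boxtimes>\<^bsub>CA\<^esub> homogeneous \<one> d = (\<lambda>g y. F g y * d (act (inv g) y))"
proof -
  have 1: "supp (homogeneous \<one> d) \<subseteq> {\<one>}" by (auto simp: homogeneous_def)
  show "homogeneous \<one> d \<boxtimes>\<^bsub>CA\<^esub> F = (\<lambda>g y. d y * F g y)"
    by (rule CA_times_eqI)
      (simp_all add: CA_times[OF homogeneous_closed[OF d one_closed] _ 1] CA_outside[OF F], simp add: homogeneous_def)
  show "F \<boxtimes>\<^bsub>CA\<^esub> homogeneous \<one> d = (\<lambda>g y. F g y * d (act (inv g) y))"
  proof (rule CA_times_eqI)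
    fix g y assume g: "g \<in> carrier G"
    have fin: "finite (insert g (supp F))" using CA_finite[OF F] by simp
    have "(F \<boxtimes>\<^bsub>CA\<^esub> homogeneous \<one> d) g y = (\<Sum>h\<in>insert g (supp F). F h y * homogeneous \<one> d (inv h \<otimes> g) (act (inv h) y))"
      by (rule CA_times[OF F fin _ g]) blast
    also have "\<dots> = (\<Sum>h\<in>insert g (supp F). if h = g then F g y * d (act (inv g) y) else 0)"
    proof (rule sum.cong[OF refl])
      fix h assume "h \<in> insert g (supp F)"
      then have h: "h \<in> carrier G" using g CA_supp[OF F] by blast
      have "inv h \<otimes> g = \<one> \<longleftrightarrow> h = g"
      proof
        assume "inv h \<otimes> g = \<one>"
        then have "h \<otimes> (inv h \<otimes> g) = h" using h by simp
        then show "h = g" using inv_shift(1)[OF h g] by simp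
      qed (use g in simp)
      then show "F h y * homogeneous \<one> d (inv h \<otimes> g) (act (inv h) y) = (if h = g then F g y * d (act (inv g) y) else 0)"
        by (simp add: homogeneous_def)
    qed
    also have "\<dots> = F g y * d (act (inv g) y)" using fin by simp
    finally show "(F \<boxtimes>\<^bsub>CA\<^esub> homogeneous \<one> d) g y = F g y * d (act (inv g) y)" .
  qed (simp add: CA_outside[OF F])
qed

lemma l_coset_affine: "(x, a) <#\<^bsub>affine_group\<^esub> transl I = (\<lambda>i. (x + a * i, a)) ` I"
  by (auto simp: l_coset_def transl_def)

context self_dual_order
begin

sublocale cs: crossed_system affine_group aff_act "coset_algebra M"
  by (rule crossed_system_affine)

abbreviation "HA \<equiv> hecke_algebra affine_group (transl M)"

abbreviation slice :: "('k \<times> 'k \<Rightarrow> complex) \<Rightarrow> 'k \<Rightarrow> 'k \<Rightarrow> complex" where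
  "slice f a \<equiv> \<lambda>x. f (x, a)"

definition degrees :: "('k \<times> 'k \<Rightarrow> complex) \<Rightarrow> 'k set" where
  "degrees f = {a. \<exists>x. f (x, a) \<noteq> 0}"

lemma double_coset:
  "transl M #>\<^bsub>affine_group\<^esub> (x, a) <#>\<^bsub>affine_group\<^esub> transl M = {(m + x + a * n, a) | m n. m \<in> M \<and> n \<in> M}"
  by (force simp: r_coset_def set_mult_def transl_def)

lemma bounded_denominators_finite:
  assumes "finite R" obtains N :: nat where "0 < N" "\<And>x. x \<in> R \<Longrightarrow> of_nat N * x \<in> M"
proof -
  have "\<exists>N::nat. 0 < N \<and> (\<forall>r\<in>R. \<forall>x. (if x = r then 1 else 0 :: complex) \<noteq> 0 \<longrightarrow> of_nat N * x \<in> M)"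
  proof (rule bounded_denominators_common[OF assms])
    fix r show "bounded_denominators (\<lambda>x. if x = r then 1 else 0)"
      using denominator[of r] by (auto simp: bounded_denominators_def)
  qed
  then show thesis using that by auto
qed

text \<open>
  The double coset of \<open>(x, a)\<close> is \<open>(x + M + a M) \<times> {a}\<close>, so biinvariance means that each slice is
  periodic under \<open>M\<close> and \<open>a M\<close>.  As \<open>M\<close> has finite quotients, finitely many double cosets
  means finitely many degrees and bounded denominators.
\<close>

lemma HA_carrier_iff:
  "f \<in> carrier HA \<longleftrightarrow> (\<forall>x. f (x, 0) = 0) \<and> (\<forall>a. a \<noteq> 0 \<longrightarrow> lattice_periodic a (slice f a)) \<and> finite (degrees f)"
proof
  let ?dc = "\<lambda>g. transl M #>\<^bsub>affine_group\<^esub> g <#>\<^bsub>affine_group\<^esub> transl M"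
  let ?S = "{g. g \<in> carrier affine_group \<and> f g \<noteq> 0}"
  have setS: "{?dc g | g. g \<in> carrier affine_group \<and> f g \<noteq> 0} = ?dc ` ?S" by blast
  {
    assume f: "f \<in> carrier HA"
    then have out: "f (x, 0) = 0" for x by (simp add: hecke_algebra_def)
    have "f ((m, 1) \<otimes>\<^bsub>affine_group\<^esub> (x, a) \<otimes>\<^bsub>affine_group\<^esub> (n, 1)) = f (x, a)" if "a \<noteq> 0" "m \<in> M" "n \<in> M" for x a m n
      using f that unfolding hecke_algebra_def transl_def by fastforce
    then have inv: "f (m + x + a * n, a) = f (x, a)" if "a \<noteq> 0" "m \<in> M" "n \<in> M" for x a m n
      using that by simp
    have "finite (?dc ` ?S)" using f setS by (simp add: hecke_algebra_def)
    \<comment> \<open>Finitely many representatives of the double cosets in the support.\<close>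
    from finite_subset_image[OF this subset_refl] obtain R where R: "finite R" "R \<subseteq> ?S" "?dc ` ?S = ?dc ` R" by blast
    have rep: "\<exists>x0 m n. (x0, a) \<in> R \<and> m \<in> M \<and> n \<in> M \<and> x = m + x0 + a * n" if nz: "f (x, a) \<noteq> 0" for x a
    proof -
      have "a \<noteq> 0" using nz out by auto
      then have "(x, a) \<in> ?S" using nz by auto
      then have "?dc (x, a) \<in> ?dc ` R" unfolding R(3)[symmetric] by (rule imageI)
      then obtain g0 where "g0 \<in> R" "?dc (x, a) = ?dc g0" by (rule imageE)
      then obtain x0 b where g: "(x0, b) \<in> R" "?dc (x, a) = ?dc (x0, b)" by (cases g0) simp
      have "(x, a) \<in> ?dc (x, a)" using zero_M by (force simp: double_coset)
      then have "(x, a) \<in> {(m + x0 + b * n, b) | m n. m \<in> M \<and> n \<in> M}" using g(2) by (simp only: double_coset)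
      then show ?thesis using g(1) by auto
    qed
    have "degrees f \<subseteq> snd ` R" using rep by (force simp: degrees_def)
    then have "finite (degrees f)" using R(1) finite_subset by blast
    moreover have "lattice_periodic a (slice f a)" if a: "a \<noteq> 0" for a
    proof (rule lattice_periodic_I)
      show "slice f a (x + m) = slice f a x" "slice f a (x + a * m) = slice f a x" if "m \<in> M" for x m
        using inv[OF a that zero_M, of x] inv[OF a zero_M that, of x] by (simp_all add: add.commute)
      obtain N :: nat where N: "0 < N" "\<And>x. x \<in> insert a (fst ` R) \<Longrightarrow> of_nat N * x \<in> M"
        using bounded_denominators_finite[of "insert a (fst ` R)"] R(1) by blast
      show "bounded_denominators (slice f a)"
        unfolding bounded_denominators_def
      proof (intro exI[of _ N] conjI allI impI N(1))
        fix x assume "slice f a x \<noteq> 0"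
        then obtain x0 m n where x0: "(x0, a) \<in> R" "m \<in> M" "n \<in> M" "x = m + x0 + a * n" using rep by blast
        have "of_nat N * x0 \<in> M" by (rule N(2)) (use x0(1) in force)
        moreover have "of_nat N * a \<in> M" by (rule N(2)) simp
        ultimately have "of_nat N * m + of_nat N * x0 + (of_nat N * a) * n \<in> M"
          using x0 by (intro add_M) (auto intro: mult_M[OF of_nat_M] mult_M)
        then show "of_nat N * x \<in> M" by (simp add: x0(4) algebra_simps)
      qed
    qed
    ultimately show "(\<forall>x. f (x, 0) = 0) \<and> (\<forall>a. a \<noteq> 0 \<longrightarrow> lattice_periodic a (slice f a)) \<and> finite (degrees f)" using out by blast
  }
  {
    assume f: "(\<forall>x. f (x, 0) = 0) \<and> (\<forall>a. a \<noteq> 0 \<longrightarrow> lattice_periodic a (slice f a)) \<and> finite (degrees f)"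
    have "\<exists>Y. transversal (dil a) {x. f (x, a) \<noteq> 0} Y" if "a \<noteq> 0" for a
      using support_transversal[OF that lattice_periodic_D(3)] f that by metis
    then obtain Y where Y: "\<And>a. a \<noteq> 0 \<Longrightarrow> transversal (dil a) {x. f (x, a) \<noteq> 0} (Y a)" by metis
    have "?dc ` ?S \<subseteq> (\<lambda>(a, y). ?dc (y, a)) ` Sigma (degrees f) Y"
    proof
      fix C assume "C \<in> ?dc ` ?S"
      then obtain x a where xa: "a \<noteq> 0" "f (x, a) \<noteq> 0" "C = ?dc (x, a)" by auto
      then obtain y where y: "y \<in> Y a" "x - y \<in> dil a" using Y[OF xa(1)] unfolding transversal_def by blast
      then obtain k where k: "k \<in> M" "x = y + a * k" by (auto simp: dil_def algebra_simps)
      have "?dc (x, a) = ?dc (y, a)"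
        unfolding double_coset
      proof (intro equalityI subsetI; clarify)
        fix m n assume "m \<in> M" "n \<in> M"
        then show "\<exists>m' n'. (m + x + a * n, a) = (m' + y + a * n', a) \<and> m' \<in> M \<and> n' \<in> M"
          using k by (intro exI[of _ m] exI[of _ "k + n"]) (auto simp: add_M algebra_simps)
      next
        fix m n assume "m \<in> M" "n \<in> M"
        then show "\<exists>m' n'. (m + y + a * n, a) = (m' + x + a * n', a) \<and> m' \<in> M \<and> n' \<in> M"
          using k by (intro exI[of _ m] exI[of _ "n - k"]) (auto simp: diff_M algebra_simps)
      qed
      moreover have "a \<in> degrees f" using xa by (auto simp: degrees_def)
      ultimately show "C \<in> (\<lambda>(a, y). ?dc (y, a)) ` Sigma (degrees f) Y" using y xa by force
    qed
    moreover have "finite (Sigma (degrees f) Y)"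
    proof (rule finite_SigmaI)
      show "finite (degrees f)" using f by blast
      fix a assume "a \<in> degrees f"
      then have "a \<noteq> 0" using f by (auto simp: degrees_def)
      then show "finite (Y a)" using Y by (simp add: transversal_def)
    qed
    ultimately have fin: "finite {?dc g | g. g \<in> carrier affine_group \<and> f g \<noteq> 0}"
      unfolding setS using finite_surj by blast
    have inv: "f (m + x + a * n, a) = f (x, a)" if "a \<noteq> 0" "m \<in> M" "n \<in> M" for x a m n
    proof -
      have n: "lattice_periodic a (slice f a)" using f that by blast
      show ?thesis using lattice_periodic_D(2)[OF n that(3), of "m + x"] lattice_periodic_D(1)[OF n that(2), of x] by (simp add: add.commute)
    qed
    have out: "\<forall>g. g \<notin> carrier affine_group \<longrightarrow> f g = 0" using f by auto
    have "\<forall>g\<in>carrier affine_group. \<forall>m\<in>transl M. \<forall>n\<in>transl M.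
        f (m \<otimes>\<^bsub>affine_group\<^esub> g \<otimes>\<^bsub>affine_group\<^esub> n) = f g"
      by (auto simp: transl_def inv)
    with out fin show "f \<in> carrier HA"
      unfolding hecke_algebra_def partial_object.select_convs mem_Collect_eq by blast
  }
qed

lemma HA_zero_degree: "f \<in> carrier HA \<Longrightarrow> f (x, 0) = 0"
  and HA_lattice_periodic: "f \<in> carrier HA \<Longrightarrow> a \<noteq> 0 \<Longrightarrow> lattice_periodic a (slice f a)"
  and HA_degrees_finite: "f \<in> carrier HA \<Longrightarrow> finite (degrees f)"
  using HA_carrier_iff by blast+

lemma degrees_nonzero: "f \<in> carrier HA \<Longrightarrow> a \<in> degrees f \<Longrightarrow> a \<noteq> 0"
  using HA_zero_degree by (auto simp: degrees_def)

lemma HA_simps: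
  "\<zero>\<^sub>*\<^bsub>HA\<^esub> = (\<lambda>g. 0)" "f \<boxplus>\<^bsub>HA\<^esub> h = (\<lambda>g. f g + h g)" "c \<odot>\<^bsub>HA\<^esub> f = (\<lambda>g. c * f g)"
  by (simp_all add: hecke_algebra_def)

lemma hecke_L_affine:
  assumes a: "a \<noteq> 0" shows "hecke_L affine_group (transl M) (x, a) = index M (M \<inter> dil a)"
proof -
  have conj: "(x, a) <#\<^bsub>affine_group\<^esub> transl M #>\<^bsub>affine_group\<^esub> (inv\<^bsub>affine_group\<^esub> (x, a)) = transl (dil a)"
    unfolding l_coset_affine using a by (auto simp: r_coset_def transl_def dil_def)
  have "transl M \<inter> transl (dil a) = transl (M \<inter> dil a)" by (auto simp: transl_def)
  moreover have "lcosets\<^bsub>affine_group\<lparr>carrier := transl M\<rparr>\<^esub> (transl (M \<inter> dil a)) =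
      (`) (\<lambda>z. (z, 1)) ` ((\<lambda>x. (+) x ` (M \<inter> dil a)) ` M)"
  proof -
    have "(m, 1) <#\<^bsub>affine_group\<lparr>carrier := transl M\<rparr>\<^esub> transl (M \<inter> dil a) = (\<lambda>z. (z, 1)) ` ((+) m ` (M \<inter> dil a))" for m
      by (auto simp: l_coset_def transl_def)
    then show ?thesis by (auto simp: LCOSETS_def transl_def image_iff)
  qed
  moreover have "inj ((`) (\<lambda>z :: 'k. (z, 1 :: 'k)))" by (auto intro!: injI simp: inj_image_eq_iff inj_def)
  ultimately show ?thesis
    unfolding hecke_L_def conj index_def by (simp add: card_image inj_on_subset)
qed

lemma index_scale:
  fixes c :: 'k
  assumes c: "c \<noteq> 0" shows "index ((*) c ` L) ((*) c ` I) = index L I"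
proof -
  have "(\<lambda>x. (+) x ` (*) c ` I) ` (*) c ` L = (`) ((*) c) ` ((\<lambda>x. (+) x ` I) ` L)"
    by (simp add: image_image distrib_left)
  moreover have "inj ((`) ((*) c))" using c by (auto intro!: injI simp: inj_image_eq_iff inj_def)
  ultimately show ?thesis unfolding index_def by (simp add: card_image inj_on_subset)
qed

lemma hecke_Delta_affine:
  assumes a: "a \<noteq> 0"
  shows "hecke_Delta affine_group (transl M) (inv\<^bsub>affine_group\<^esub> (x, a)) = modular a"
proof -
  have "(*) a ` M = dil a" by (simp add: dil_def)
  moreover have "(*) a ` (M \<inter> dil (1 / a)) = M \<inter> dil a"
  proof -
    have "(*) a ` (M \<inter> dil (1 / a)) = (*) a ` M \<inter> (*) a ` dil (1 / a)"
      using a by (intro image_Int) (auto simp: inj_def)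
    also have "(*) a ` dil (1 / a) = M" using a by (simp add: dil_def image_image)
    finally show ?thesis by (simp add: dil_def Int_commute)
  qed
  ultimately have "index (dil a) (M \<inter> dil a) = index M (M \<inter> dil (1 / a))"
    using index_scale[OF a, of M "M \<inter> dil (1 / a)"] by simp
  then show ?thesis using a by (simp add: hecke_Delta_def modular_def hecke_L_affine)
qed

lemma HA_star:
  "a \<noteq> 0 \<Longrightarrow> (f\<^sup>\<star>\<^bsub>HA\<^esub>) (x, a) = of_real (modular a) * cnj (f (- x / a, 1 / a))" "(f\<^sup>\<star>\<^bsub>HA\<^esub>) (x, 0) = 0"
  using hecke_Delta_affine[of a x] by (simp_all add: hecke_algebra_def)

text \<open>
  The left coset of \<open>(y, b)\<close> is \<open>(y + b M) \<times> {b}\<close>.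
\<close>

lemma HA_times:
  assumes f: "f \<in> carrier HA" and h: "h \<in> carrier HA" and a: "a \<noteq> 0"
  shows "(f \<boxtimes>\<^bsub>HA\<^esub> h) (x, a) = (\<Sum>b\<in>degrees f. conv b (slice f b) (slice h (a / b)) x)"
proof -
  let ?lc = "\<lambda>(b, y). (y, b) <#\<^bsub>affine_group\<^esub> transl M"
  let ?S = "{C \<in> lcosets\<^bsub>affine_group\<^esub> (transl M). \<exists>y\<in>C. f y \<noteq> 0}"
  define V where "V C = (let y = (SOME y. y \<in> C) in f y * h (inv\<^bsub>affine_group\<^esub> y \<otimes>\<^bsub>affine_group\<^esub> (x, a)))" for C
  have "\<exists>Y. transversal (dil b) {y. f (y, b) \<noteq> 0} Y \<and> Y \<subseteq> {y. f (y, b) \<noteq> 0}" if "b \<noteq> 0" for b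
    using support_transversal[OF that lattice_periodic_D(3)[OF HA_lattice_periodic[OF f that]]] by metis
  then obtain Y where Y: "\<And>b. b \<noteq> 0 \<Longrightarrow> transversal (dil b) {y. f (y, b) \<noteq> 0} (Y b)"
    "\<And>b. b \<noteq> 0 \<Longrightarrow> Y b \<subseteq> {y. f (y, b) \<noteq> 0}" by metis
  have fin: "finite (Y b)" if "b \<in> degrees f" for b
    using Y(1) degrees_nonzero[OF f that] by (simp add: transversal_def)
  have "bij_betw ?lc (Sigma (degrees f) Y) ?S"
    unfolding bij_betw_def
  proof
    show "inj_on ?lc (Sigma (degrees f) Y)"
    proof (rule inj_onI, clarify)
      fix b y b' y' assume b: "b \<in> degrees f" "y \<in> Y b" "b' \<in> degrees f" "y' \<in> Y b'"
        and eq: "(y, b) <#\<^bsub>affine_group\<^esub> transl M = (y', b') <#\<^bsub>affine_group\<^esub> transl M"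
      have "(y, b) \<in> (y, b) <#\<^bsub>affine_group\<^esub> transl M" using zero_M by (force simp: l_coset_affine)
      then have "(y, b) \<in> (y', b') <#\<^bsub>affine_group\<^esub> transl M" by (simp only: eq)
      then obtain m where m: "m \<in> M" "y = y' + b' * m" "b = b'" unfolding l_coset_affine by blast
      then have "y - y' \<in> dil b" "y - y \<in> dil b" using zero_M by (auto simp: dil_def image_iff)
      then show "b = b' \<and> y = y'"
        using Y[OF degrees_nonzero[OF f b(1)]] b m(3) unfolding transversal_def by blast
    qed
    show "?lc ` Sigma (degrees f) Y = ?S"
    proof (intro equalityI subsetI)
      fix C assume "C \<in> ?lc ` Sigma (degrees f) Y"
      then obtain b y where b: "b \<in> degrees f" "y \<in> Y b" "C = (y, b) <#\<^bsub>affine_group\<^esub> transl M" by auto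
      have b0: "b \<noteq> 0" using degrees_nonzero[OF f b(1)] .
      have "(y, b) \<in> C" unfolding b(3) using zero_M by (force simp: l_coset_affine)
      moreover have "f (y, b) \<noteq> 0" using Y(2)[OF b0] b(2) by blast
      moreover have "C \<in> lcosets\<^bsub>affine_group\<^esub> (transl M)" using b(3) b0 by (auto simp: LCOSETS_def)
      ultimately show "C \<in> ?S" by blast
    next
      fix C assume C: "C \<in> ?S"
      then obtain z b where z: "b \<noteq> 0" "C = (z, b) <#\<^bsub>affine_group\<^esub> transl M" by (auto simp: LCOSETS_def)
      then obtain m where m: "m \<in> M" "f (z + b * m, b) \<noteq> 0" using C by (auto simp: l_coset_affine)
      then have "f (z, b) \<noteq> 0" using lattice_periodic_D(2)[OF HA_lattice_periodic[OF f z(1)]] by simp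
      then obtain y where y: "y \<in> Y b" "z - y \<in> dil b" "b \<in> degrees f"
        using Y(1)[OF z(1)] unfolding transversal_def degrees_def by blast
      then obtain k where k: "k \<in> M" "z = y + b * k" by (auto simp: dil_def algebra_simps)
      have "(z, b) <#\<^bsub>affine_group\<^esub> transl M = (y, b) <#\<^bsub>affine_group\<^esub> transl M"
      proof (unfold l_coset_affine, intro equalityI subsetI; clarify)
        fix i assume "i \<in> M"
        then show "(z + b * i, b) \<in> (\<lambda>i. (y + b * i, b)) ` M"
          using k by (intro image_eqI[of _ _ "k + i"]) (auto simp: add_M algebra_simps)
      next
        fix i assume "i \<in> M"
        then show "(y + b * i, b) \<in> (\<lambda>i. (z + b * i, b)) ` M"
          using k by (intro image_eqI[of _ _ "i - k"]) (auto simp: diff_M algebra_simps)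
      qed
      then show "C \<in> ?lc ` Sigma (degrees f) Y" using y z(2) by force
    qed
  qed
  note bij = this
  have V: "V ((y, b) <#\<^bsub>affine_group\<^esub> transl M) = f (y, b) * h ((x - y) / b, a / b)" if b: "b \<noteq> 0" for y b
  proof -
    let ?C = "(y, b) <#\<^bsub>affine_group\<^esub> transl M"
    have "(y, b) \<in> ?C" using zero_M by (force simp: l_coset_affine)
    then have "(SOME y. y \<in> ?C) \<in> ?C" by (rule someI)
    then obtain m where m: "m \<in> M" "(SOME y. y \<in> ?C) = (y + b * m, b)" unfolding l_coset_affine by blast
    have e: "- (y + b * m) / b + 1 / b * x = (x - y) / b + (- m)" using b by (simp add: field_simps)
    have ab: "a / b \<noteq> 0" using a b by simp
    have "V ?C = f (y + b * m, b) * h ((x - y) / b + (- m), a / b)"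
      unfolding V_def m(2) Let_def affine_group_inv[OF b] affine_group_simps(2) e by simp
    then show ?thesis
      using lattice_periodic_D(2)[OF HA_lattice_periodic[OF f b] m(1)] lattice_periodic_D(1)[OF HA_lattice_periodic[OF h ab] uminus_M[OF m(1)]] by simp
  qed
  have "(f \<boxtimes>\<^bsub>HA\<^esub> h) (x, a) = (\<Sum>C\<in>?S. V C)" using a by (simp add: hecke_algebra_def V_def)
  also have "\<dots> = (\<Sum>p\<in>Sigma (degrees f) Y. V (?lc p))" by (rule sum.reindex_bij_betw[OF bij, symmetric])
  also have "\<dots> = (\<Sum>(b, y)\<in>Sigma (degrees f) Y. f (y, b) * h ((x - y) / b, a / b))"
    using V degrees_nonzero[OF f] by (intro sum.cong refl) auto
  also have "\<dots> = (\<Sum>b\<in>degrees f. \<Sum>y\<in>Y b. f (y, b) * h ((x - y) / b, a / b))"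
    by (rule sum.Sigma[symmetric]) (auto simp: HA_degrees_finite[OF f] fin)
  also have "\<dots> = (\<Sum>b\<in>degrees f. conv b (slice f b) (slice h (a / b)) x)"
  proof (rule sum.cong[OF refl])
    fix b assume "b \<in> degrees f"
    then have b: "b \<noteq> 0" by (rule degrees_nonzero[OF f])
    have ab: "a / b \<noteq> 0" using a b by simp
    show "(\<Sum>y\<in>Y b. f (y, b) * h ((x - y) / b, a / b)) = conv b (slice f b) (slice h (a / b)) x"
      unfolding conv_def
      by (rule coset_sum_eq[OF dil_subgroup conv_periodic(1)[OF b HA_lattice_periodic[OF f b] HA_lattice_periodic[OF h ab]] Y(1)[OF b], symmetric]) auto
  qed
  finally show ?thesis .
qed

lemma HA_times_zero: "(f \<boxtimes>\<^bsub>HA\<^esub> h) (x, 0) = 0"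
  by (simp add: hecke_algebra_def)

subsection \<open>The Fourier transform of the Hecke algebra\<close>

lemma lattice_periodic_sum:
  assumes I: "finite I" and g: "\<And>i. i \<in> I \<Longrightarrow> lattice_periodic b (g i)"
  shows "lattice_periodic b (\<lambda>x. \<Sum>i\<in>I. g i x)"
proof (rule lattice_periodic_I)
  show "(\<Sum>i\<in>I. g i (x + m)) = (\<Sum>i\<in>I. g i x)" "(\<Sum>i\<in>I. g i (x + b * m)) = (\<Sum>i\<in>I. g i x)" if "m \<in> M" for x m
    using lattice_periodic_D(1,2)[OF g that] by (auto intro: sum.cong)
  have "\<exists>N::nat. 0 < N \<and> (\<forall>i\<in>I. \<forall>x. g i x \<noteq> 0 \<longrightarrow> of_nat N * x \<in> M)"
    by (rule bounded_denominators_common[OF I lattice_periodic_D(3)[OF g]])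
  then obtain N :: nat where N: "0 < N" "\<forall>i\<in>I. \<forall>x. g i x \<noteq> 0 \<longrightarrow> of_nat N * x \<in> M" by blast
  show "bounded_denominators (\<lambda>x. \<Sum>i\<in>I. g i x)"
    unfolding bounded_denominators_def
  proof (intro exI[of _ N] conjI allI impI N(1))
    fix x assume "(\<Sum>i\<in>I. g i x) \<noteq> 0"
    then obtain i where "i \<in> I" "g i x \<noteq> 0" by (metis sum.neutral)
    then show "of_nat N * x \<in> M" using N(2) by blast
  qed
qed

lemma lattice_periodic_plus: "lattice_periodic b g \<Longrightarrow> lattice_periodic b h \<Longrightarrow> lattice_periodic b (\<lambda>x. g x + h x)"
  using lattice_periodic_sum[of "UNIV :: bool set" b "\<lambda>i. if i then g else h"] by (simp add: UNIV_bool add.commute)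

lemma lattice_periodic_scale: "lattice_periodic b g \<Longrightarrow> lattice_periodic b (\<lambda>x. c * g x)"
  unfolding lattice_periodic_def periodic_def by (auto intro: bounded_denominators_mono)

lemma lattice_periodic_zero: "lattice_periodic b (\<lambda>x. 0)"
  using lattice_periodic_sum[of "{}" b] by simp

lemma HA_zero_closed: "\<zero>\<^sub>*\<^bsub>HA\<^esub> \<in> carrier HA"
  by (simp add: HA_carrier_iff HA_simps(1) lattice_periodic_zero degrees_def)

lemma HA_plus_closed:
  assumes "f \<in> carrier HA" "h \<in> carrier HA" shows "f \<boxplus>\<^bsub>HA\<^esub> h \<in> carrier HA"
proof -
  have "degrees (f \<boxplus>\<^bsub>HA\<^esub> h) \<subseteq> degrees f \<union> degrees h" by (auto simp: degrees_def HA_simps(2))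
  then have "finite (degrees (f \<boxplus>\<^bsub>HA\<^esub> h))"
    using assms HA_degrees_finite by (meson finite_UnI finite_subset)
  then show ?thesis using assms by (simp add: HA_carrier_iff HA_simps(2) lattice_periodic_plus)
qed

lemma HA_scale_closed:
  assumes "f \<in> carrier HA" shows "c \<odot>\<^bsub>HA\<^esub> f \<in> carrier HA"
proof -
  have "degrees (c \<odot>\<^bsub>HA\<^esub> f) \<subseteq> degrees f" by (auto simp: degrees_def HA_simps(3))
  then have "finite (degrees (c \<odot>\<^bsub>HA\<^esub> f))"
    using assms HA_degrees_finite by (meson finite_subset)
  then show ?thesis using assms by (simp add: HA_carrier_iff HA_simps(3) lattice_periodic_scale)
qed

lemma HA_times_nonzero:
  assumes f: "f \<in> carrier HA" and h: "h \<in> carrier HA" and nz: "(f \<boxtimes>\<^bsub>HA\<^esub> h) (x, a) \<noteq> 0"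
  shows "\<exists>y b. b \<noteq> 0 \<and> f (y, b) \<noteq> 0 \<and> h ((x - y) / b, a / b) \<noteq> 0"
proof -
  have a: "a \<noteq> 0" using nz HA_times_zero by auto
  then have "(\<Sum>b\<in>degrees f. conv b (slice f b) (slice h (a / b)) x) \<noteq> 0" using nz HA_times[OF f h] by simp
  then obtain b where b: "b \<in> degrees f" "conv b (slice f b) (slice h (a / b)) x \<noteq> 0"
    by (rule sum.not_neutral_contains_not_neutral)
  have b0: "b \<noteq> 0" using degrees_nonzero[OF f b(1)] .
  have ab: "a / b \<noteq> 0" using a b0 by simp
  show ?thesis using conv_nonzero[OF b0 HA_lattice_periodic[OF f b0] HA_lattice_periodic[OF h ab] b(2)] b0 by blast
qed

lemma degrees_times:
  assumes f: "f \<in> carrier HA" and h: "h \<in> carrier HA"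
  shows "degrees (f \<boxtimes>\<^bsub>HA\<^esub> h) \<subseteq> (\<lambda>(b, c). b * c) ` (degrees f \<times> degrees h)"
proof
  fix a assume "a \<in> degrees (f \<boxtimes>\<^bsub>HA\<^esub> h)"
  then obtain x where "(f \<boxtimes>\<^bsub>HA\<^esub> h) (x, a) \<noteq> 0" by (auto simp: degrees_def)
  from HA_times_nonzero[OF f h this] obtain y b
    where b: "b \<noteq> 0" "f (y, b) \<noteq> 0" "h ((x - y) / b, a / b) \<noteq> 0" by blast
  have "(b, a / b) \<in> degrees f \<times> degrees h" using b by (auto simp: degrees_def)
  moreover have "a = (\<lambda>(b, c). b * c) (b, a / b)" using b(1) by simp
  ultimately show "a \<in> (\<lambda>(b, c). b * c) ` (degrees f \<times> degrees h)" by (rule rev_image_eqI)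
qed

lemma slice_times:
  assumes f: "f \<in> carrier HA" and h: "h \<in> carrier HA" and a: "a \<noteq> 0"
  shows "slice (f \<boxtimes>\<^bsub>HA\<^esub> h) a = (\<lambda>x. \<Sum>b\<in>degrees f. conv b (slice f b) (slice h (a / b)) x)"
  using HA_times[OF assms] by (rule ext)

lemma conv_slice_lattice_periodic:
  assumes f: "f \<in> carrier HA" and h: "h \<in> carrier HA" and a: "a \<noteq> 0" and b: "b \<in> degrees f"
  shows "lattice_periodic a (conv b (slice f b) (slice h (a / b)))"
proof -
  have b0: "b \<noteq> 0" using degrees_nonzero[OF f b] .
  have ab: "a / b \<noteq> 0" using a b0 by simp
  have "lattice_periodic (b * (a / b)) (conv b (slice f b) (slice h (a / b)))"
    by (rule conv_lattice_periodic[OF b0 ab HA_lattice_periodic[OF f b0] HA_lattice_periodic[OF h ab]])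
  then show ?thesis using b0 by simp
qed

lemma HA_times_closed:
  assumes f: "f \<in> carrier HA" and h: "h \<in> carrier HA" shows "f \<boxtimes>\<^bsub>HA\<^esub> h \<in> carrier HA"
proof (subst HA_carrier_iff, intro conjI allI impI)
  show "(f \<boxtimes>\<^bsub>HA\<^esub> h) (x, 0) = 0" for x by (rule HA_times_zero)
  show "finite (degrees (f \<boxtimes>\<^bsub>HA\<^esub> h))"
    using degrees_times[OF f h] HA_degrees_finite[OF f] HA_degrees_finite[OF h]
    by (meson finite_SigmaI finite_imageI finite_subset)
  show "lattice_periodic a (slice (f \<boxtimes>\<^bsub>HA\<^esub> h) a)" if a: "a \<noteq> 0" for a
  proof -
    have "lattice_periodic a (\<lambda>x. \<Sum>b\<in>degrees f. conv b (slice f b) (slice h (a / b)) x)"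
      by (rule lattice_periodic_sum[OF HA_degrees_finite[OF f]]) (rule conv_slice_lattice_periodic[OF f h a])
    then show ?thesis by (simp only: HA_times[OF f h a])
  qed
qed

lemma slice_star: "a \<noteq> 0 \<Longrightarrow> slice (f\<^sup>\<star>\<^bsub>HA\<^esub>) a = (\<lambda>x. of_real (modular a) * cnj (slice f (1 / a) (- x / a)))"
  by (rule ext) (rule HA_star(1))

lemma HA_star_nonzero: "(f\<^sup>\<star>\<^bsub>HA\<^esub>) (x, a) \<noteq> 0 \<Longrightarrow> a \<noteq> 0 \<and> f (- x / a, 1 / a) \<noteq> 0"
  using HA_star(1)[of a f x] HA_star(2)[of f x] by (cases "a = 0") auto

lemma HA_star_closed:
  assumes f: "f \<in> carrier HA" shows "f\<^sup>\<star>\<^bsub>HA\<^esub> \<in> carrier HA"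
proof (subst HA_carrier_iff, intro conjI allI impI)
  show "(f\<^sup>\<star>\<^bsub>HA\<^esub>) (x, 0) = 0" for x by (rule HA_star(2))
  have "degrees (f\<^sup>\<star>\<^bsub>HA\<^esub>) \<subseteq> (\<lambda>b. 1 / b) ` degrees f"
  proof
    fix a assume "a \<in> degrees (f\<^sup>\<star>\<^bsub>HA\<^esub>)"
    then obtain x where "(f\<^sup>\<star>\<^bsub>HA\<^esub>) (x, a) \<noteq> 0" by (auto simp: degrees_def)
    then have "a \<noteq> 0 \<and> f (- x / a, 1 / a) \<noteq> 0" by (rule HA_star_nonzero)
    then show "a \<in> (\<lambda>b. 1 / b) ` degrees f" by (intro image_eqI[of _ _ "1 / a"]) (auto simp: degrees_def)
  qed
  then show "finite (degrees (f\<^sup>\<star>\<^bsub>HA\<^esub>))" using HA_degrees_finite[OF f] by (meson finite_imageI finite_subset)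
  show "lattice_periodic a (slice (f\<^sup>\<star>\<^bsub>HA\<^esub>) a)" if a: "a \<noteq> 0" for a
    unfolding slice_star[OF a] using a by (intro fourier_star(1) HA_lattice_periodic[OF f]) auto
qed

text \<open>
  The transform of the part of degree \<open>b\<close> is the coefficient at the group element \<open>(0, b\<^sup>-\<^sup>1)\<close>: conjugation by a
  dilation acts on translations by \<open>b\<close> and on the dual variable by \<open>b\<^sup>-\<^sup>1\<close>.
\<close>

definition transform :: "('k \<times> 'k \<Rightarrow> complex) \<Rightarrow> 'k \<times> 'k \<Rightarrow> 'k \<Rightarrow> complex" where
  "transform f g t = (if fst g = 0 \<and> snd g \<noteq> 0 then fourier (1 / snd g) (slice f (1 / snd g)) t else 0)"

lemma transform_outside: "fst g \<noteq> 0 \<or> snd g = 0 \<Longrightarrow> transform f g = (\<lambda>t. 0)"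
  by (auto simp: transform_def)

lemma transform_zero_slice: "slice f (1 / snd g) = (\<lambda>x. 0) \<Longrightarrow> transform f g = (\<lambda>t. 0)"
proof -
  assume "slice f (1 / snd g) = (\<lambda>x. 0)"
  moreover have "fourier b (\<lambda>x. 0) t = 0" for b t by (simp add: fourier_def coset_sum_def)
  ultimately show ?thesis by (simp add: transform_def fun_eq_iff)
qed

lemma supp_transform:
  assumes f: "f \<in> carrier HA"
  shows "{g. transform f g \<noteq> (\<lambda>t. 0)} \<subseteq> (\<lambda>b. (0, 1 / b)) ` degrees f"
proof
  fix g assume g: "g \<in> {g. transform f g \<noteq> (\<lambda>t. 0)}"
  then have "fst g = 0" "snd g \<noteq> 0" using transform_outside by blast+
  moreover have "1 / snd g \<in> degrees f" using g transform_zero_slice[of f g] by (auto simp: degrees_def)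
  ultimately show "g \<in> (\<lambda>b. (0, 1 / b)) ` degrees f"
    by (intro image_eqI[of _ _ "1 / snd g"]) (auto simp: prod_eq_iff)
qed

lemma transform_closed:
  assumes f: "f \<in> carrier HA" shows "transform f \<in> carrier cs.CA"
proof (rule cs.CA_I)
  fix g :: "'k \<times> 'k"
  show "transform f g \<in> coset_algebra M"
  proof (cases "fst g = 0 \<and> snd g \<noteq> 0")
    case True
    then have b: "1 / snd g \<noteq> 0" by simp
    obtain T d where T: "finite T" "d \<noteq> 0" "fourier (1 / snd g) (slice f (1 / snd g)) =
        (\<lambda>t. \<Sum>s\<in>T. fourier (1 / snd g) (slice f (1 / snd g)) s * indicator ((\<lambda>m. s + d * m) ` M) t)"
      by (rule fourier_step_function[OF b HA_lattice_periodic[OF f b]])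
    have "(\<lambda>t. \<Sum>s\<in>T. fourier (1 / snd g) (slice f (1 / snd g)) s * indicator ((\<lambda>m. s + d * m) ` M) t) \<in> coset_algebra M"
      by (intro cs.D_sum T(1) cs.D_scale indicator_coset_algebra T(2))
    moreover have "transform f g = fourier (1 / snd g) (slice f (1 / snd g))"
      using True by (simp add: transform_def fun_eq_iff)
    ultimately show ?thesis using T(3) by simp
  next
    case False
    then show ?thesis using transform_outside[of g f] cs.D_zero by auto
  qed
next
  show "finite {g. transform f g \<noteq> (\<lambda>t. 0)}"
    using supp_transform[OF f] HA_degrees_finite[OF f] by (meson finite_imageI finite_subset)
qed (auto intro: transform_outside)

lemma transform_times:
  assumes f: "f \<in> carrier HA" and h: "h \<in> carrier HA"
  shows "transform (f \<boxtimes>\<^bsub>HA\<^esub> h) = transform f \<boxtimes>\<^bsub>cs.CA\<^esub> transform h"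
proof (rule sym, rule cs.CA_times_eqI)
  fix g :: "'k \<times> 'k" and t assume g: "g \<in> carrier affine_group"
  obtain x a where xa: "g = (x, a)" by (cases g)
  have a: "a \<noteq> 0" using g xa by simp
  let ?S = "(\<lambda>b. (0, 1 / b)) ` degrees f"
  have fin: "finite ?S" using HA_degrees_finite[OF f] by simp
  have inj: "inj_on (\<lambda>b. (0 :: 'k, 1 / b)) (degrees f)" by (auto intro!: inj_onI)
  have "(transform f \<boxtimes>\<^bsub>cs.CA\<^esub> transform h) g t =
      (\<Sum>k\<in>?S. transform f k t * transform h (inv\<^bsub>affine_group\<^esub> k \<otimes>\<^bsub>affine_group\<^esub> g) (aff_act (inv\<^bsub>affine_group\<^esub> k) t))"
    by (rule cs.CA_times[OF transform_closed[OF f] fin supp_transform[OF f] g])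
  also have "\<dots> = (\<Sum>b\<in>degrees f. transform f (0, 1 / b) t * transform h (b * x, b * a) (b * t))"
    unfolding sum.reindex[OF inj] o_apply
  proof (rule sum.cong[OF refl])
    fix b assume "b \<in> degrees f"
    then have b: "b \<noteq> 0" by (rule degrees_nonzero[OF f])
    then have "inv\<^bsub>affine_group\<^esub> (0, 1 / b) = (0, b)" by simp
    then show "transform f (0, 1 / b) t * transform h (inv\<^bsub>affine_group\<^esub> (0, 1 / b) \<otimes>\<^bsub>affine_group\<^esub> g) (aff_act (inv\<^bsub>affine_group\<^esub> (0, 1 / b)) t) =
      transform f (0, 1 / b) t * transform h (b * x, b * a) (b * t)"
      by (simp only: xa affine_group_simps aff_act_def split add_0)
  qed
  also have "\<dots> = transform (f \<boxtimes>\<^bsub>HA\<^esub> h) g t"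
  proof (cases "x = 0")
    case False
    then have "transform h (b * x, b * a) (b * t) = 0" if "b \<in> degrees f" for b
      using degrees_nonzero[OF f that] by (simp add: transform_def)
    then show ?thesis using False by (simp add: xa transform_def)
  next
    case True
    have d: "1 / a \<noteq> 0" using a by simp
    have "transform (f \<boxtimes>\<^bsub>HA\<^esub> h) g t =
        fourier (1 / a) (\<lambda>x. \<Sum>b\<in>degrees f. conv b (slice f b) (slice h (1 / a / b)) x) t"
    proof -
      have "transform (f \<boxtimes>\<^bsub>HA\<^esub> h) g t = fourier (1 / a) (slice (f \<boxtimes>\<^bsub>HA\<^esub> h) (1 / a)) t"
        using True a by (simp add: transform_def xa)
      then show ?thesis unfolding slice_times[OF f h d] .
    qed
    also have "\<dots> = (\<Sum>b\<in>degrees f. fourier (1 / a) (conv b (slice f b) (slice h (1 / a / b))) t)"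
      by (rule fourier_sum[OF d HA_degrees_finite[OF f]]) (rule conv_slice_lattice_periodic[OF f h d])
    also have "\<dots> = (\<Sum>b\<in>degrees f. transform f (0, 1 / b) t * transform h (b * x, b * a) (b * t))"
    proof (rule sum.cong[OF refl])
      fix b assume "b \<in> degrees f"
      then have b: "b \<noteq> 0" by (rule degrees_nonzero[OF f])
      have c: "1 / a / b \<noteq> 0" using a b by simp
      have "fourier (b * (1 / a / b)) (conv b (slice f b) (slice h (1 / a / b))) t =
          fourier b (slice f b) t * fourier (1 / a / b) (slice h (1 / a / b)) (b * t)"
        by (rule fourier_conv[OF b c HA_lattice_periodic[OF f b] HA_lattice_periodic[OF h c]])
      moreover have "b * (1 / a / b) = 1 / a" "1 / (b * a) = 1 / a / b" using b by simp_all
      ultimately show "fourier (1 / a) (conv b (slice f b) (slice h (1 / a / b))) t =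
          transform f (0, 1 / b) t * transform h (b * x, b * a) (b * t)"
        using True a b by (simp add: transform_def mult.commute)
    qed
    finally show ?thesis by simp
  qed
  finally show "(transform f \<boxtimes>\<^bsub>cs.CA\<^esub> transform h) g t = transform (f \<boxtimes>\<^bsub>HA\<^esub> h) g t" .
qed (auto intro: transform_outside)

lemma transform_star:
  assumes f: "f \<in> carrier HA"
  shows "transform (f\<^sup>\<star>\<^bsub>HA\<^esub>) = (transform f)\<^sup>\<star>\<^bsub>cs.CA\<^esub>"
proof (intro ext)
  fix g :: "'k \<times> 'k" and t
  obtain x a where xa: "g = (x, a)" by (cases g)
  show "transform (f\<^sup>\<star>\<^bsub>HA\<^esub>) g t = ((transform f)\<^sup>\<star>\<^bsub>cs.CA\<^esub>) g t"
  proof (cases "x = 0 \<and> a \<noteq> 0")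
    case True
    then have d: "1 / a \<noteq> 0" by simp
    then have n: "lattice_periodic (1 / (1 / a)) (slice f (1 / (1 / a)))" by (intro HA_lattice_periodic[OF f]) simp
    have "transform (f\<^sup>\<star>\<^bsub>HA\<^esub>) g t = cnj (fourier (1 / (1 / a)) (slice f (1 / (1 / a))) (1 / a * t))"
      using fourier_star(2)[OF d n, of t] True by (simp only: transform_def xa slice_star[OF d] fst_conv snd_conv) simp
    then show ?thesis unfolding cs.CA_star using True by (simp add: xa transform_def aff_act_def)
  next
    case False
    then show ?thesis by (auto simp: cs.CA_star xa transform_def)
  qed
qed

lemma transform_star_hom: "star_hom HA cs.CA transform"
  unfolding star_hom_def
proof (intro conjI ballI allI)
  fix f h c assume f: "f \<in> carrier HA"
  show "transform f \<in> carrier cs.CA" by (rule transform_closed[OF f])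
  show "transform (f\<^sup>\<star>\<^bsub>HA\<^esub>) = (transform f)\<^sup>\<star>\<^bsub>cs.CA\<^esub>" by (rule transform_star[OF f])
  show "transform (c \<odot>\<^bsub>HA\<^esub> f) = c \<odot>\<^bsub>cs.CA\<^esub> transform f"
    using fourier_scale HA_lattice_periodic[OF f] by (auto simp: cs.CA_simps(3) HA_simps(3) transform_def fun_eq_iff)
  assume h: "h \<in> carrier HA"
  show "transform (f \<boxplus>\<^bsub>HA\<^esub> h) = transform f \<boxplus>\<^bsub>cs.CA\<^esub> transform h"
    using fourier_plus HA_lattice_periodic[OF f] HA_lattice_periodic[OF h]
    by (auto simp: cs.CA_simps(2) HA_simps(2) transform_def fun_eq_iff)
  show "transform (f \<boxtimes>\<^bsub>HA\<^esub> h) = transform f \<boxtimes>\<^bsub>cs.CA\<^esub> transform h" by (rule transform_times[OF f h])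
qed

lemma transform_bound:
  assumes f: "f \<in> carrier HA" and B: "\<And>g t. cmod (transform f g t) \<le> B"
  shows "cmod (f (x, a)) \<le> B"
proof (cases "a = 0")
  case True
  have "0 \<le> B" using B order_trans[OF norm_ge_zero] by blast
  then show ?thesis using True HA_zero_degree[OF f] by simp
next
  case False
  have "cmod (fourier a (slice f a) t) \<le> B" for t
    using B[of "(0, 1 / a)" t] False by (simp add: transform_def)
  from fourier_inversion[OF False HA_lattice_periodic[OF f False] this] show ?thesis .
qed

lemma transform_inj: "inj_on transform (carrier HA)"
proof (rule inj_onI)
  fix f h assume f: "f \<in> carrier HA" and h: "h \<in> carrier HA" and eq: "transform f = transform h"
  let ?d = "f \<boxplus>\<^bsub>HA\<^esub> (-1) \<odot>\<^bsub>HA\<^esub> h"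
  have d: "?d \<in> carrier HA" by (intro HA_plus_closed HA_scale_closed f h)
  have "transform ?d = transform f \<boxplus>\<^bsub>cs.CA\<^esub> (-1) \<odot>\<^bsub>cs.CA\<^esub> transform h"
    using transform_star_hom f h HA_scale_closed[OF h] by (simp add: star_hom_def)
  then have "cmod (transform ?d g t) \<le> 0" for g t using eq by (simp add: cs.CA_simps)
  from transform_bound[OF d this] have "?d (x, a) = 0" for x a by simp
  then show "f = h" by (auto simp: HA_simps fun_eq_iff)
qed

lemma HA_star_algebra: "star_algebra HA"
proof (rule star_algebra_inject[OF cs.CA_star_algebra transform_inj transform_star_hom])
  show "transform \<zero>\<^sub>*\<^bsub>HA\<^esub> = \<zero>\<^sub>*\<^bsub>cs.CA\<^esub>"
    unfolding HA_simps(1) cs.CA_simps(1) by (intro ext, subst transform_zero_slice) auto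
qed (fact HA_zero_closed HA_plus_closed HA_scale_closed HA_times_closed HA_star_closed)+

subsection \<open>The transform is isometric\<close>

text \<open>
  The norm of the crossed product, seen on the Hecke algebra.
\<close>

definition cross_norm :: "('k \<times> 'k \<Rightarrow> complex) \<Rightarrow> real" where
  "cross_norm f = env_norm cs.CA (transform f)"

lemma cross_norm_seminorm: "cstar_seminorm HA cross_norm"
proof -
  have "cstar_seminorm cs.CA (env_norm cs.CA)"
    by (rule star_algebra.env_norm_seminorm[OF cs.CA_star_algebra cs.CA_env_finite])
  then show ?thesis
    using transform_star_hom HA_star_closed unfolding cstar_seminorm_def star_hom_def cross_norm_def by simp
qed

lemma coefficient_le_cross_norm: "f \<in> carrier HA \<Longrightarrow> cmod (f (x, a)) \<le> cross_norm f"
  unfolding cross_norm_def by (rule transform_bound[OF _ cs.coeff_le_env_norm[OF transform_closed]])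

lemma cross_norm_iter_sq: "f \<in> carrier HA \<Longrightarrow> cross_norm (iter_sq HA f k) = cross_norm f ^ 2 ^ Suc k"
  by (rule seminormed_star_algebra.seminorm_iter_sq[OF seminormed_star_algebraI[OF HA_star_algebra cross_norm_seminorm]])

lemma cross_norm_nonneg: "f \<in> carrier HA \<Longrightarrow> 0 \<le> cross_norm f"
  using cross_norm_seminorm by (simp add: cstar_seminorm_def)

lemma HA_seminorm_sum:
  assumes q: "cstar_seminorm HA q" and I: "finite I" and e: "\<And>i. i \<in> I \<Longrightarrow> e i \<in> carrier HA"
  shows "(\<lambda>g. \<Sum>i\<in>I. c i * e i g) \<in> carrier HA \<and> q (\<lambda>g. \<Sum>i\<in>I. c i * e i g) \<le> (\<Sum>i\<in>I. cmod (c i) * q (e i))"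
  using I e
proof (induction rule: finite_induct)
  case empty
  interpret seminormed_star_algebra HA q by (rule seminormed_star_algebraI[OF HA_star_algebra q])
  show ?case using HA_zero_closed q_zero by (simp add: HA_simps(1))
next
  case (insert i I)
  interpret seminormed_star_algebra HA q by (rule seminormed_star_algebraI[OF HA_star_algebra q])
  let ?s = "\<lambda>g. \<Sum>i\<in>I. c i * e i g"
  have s: "?s \<in> carrier HA" "q ?s \<le> (\<Sum>i\<in>I. cmod (c i) * q (e i))" using insert by auto
  have i: "c i \<odot>\<^bsub>HA\<^esub> e i \<in> carrier HA" using insert by (intro HA_scale_closed) auto
  have eq: "(\<lambda>g. \<Sum>i\<in>insert i I. c i * e i g) = c i \<odot>\<^bsub>HA\<^esub> e i \<boxplus>\<^bsub>HA\<^esub> ?s"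
    using insert by (simp add: HA_simps)
  have "q (c i \<odot>\<^bsub>HA\<^esub> e i \<boxplus>\<^bsub>HA\<^esub> ?s) \<le> cmod (c i) * q (e i) + (\<Sum>i\<in>I. cmod (c i) * q (e i))"
    using q_triangle[OF i s(1)] s(2) q_scale[of "e i" "c i"] insert(4) by simp
  then show ?case unfolding eq using HA_plus_closed[OF i s(1)] insert by simp
qed

text \<open>
  The elements that live on the finite group \<open>N\<^sup>-\<^sup>1 M / M\<close> in degree 1.
\<close>

definition finite_level :: "nat \<Rightarrow> ('k \<times> 'k \<Rightarrow> complex) set" where
  "finite_level N = {f \<in> carrier HA. \<forall>x a. f (x, a) \<noteq> 0 \<longrightarrow> a = 1 \<and> of_nat N * x \<in> M}"

lemma finite_level_iter_sq:
  assumes f: "f \<in> finite_level N" shows "iter_sq HA f k \<in> finite_level N"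
proof -
  have times: "u \<boxtimes>\<^bsub>HA\<^esub> v \<in> finite_level N" if "u \<in> finite_level N" "v \<in> finite_level N" for u v
    unfolding finite_level_def
  proof (intro CollectI conjI allI impI)
    have uv: "u \<in> carrier HA" "v \<in> carrier HA" using that by (auto simp: finite_level_def)
    then show "u \<boxtimes>\<^bsub>HA\<^esub> v \<in> carrier HA" by (rule HA_times_closed)
    fix x a assume "(u \<boxtimes>\<^bsub>HA\<^esub> v) (x, a) \<noteq> 0"
    from HA_times_nonzero[OF uv this] obtain y b where b: "u (y, b) \<noteq> 0" "v ((x - y) / b, a / b) \<noteq> 0" by blast
    then have "b = 1" "of_nat N * y \<in> M" "a / b = 1" "of_nat N * ((x - y) / b) \<in> M"
      using that unfolding finite_level_def by blast+
    then show "a = 1" "of_nat N * x \<in> M" using add_M[of "of_nat N * y" "of_nat N * (x - y)"]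
      by (auto simp: right_diff_distrib)
  qed
  have star: "f\<^sup>\<star>\<^bsub>HA\<^esub> \<in> finite_level N"
    unfolding finite_level_def
  proof (intro CollectI conjI allI impI)
    show "f\<^sup>\<star>\<^bsub>HA\<^esub> \<in> carrier HA" using f by (auto simp: finite_level_def intro: HA_star_closed)
    fix x a assume "(f\<^sup>\<star>\<^bsub>HA\<^esub>) (x, a) \<noteq> 0"
    from HA_star_nonzero[OF this] have "a \<noteq> 0" "1 / a = 1" "of_nat N * (- x / a) \<in> M"
      using f unfolding finite_level_def by blast+
    then show "a = 1" "of_nat N * x \<in> M" using uminus_M_iff[of "of_nat N * x"] by auto
  qed
  show ?thesis by (induction k) (simp_all add: times star f)
qed

text \<open>
  Elements of a fixed finite level are combinations of finitely many fixed elements, with coefficients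
  bounded by \<open>cross_norm\<close>.  So \<open>q \<le> C \<cdot> cross_norm\<close> on the level, and the constant disappears since the
  level contains all the \<open>(f\<^sup>\<star> f)\<^bsup>m\<^esup>\<close>.
\<close>

lemma seminorm_le_degree_one:
  assumes q: "cstar_seminorm HA q" and f: "f \<in> carrier HA" and deg: "degrees f \<subseteq> {1}"
  shows "q f \<le> cross_norm f"
proof -
  interpret seminormed_star_algebra HA q by (rule seminormed_star_algebraI[OF HA_star_algebra q])
  obtain N :: nat where N: "0 < N" "\<And>x. f (x, 1) \<noteq> 0 \<Longrightarrow> of_nat N * x \<in> M"
    using lattice_periodic_D(3)[OF HA_lattice_periodic[OF f one_neq_zero]] by (auto simp: bounded_denominators_def)
  have fN: "f \<in> finite_level N"
    using f deg N(2) by (auto simp: finite_level_def degrees_def)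
  obtain Y where Y: "transversal (dil 1) {x. of_nat N * x \<in> M} Y" "Y \<subseteq> {x. of_nat N * x \<in> M}"
    using dil_transversal[OF one_neq_zero N(1)] .
  have fin: "finite Y" using Y by (simp add: transversal_def)
  \<comment> \<open>The point masses of the finite group \<open>N\<^sup>-\<^sup>1 M / M\<close>.\<close>
  define e where "e y = (\<lambda>(x, a :: 'k). if a = 1 \<and> x - y \<in> M then 1 else 0 :: complex)" for y
  have e: "e y \<in> carrier HA" if y: "y \<in> Y" for y
    unfolding HA_carrier_iff
  proof (intro conjI allI impI)
    show "finite (degrees (e y))" by (rule finite_subset[of _ "{1}"]) (auto simp: degrees_def e_def)
    fix a :: 'k assume "a \<noteq> 0"
    have m: "x + m - y \<in> M \<longleftrightarrow> x - y \<in> M" if "m \<in> M" for x m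
      using add_M[of "x - y" m] diff_M[of "x + m - y" m] that by (auto simp: algebra_simps)
    show "lattice_periodic a (slice (e y) a)"
    proof (rule lattice_periodic_I)
      show "slice (e y) a (x + m) = slice (e y) a x" if "m \<in> M" for x m
        using m[OF that, of x] by (simp add: e_def)
      show "slice (e y) a (x + a * m) = slice (e y) a x" if "m \<in> M" for x m
        using m[OF that, of x] by (cases "a = 1") (simp_all add: e_def)
      have "of_nat N * x \<in> M" if "slice (e y) a x \<noteq> 0" for x
      proof -
        have "of_nat N * y \<in> M" "x - y \<in> M" using y Y(2) that by (auto simp: e_def split: if_splits)
        then have "of_nat N * y + of_nat N * (x - y) \<in> M" using add_M mult_M[OF of_nat_M] by blast
        then show ?thesis by (simp add: right_diff_distrib)
      qed
      then show "bounded_denominators (slice (e y) a)"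
        unfolding bounded_denominators_def using N(1) by blast
    qed
  qed (simp add: e_def)
  have decomp: "z = (\<lambda>g. \<Sum>y\<in>Y. z (y, 1) * e y g)" if z: "z \<in> finite_level N" for z
  proof
    fix g :: "'k \<times> 'k"
    obtain x a where g: "g = (x, a)" by (cases g)
    have zH: "z \<in> carrier HA" using z by (simp add: finite_level_def)
    show "z g = (\<Sum>y\<in>Y. z (y, 1) * e y g)"
    proof (cases "a = 1 \<and> of_nat N * x \<in> M")
      case True
      then obtain y0 where y0: "y0 \<in> Y" "x - y0 \<in> M" "\<And>y. y \<in> Y \<Longrightarrow> x - y \<in> M \<Longrightarrow> y = y0"
        using Y(1) unfolding transversal_def dil_1 by blast
      have "z (y0 + (x - y0), 1) = z (y0, 1)" using lattice_periodic_D(1)[OF HA_lattice_periodic[OF zH one_neq_zero] y0(2)] .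
      then have zg: "z (y0, 1) = z g" using True g by simp
      have summand: "z (y, 1) * e y g = (if y = y0 then z g else 0)" if "y \<in> Y" for y
      proof (cases "y = y0")
        case eq: True
        have "e y0 g = 1" using True y0(2) g by (simp add: e_def)
        then show ?thesis using zg eq by simp
      next
        case False
        then have "x - y \<notin> M" using y0(3)[OF that] by blast
        then have "e y g = 0" using g by (simp add: e_def)
        then show ?thesis using False by simp
      qed
      have "(\<Sum>y\<in>Y. z (y, 1) * e y g) = (\<Sum>y\<in>Y. if y = y0 then z g else 0)"
        by (rule sum.cong[OF refl summand])
      then show ?thesis using y0(1) fin by simp
    next
      case False
      then have "z g = 0" using z g unfolding finite_level_def by blast
      moreover have "e y g = 0" if "y \<in> Y" for y
      proof (rule ccontr)
        assume "e y g \<noteq> 0"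
        then have "a = 1" "x - y \<in> M" by (auto simp: e_def g split: if_splits)
        moreover have "of_nat N * y \<in> M" using Y(2) that by blast
        ultimately have "of_nat N * y + of_nat N * (x - y) \<in> M" using add_M mult_M[OF of_nat_M] by blast
        then have "of_nat N * x \<in> M" by (simp add: right_diff_distrib)
        then show False using False \<open>a = 1\<close> by blast
      qed
      ultimately show ?thesis by simp
    qed
  qed
  define C where "C = (\<Sum>y\<in>Y. q (e y))"
  have bound: "q z \<le> C * cross_norm z" if z: "z \<in> finite_level N" for z
  proof -
    have zH: "z \<in> carrier HA" using z by (simp add: finite_level_def)
    have "q (\<lambda>g. \<Sum>y\<in>Y. z (y, 1) * e y g) \<le> (\<Sum>y\<in>Y. cmod (z (y, 1)) * q (e y))"
      using HA_seminorm_sum[OF q fin, of e "\<lambda>y. z (y, 1)"] e by blast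
    also have "\<dots> \<le> (\<Sum>y\<in>Y. cross_norm z * q (e y))"
      by (intro sum_mono mult_right_mono coefficient_le_cross_norm zH q_nonneg e)
    also have "\<dots> = C * cross_norm z" by (simp add: C_def sum_distrib_left mult.commute)
    finally show ?thesis using decomp[OF z] by simp
  qed
  show ?thesis
  proof (rule polynomial_growth_root[where C = C and m = 0])
    show "0 \<le> q f" by (rule q_nonneg[OF f])
    show "0 \<le> cross_norm f" by (rule cross_norm_nonneg[OF f])
    show "q f ^ 2 ^ Suc k \<le> C * (2 ^ k + 1) ^ 0 * cross_norm f ^ 2 ^ Suc k" for k
      using bound[OF finite_level_iter_sq[OF fN, of k]] seminorm_iter_sq[OF f, of k] cross_norm_iter_sq[OF f, of k] by simp
  qed
qed

definition component :: "('k \<times> 'k \<Rightarrow> complex) \<Rightarrow> 'k \<Rightarrow> 'k \<times> 'k \<Rightarrow> complex" where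
  "component f a = (\<lambda>(x, b). if b = a then f (x, b) else 0)"

lemma component_closed:
  assumes f: "f \<in> carrier HA" shows "component f a \<in> carrier HA"
  unfolding HA_carrier_iff
proof (intro conjI allI impI)
  show "component f a (x, 0) = 0" for x using HA_zero_degree[OF f] by (simp add: component_def)
  show "finite (degrees (component f a))"
    by (rule finite_subset[of _ "{a}"]) (auto simp: degrees_def component_def)
  show "lattice_periodic b (slice (component f a) b)" if "b \<noteq> 0" for b
    using HA_lattice_periodic[OF f that] lattice_periodic_zero by (cases "b = a") (auto simp: component_def)
qed

text \<open>
  If \<open>c\<close> is homogeneous, then \<open>c\<^sup>\<star> c\<close> has degree 1, and \<open>q (c)\<^sup>2 = q (c\<^sup>\<star> c)\<close>.
\<close>

lemma seminorm_component_le: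
  assumes q: "cstar_seminorm HA q" and f: "f \<in> carrier HA" and a: "a \<noteq> 0"
  shows "q (component f a) \<le> cross_norm f"
proof -
  interpret seminormed_star_algebra HA q by (rule seminormed_star_algebraI[OF HA_star_algebra q])
  let ?c = "component f a"
  note c = component_closed[OF f, of a]
  note cs' = HA_star_closed[OF c]
  have "degrees (?c\<^sup>\<star>\<^bsub>HA\<^esub> \<boxtimes>\<^bsub>HA\<^esub> ?c) \<subseteq> {1}"
  proof
    fix d assume "d \<in> degrees (?c\<^sup>\<star>\<^bsub>HA\<^esub> \<boxtimes>\<^bsub>HA\<^esub> ?c)"
    then obtain x where "(?c\<^sup>\<star>\<^bsub>HA\<^esub> \<boxtimes>\<^bsub>HA\<^esub> ?c) (x, d) \<noteq> 0" by (auto simp: degrees_def)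
    from HA_times_nonzero[OF cs' c this] obtain y b
      where b: "b \<noteq> 0" "(?c\<^sup>\<star>\<^bsub>HA\<^esub>) (y, b) \<noteq> 0" "?c ((x - y) / b, d / b) \<noteq> 0" by blast
    have "?c (- y / b, 1 / b) \<noteq> 0" using HA_star_nonzero[OF b(2)] by blast
    then have "1 / b = a" "d / b = a" using b(3) by (auto simp: component_def split: if_splits)
    then show "d \<in> {1}" using b(1) by (auto simp: field_simps)
  qed
  then have "q (?c\<^sup>\<star>\<^bsub>HA\<^esub> \<boxtimes>\<^bsub>HA\<^esub> ?c) \<le> cross_norm (?c\<^sup>\<star>\<^bsub>HA\<^esub> \<boxtimes>\<^bsub>HA\<^esub> ?c)"
    by (intro seminorm_le_degree_one q HA_times_closed cs' c)
  then have "(q ?c)\<^sup>2 \<le> (cross_norm ?c)\<^sup>2"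
    using q_cstar[OF c] cross_norm_seminorm c by (simp add: cstar_seminorm_def)
  then have "q ?c \<le> cross_norm ?c" by (rule power2_le_imp_le[OF _ cross_norm_nonneg[OF c]])
  also have "cross_norm ?c \<le> cross_norm f"
    unfolding cross_norm_def
  proof (rule cs.env_norm_homogeneous_le[OF transform_closed[OF c], of "(0, 1 / a)"])
    have "degrees ?c \<subseteq> {a}" by (auto simp: degrees_def component_def)
    then show "{g. transform ?c g \<noteq> (\<lambda>y. 0)} \<subseteq> {(0, 1 / a)}" using supp_transform[OF c] by blast
    show "(0, 1 / a) \<in> carrier affine_group" using a by simp
    have "transform ?c (0, 1 / a) = transform f (0, 1 / a)" by (simp add: transform_def component_def fun_eq_iff)
    then show "cmod (transform ?c (0, 1 / a) y) \<le> env_norm cs.CA (transform f)" for y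
      using cs.coeff_le_env_norm[OF transform_closed[OF f]] by simp
  qed
  finally show ?thesis .
qed

lemma seminorm_le_card_degrees:
  assumes q: "cstar_seminorm HA q" and f: "f \<in> carrier HA"
  shows "q f \<le> card (degrees f) * cross_norm f"
proof -
  have eq: "f = (\<lambda>g. \<Sum>a\<in>degrees f. 1 * component f a g)"
  proof
    fix g :: "'k \<times> 'k"
    obtain x b where g: "g = (x, b)" by (cases g)
    have "(\<Sum>a\<in>degrees f. 1 * component f a g) = (\<Sum>a\<in>degrees f. if a = b then f g else 0)"
      by (intro sum.cong refl) (auto simp: component_def g)
    also have "\<dots> = f g" using HA_degrees_finite[OF f] by (auto simp: g degrees_def)
    finally show "f g = (\<Sum>a\<in>degrees f. 1 * component f a g)" by simp
  qed
  have "q (\<lambda>g. \<Sum>a\<in>degrees f. 1 * component f a g) \<le> (\<Sum>a\<in>degrees f. cmod 1 * q (component f a))"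
    using HA_seminorm_sum[OF q HA_degrees_finite[OF f], of "component f" "\<lambda>a. 1"] component_closed[OF f] by blast
  then have "q f \<le> (\<Sum>a\<in>degrees f. cmod 1 * q (component f a))" unfolding eq[symmetric] .
  also have "\<dots> \<le> (\<Sum>a\<in>degrees f. cross_norm f)"
    using seminorm_component_le[OF q f] degrees_nonzero[OF f] by (intro sum_mono) simp
  finally show ?thesis by simp
qed

text \<open>
  The exponents are taken to be \<open>undefined\<close> outside \<open>S\<close> in order to have finitely many of them.
\<close>

definition monomials :: "'k set \<Rightarrow> nat \<Rightarrow> 'k set" where
  "monomials S n = (\<lambda>e. \<Prod>s\<in>S. s ^ e s) ` (S \<rightarrow>\<^sub>E {..n})"

lemma card_monomials: "finite S \<Longrightarrow> card (monomials S n) \<le> (n + 1) ^ card S"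
  using card_image_le[of "S \<rightarrow>\<^sub>E {..n}" "\<lambda>e. \<Prod>s\<in>S. s ^ e s"] finite_PiE[of S "\<lambda>_. {..n}"]
  by (simp add: monomials_def card_PiE)

lemma finite_monomials: "finite S \<Longrightarrow> finite (monomials S n)"
  by (simp add: monomials_def finite_PiE)

lemma monomials_base: assumes S: "finite S" shows "S \<subseteq> monomials S 1"
proof
  fix x assume x: "x \<in> S"
  let ?e = "\<lambda>s\<in>S. if s = x then 1 else 0 :: nat"
  have "(\<Prod>s\<in>S. s ^ ?e s) = (\<Prod>s\<in>S. if s = x then x else 1)" by (intro prod.cong) auto
  also have "\<dots> = x" using S x by simp
  finally show "x \<in> monomials S 1" unfolding monomials_def by (intro image_eqI[of _ _ ?e]) auto
qed

lemma monomials_times: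
  assumes "x \<in> monomials S n" "y \<in> monomials S n" shows "x * y \<in> monomials S (2 * n)"
proof -
  obtain d e where de: "d \<in> S \<rightarrow>\<^sub>E {..n}" "e \<in> S \<rightarrow>\<^sub>E {..n}" "x = (\<Prod>s\<in>S. s ^ d s)" "y = (\<Prod>s\<in>S. s ^ e s)"
    using assms by (auto simp: monomials_def)
  let ?e = "\<lambda>s\<in>S. d s + e s"
  have "d s + e s \<le> 2 * n" if "s \<in> S" for s
    using PiE_mem[OF de(1) that] PiE_mem[OF de(2) that] by simp
  then have "?e \<in> S \<rightarrow>\<^sub>E {..2 * n}" by auto
  moreover have "x * y = (\<Prod>s\<in>S. s ^ ?e s)"
    unfolding de(3,4) prod.distrib[symmetric] by (intro prod.cong) (auto simp: power_add)
  ultimately show ?thesis unfolding monomials_def by blast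
qed

text \<open>
  The degrees of \<open>(f\<^sup>\<star> f)\<^bsup>m\<^esup>\<close> are monomials in the finitely many degrees of \<open>f\<^sup>\<star> f\<close> with exponents at
  most \<open>m\<close>, because \<open>K\<^sup>\<times>\<close> is commutative; so there are only polynomially many in \<open>m\<close>.
\<close>

theorem seminorm_le_cross_norm:
  assumes q: "cstar_seminorm HA q" and f: "f \<in> carrier HA"
  shows "q f \<le> cross_norm f"
proof -
  interpret seminormed_star_algebra HA q by (rule seminormed_star_algebraI[OF HA_star_algebra q])
  define S where "S = degrees (iter_sq HA f 0)"
  have S: "finite S" unfolding S_def using f by (intro HA_degrees_finite iter_sq_closed)
  have deg: "degrees (iter_sq HA f k) \<subseteq> monomials S (2 ^ k)" for k
  proof (induction k)
    case 0 then show ?case using monomials_base[OF S] by (simp add: S_def)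
  next
    case (Suc k)
    have z: "iter_sq HA f k \<in> carrier HA" using f by (rule iter_sq_closed)
    show ?case
    proof
      fix a assume "a \<in> degrees (iter_sq HA f (Suc k))"
      then obtain b c where "b \<in> degrees (iter_sq HA f k)" "c \<in> degrees (iter_sq HA f k)" "a = b * c"
        using degrees_times[OF z z] by auto
      then show "a \<in> monomials S (2 ^ Suc k)" using Suc monomials_times[of b S "2 ^ k" c] by auto
    qed
  qed
  show ?thesis
  proof (rule polynomial_growth_root[where C = 1 and m = "card S"])
    show "0 \<le> q f" by (rule q_nonneg[OF f])
    show "0 \<le> cross_norm f" by (rule cross_norm_nonneg[OF f])
    fix k
    have z: "iter_sq HA f k \<in> carrier HA" using f by (rule iter_sq_closed)
    have "card (degrees (iter_sq HA f k)) \<le> (2 ^ k + 1) ^ card S"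
      using card_mono[OF finite_monomials[OF S] deg] card_monomials[OF S, of "2 ^ k"] by (rule order_trans)
    then have "real (card (degrees (iter_sq HA f k))) \<le> real ((2 ^ k + 1) ^ card S)" by (rule of_nat_mono)
    then have c: "real (card (degrees (iter_sq HA f k))) \<le> (2 ^ k + 1) ^ card S" by (simp add: add.commute)
    have "q f ^ 2 ^ Suc k \<le> card (degrees (iter_sq HA f k)) * cross_norm f ^ 2 ^ Suc k"
      using seminorm_le_card_degrees[OF q z] seminorm_iter_sq[OF f] cross_norm_iter_sq[OF f] by simp
    also have "\<dots> \<le> (2 ^ k + 1) ^ card S * cross_norm f ^ 2 ^ Suc k"
      by (intro mult_right_mono c zero_le_power cross_norm_nonneg f)
    finally show "q f ^ 2 ^ Suc k \<le> 1 * (2 ^ k + 1) ^ card S * cross_norm f ^ 2 ^ Suc k" by simp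
  qed
qed

subsection \<open>The embedding\<close>

theorem hecke_cstar_embeds:
  "\<exists>\<phi>. star_hom (hecke_cstar affine_group (transl M))
      (corner (full_crossed_product affine_group (coset_algebra M) aff_alpha)
        (i_D affine_group (coset_algebra M) aff_alpha (indicator M))) \<phi> \<and>
    inj_on \<phi> (carrier (hecke_cstar affine_group (transl M)))"
proof -
  have fin: "env_finite HA"
    unfolding env_finite_def using seminorm_le_cross_norm by (auto intro!: bdd_aboveI)
  have iso: "env_norm cs.CA (transform f) = env_norm HA f" if f: "f \<in> carrier HA" for f
  proof (rule antisym)
    show "env_norm cs.CA (transform f) \<le> env_norm HA f"
      using env_norm_upper[OF fin cross_norm_seminorm f] by (simp add: cross_norm_def)
    show "env_norm HA f \<le> env_norm cs.CA (transform f)"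
      using seminorm_le_cross_norm[OF _ f] by (intro env_norm_least) (simp add: cross_norm_def)
  qed
  let ?p = "cs.homogeneous (0, 1) (indicator M)"
  have ind: "indicator M \<in> coset_algebra M" using indicator_coset_algebra[of 1 0 M] by simp
  have p: "?p \<in> carrier cs.CA" by (rule cs.homogeneous_closed[OF ind]) simp
  have "?p \<boxtimes>\<^bsub>cs.CA\<^esub> transform f \<boxtimes>\<^bsub>cs.CA\<^esub> ?p = transform f" if f: "f \<in> carrier HA" for f
  proof -
    note t = transform_closed[OF f]
    have "?p \<boxtimes>\<^bsub>cs.CA\<^esub> transform f = (\<lambda>g t. indicator M t * transform f g t)"
      using cs.homogeneous_one_times(1)[OF ind t] by simp
    also have "\<dots> = transform f"
    proof (intro ext)
      fix g t
      show "indicator M t * transform f g t = transform f g t"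
      proof (cases "transform f g t = 0")
        case False
        then have "snd g \<noteq> 0" "fourier (1 / snd g) (slice f (1 / snd g)) t \<noteq> 0"
          by (auto simp: transform_def split: if_splits)
        then have "t \<in> M" using fourier_support(1)[OF _ HA_lattice_periodic[OF f], of "1 / snd g" t] by simp
        then show ?thesis by simp
      qed simp
    qed
    finally have "?p \<boxtimes>\<^bsub>cs.CA\<^esub> transform f \<boxtimes>\<^bsub>cs.CA\<^esub> ?p = transform f \<boxtimes>\<^bsub>cs.CA\<^esub> ?p" by simp
    also have "\<dots> = (\<lambda>g t. transform f g t * indicator M (aff_act (inv\<^bsub>affine_group\<^esub> g) t))"
      using cs.homogeneous_one_times(2)[OF ind t] by simp
    also have "\<dots> = transform f"
    proof (intro ext)
      fix g t
      show "transform f g t * indicator M (aff_act (inv\<^bsub>affine_group\<^esub> g) t) = transform f g t"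
      proof (cases "transform f g t = 0")
        case False
        then have g: "fst g = 0" "snd g \<noteq> 0" "fourier (1 / snd g) (slice f (1 / snd g)) t \<noteq> 0"
          by (auto simp: transform_def split: if_splits)
        then have "1 / snd g * t \<in> M" using fourier_support(2)[OF _ HA_lattice_periodic[OF f], of "1 / snd g" t] by simp
        moreover have "aff_act (inv\<^bsub>affine_group\<^esub> g) t = 1 / snd g * t"
          using g by (cases g) (simp add: aff_act_def)
        ultimately show ?thesis by simp
      qed simp
    qed
    finally show ?thesis .
  qed
  note pp = this
  have \<alpha>: "aff_alpha = (\<lambda>g f. f \<circ> aff_act (inv\<^bsub>affine_group\<^esub> g))"
    by (intro ext) (simp add: aff_alpha_def)
  show ?thesis
    unfolding hecke_cstar_def full_crossed_product_def i_D_def \<alpha>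
    using env_cstar_embeds_corner[OF HA_star_algebra fin cs.CA_star_algebra cs.CA_env_finite
        transform_star_hom iso p pp]
    by (simp add: cs.homogeneous_def[abs_def])
qed

end

section \<open>The order generated by an algebraic integer\<close>

definition eval_rat :: "'k::field_char_0 \<Rightarrow> rat poly \<Rightarrow> 'k" where
  "eval_rat \<theta> r = poly (map_poly of_rat r) \<theta>"

definition eval_int :: "'k::field_char_0 \<Rightarrow> int poly \<Rightarrow> 'k" where
  "eval_int \<theta> p = eval_rat \<theta> (map_poly of_int p)"

lemma eval_int_eq: "eval_int \<theta> p = poly (map_poly of_int p) \<theta>"
  by (simp add: eval_int_def eval_rat_def map_poly_map_poly comp_def)

lemma eval_rat_add: "eval_rat \<theta> (p + q) = eval_rat \<theta> p + eval_rat \<theta> q"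
proof -
  have "map_poly of_rat (p + q) = (map_poly of_rat p + map_poly of_rat q :: 'a poly)"
    by (rule poly_eqI) (simp add: coeff_map_poly of_rat_add)
  then show ?thesis by (simp add: eval_rat_def)
qed

lemma eval_rat_mult: "eval_rat \<theta> (p * q) = eval_rat \<theta> p * eval_rat \<theta> q"
proof -
  have "map_poly of_rat (p * q) = (map_poly of_rat p * map_poly of_rat q :: 'a poly)"
    by (rule poly_eqI) (simp add: coeff_map_poly coeff_mult of_rat_sum of_rat_mult)
  then show ?thesis by (simp add: eval_rat_def)
qed

lemma eval_rat_const: "eval_rat \<theta> [:c:] = of_rat c"
  by (simp add: eval_rat_def map_poly_pCons)

lemma eval_rat_smult: "eval_rat \<theta> (smult c p) = of_rat c * eval_rat \<theta> p"
  using eval_rat_mult[of \<theta> "[:c:]" p] by (simp add: eval_rat_const)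

lemma eval_rat_0 [simp]: "eval_rat \<theta> 0 = 0"
  by (simp add: eval_rat_def)

lemma eval_rat_diff: "eval_rat \<theta> (p - q) = eval_rat \<theta> p - eval_rat \<theta> q"
  using eval_rat_add[of \<theta> "p - q" q] by simp

lemma eval_rat_monom: "eval_rat \<theta> (monom c i) = of_rat c * \<theta> ^ i"
  by (simp add: eval_rat_def map_poly_monom poly_monom)

lemma of_int_poly_add: "map_poly of_int (p + q) = (map_poly of_int p + map_poly of_int q :: 'a::comm_ring_1 poly)"
  and of_int_poly_diff: "map_poly of_int (p - q) = (map_poly of_int p - map_poly of_int q :: 'a::comm_ring_1 poly)"
  and of_int_poly_smult: "map_poly of_int (smult c p) = (smult (of_int c) (map_poly of_int p) :: 'a::comm_ring_1 poly)"
  by (rule poly_eqI; simp add: coeff_map_poly)+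

lemma of_int_poly_mult: "map_poly of_int (p * q) = (map_poly of_int p * map_poly of_int q :: 'a::comm_ring_1 poly)"
  by (rule poly_eqI) (simp add: coeff_map_poly coeff_mult)

lemma eval_int_add: "eval_int \<theta> (p + q) = eval_int \<theta> p + eval_int \<theta> q"
  and eval_int_diff: "eval_int \<theta> (p - q) = eval_int \<theta> p - eval_int \<theta> q"
  and eval_int_mult: "eval_int \<theta> (p * q) = eval_int \<theta> p * eval_int \<theta> q"
  and eval_int_smult: "eval_int \<theta> (smult c p) = of_int c * eval_int \<theta> p"
  by (simp_all add: eval_int_def of_int_poly_add of_int_poly_diff of_int_poly_mult of_int_poly_smult
      eval_rat_add eval_rat_diff eval_rat_mult eval_rat_smult)

lemma eval_int_1: "eval_int \<theta> 1 = 1"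
  by (simp add: eval_int_eq)

lemma Z_adjoin_eq: "Z_adjoin \<theta> = range (eval_int \<theta>)"
  by (simp add: Z_adjoin_def eval_int_eq)

lemma clear_denominators:
  fixes r :: "rat poly"
  shows "\<exists>m::nat. 0 < m \<and> (\<exists>p. smult (of_nat m) r = map_poly of_int p)"
proof (induction r rule: pCons_induct)
  case 0 then show ?case by (intro exI[of _ 1] conjI exI[of _ 0]) auto
next
  case (pCons a r)
  then obtain m :: nat and p where m: "0 < m" "smult (of_nat m) r = map_poly of_int p" by blast
  obtain x y where xy: "a = of_int x / of_int y" "0 < (y::int)" by (metis quotient_of_div quotient_of_denom_pos surj_pair)
  define d where "d = nat y"
  have d: "0 < d" "(of_nat d :: rat) = of_int y" using xy(2) by (simp_all add: d_def)
  have "smult (of_nat (m * d)) (pCons a r) = pCons (of_nat m * of_int x) (smult (of_int y) (smult (of_nat m) r))"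
    using xy d by (simp add: mult.commute)
  also have "\<dots> = map_poly of_int (pCons (int m * x) (smult y p))"
    by (simp add: m(2) map_poly_pCons of_int_poly_smult)
  finally show ?case using m d by (intro exI[of _ "m * d"]) auto
qed

text \<open>
  Gauss's lemma: a primitive integral polynomial of least degree that annihilates \<open>\<theta>\<close> divides every
  monic one over the integers, so its leading coefficient is a unit.
\<close>

lemma integral_minimal_polynomial:
  fixes \<theta> :: "'k::field_char_0"
  assumes "algebraic_int \<theta>"
  obtains P :: "int poly" where "lead_coeff P = 1" "eval_int \<theta> P = 0"
    "\<And>r. eval_rat \<theta> r = 0 \<Longrightarrow> r \<noteq> 0 \<Longrightarrow> degree P \<le> degree r"
proof -
  obtain Q where Q: "eval_int \<theta> Q = 0" "lead_coeff Q = 1"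
    using assms by (auto simp: algebraic_int_altdef_ipoly eval_int_eq)
  then have "Q \<noteq> 0" by auto
  with Q(1) obtain p0 where p0: "p0 \<noteq> 0" "eval_int \<theta> p0 = 0"
    "\<And>p. p \<noteq> 0 \<Longrightarrow> eval_int \<theta> p = 0 \<Longrightarrow> degree p0 \<le> degree p"
    using exists_least_iff[of "\<lambda>d. \<exists>p. p \<noteq> 0 \<and> eval_int \<theta> p = 0 \<and> degree p = d"]
    by (metis not_le)
  define p where "p = primitive_part p0"
  have pc: "p0 = smult (content p0) p" by (simp add: p_def)
  have "of_int (content p0) * eval_int \<theta> p = 0"
    using p0(2) pc eval_int_smult[of \<theta> "content p0" p] by simp
  then have p1: "eval_int \<theta> p = 0" using p0(1) by simp
  have p: "p \<noteq> 0" "degree p = degree p0" "content p = 1" using p0(1) by (simp_all add: p_def)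
  obtain a q where aq: "a \<noteq> 0" "smult a Q = p * q + pseudo_mod Q p" using pseudo_mod(1)[OF p(1)] by blast
  have "eval_int \<theta> (pseudo_mod Q p) = 0"
    using arg_cong[OF aq(2), of "eval_int \<theta>"] Q(1) p1 by (simp add: eval_int_add eval_int_mult eval_int_smult)
  then have "pseudo_mod Q p = 0" using pseudo_mod(2)[OF p(1), of Q] p0(3) p(2) by fastforce
  then have pq: "smult a Q = p * q" using aq(2) by simp
  have "content Q dvd lead_coeff Q" by (rule content_dvd_coeff)
  then have "content Q = 1" using Q(2) by (metis is_unit_normalize normalize_content)
  then have "normalize a = content q" using arg_cong[OF pq, of content] p(3) by (simp add: content_mult)
  then have "a dvd content q" by (metis dvd_normalize_iff dvd_refl)
  then have "[:a:] dvd q" by (simp add: const_poly_dvd_iff_dvd_content)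
  then obtain q' where "q = [:a:] * q'" by (rule dvdE)
  then have "smult a Q = smult a (p * q')" using pq by simp
  then have "Q = p * q'" using aq(1) by (metis smult_cancel)
  then have "lead_coeff p * lead_coeff q' = 1" using Q(2) by (simp add: lead_coeff_mult)
  then have lc: "lead_coeff p = 1 \<or> lead_coeff p = -1" by (auto simp: zmult_eq_1_iff)
  define P where "P = smult (lead_coeff p) p"
  show thesis
  proof (rule that)
    show "lead_coeff P = 1" using lc by (auto simp: P_def)
    show "eval_int \<theta> P = 0" by (simp add: P_def eval_int_smult p1)
    fix r assume r: "eval_rat \<theta> r = 0" "r \<noteq> 0"
    obtain m :: nat and s where m: "0 < m" "smult (of_nat m) r = map_poly of_int s" using clear_denominators by blast
    have "eval_int \<theta> s = 0" using r by (simp add: eval_int_def m(2)[symmetric] eval_rat_smult)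
    moreover have "s \<noteq> 0" using m r by auto
    ultimately have "degree p0 \<le> degree s" by (rule p0(3)[rotated])
    also have "degree s = degree (map_poly of_int s :: rat poly)" by (rule degree_map_poly[symmetric]) auto
    also have "\<dots> = degree r" using m by (simp flip: m(2))
    finally show "degree P \<le> degree r" using lc p(2) by (auto simp: P_def)
  qed
qed

text \<open>
  \<open>P\<close> is the minimal polynomial of \<open>\<theta>\<close>, so that \<open>1, \<theta>, \<dots>, \<theta>\<^sup>n\<^sup>-\<^sup>1\<close> is a basis of \<open>K\<close> over \<open>\<rat>\<close> and of
  \<open>\<int>[\<theta>]\<close> over \<open>\<int>\<close>.
\<close>

locale power_basis =
  fixes \<theta> :: "'k::field_char_0" and P :: "int poly"
  assumes monic: "lead_coeff P = 1" and root: "eval_int \<theta> P = 0"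
    and minimal: "\<And>r. eval_rat \<theta> r = 0 \<Longrightarrow> r \<noteq> 0 \<Longrightarrow> degree P \<le> degree r"
    and generates: "Q_adjoin \<theta> = UNIV"
begin

abbreviation "n \<equiv> degree P"

text \<open>
  Degree less than \<open>n\<close>, with the zero polynomial included.
\<close>

definition small :: "'a::zero poly \<Rightarrow> bool" where
  "small r \<longleftrightarrow> (\<forall>i\<ge>n. coeff r i = 0)"

lemma n_pos: "0 < n"
proof (rule ccontr)
  assume "\<not> 0 < n"
  then have "P = 1" using monic by (metis degree_eq_zeroE gr0I lead_coeff_pCons(2) one_pCons)
  then show False using root by (simp add: eval_int_1)
qed

lemma small_degree: "r = 0 \<or> degree r < n \<Longrightarrow> small r"
  by (auto simp: small_def coeff_eq_0)

lemma small_unique: assumes "small r" "small s" "eval_rat \<theta> r = eval_rat \<theta> s" shows "r = s"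
proof (rule ccontr)
  assume "r \<noteq> s"
  then have "n \<le> degree (r - s)" using assms(3) by (intro minimal) (simp_all add: eval_rat_diff)
  then have "coeff (r - s) (degree (r - s)) = 0" using assms by (simp add: small_def)
  then show False using \<open>r \<noteq> s\<close> by (metis eq_iff_diff_eq_0 leading_coeff_0_iff)
qed

text \<open>
  A denominator \<open>q(\<theta>) \<noteq> 0\<close> is inverted by Bezout's identity, for \<open>q\<close> and \<open>P\<close> are coprime by the
  minimality of \<open>P\<close>.
\<close>

lemma rational_poly_representation: "\<exists>w. x = eval_rat \<theta> w"
proof -
  let ?P = "map_poly of_int P :: rat poly"
  obtain p q where pq: "x = eval_rat \<theta> p / eval_rat \<theta> q" "eval_rat \<theta> q \<noteq> 0"
    using generates unfolding Q_adjoin_def eval_rat_def by blast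
  define g where "g = gcd q ?P"
  obtain u v where uv: "u * q + v * ?P = g" unfolding g_def by (metis bezout_coefficients_fst_snd)
  have P0: "eval_rat \<theta> ?P = 0" using root by (simp add: eval_int_def)
  have g: "eval_rat \<theta> u * eval_rat \<theta> q = eval_rat \<theta> g" unfolding uv[symmetric] by (simp add: eval_rat_add eval_rat_mult P0)
  obtain k where k: "q = g * k" unfolding g_def by (metis dvdE gcd_dvd1)
  have g0: "eval_rat \<theta> g \<noteq> 0" using pq(2) by (auto simp: k eval_rat_mult)
  obtain h where h: "?P = g * h" unfolding g_def by (metis dvdE gcd_dvd2)
  have Pn: "?P \<noteq> 0" "degree ?P = n" using n_pos by (auto simp: degree_map_poly dest: arg_cong[of _ _ degree])
  have h0: "h \<noteq> 0" "g \<noteq> 0" using Pn h by auto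
  have "eval_rat \<theta> h = 0" using P0 g0 by (simp add: h eval_rat_mult)
  then have "n \<le> degree h" using h0 by (intro minimal)
  moreover have "n = degree g + degree h" using Pn h0 h by (metis degree_mult_eq)
  ultimately have "degree g = 0" by simp
  then obtain c where c: "g = [:c:]" by (rule degree_eq_zeroE)
  then have c0: "(of_rat c :: 'k) \<noteq> 0" using g0 by (simp add: eval_rat_const)
  have "eval_rat \<theta> u * eval_rat \<theta> q = of_rat c" using g c by (simp add: eval_rat_const)
  moreover have "x * eval_rat \<theta> q = eval_rat \<theta> p" using pq by simp
  ultimately have "x * of_rat c = eval_rat \<theta> p * eval_rat \<theta> u" by (metis mult.assoc mult.commute)
  then have "x = of_rat (1 / c) * (eval_rat \<theta> p * eval_rat \<theta> u)"
    using c0 by (simp add: of_rat_divide field_simps)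
  then show ?thesis by (intro exI[of _ "smult (1 / c) (p * u)"]) (simp add: eval_rat_smult eval_rat_mult)
qed

lemma small_representation: "\<exists>r. small r \<and> eval_rat \<theta> r = x"
proof -
  let ?P = "map_poly of_int P :: rat poly"
  obtain w where w: "x = eval_rat \<theta> w" using rational_poly_representation by blast
  have P0: "eval_rat \<theta> ?P = 0" using root by (simp add: eval_int_def)
  have Pn: "?P \<noteq> 0" "degree ?P = n" using n_pos by (auto simp: degree_map_poly dest: arg_cong[of _ _ degree])
  have "eval_rat \<theta> (w mod ?P) = x"
    using arg_cong[OF div_mult_mod_eq[of w ?P], of "eval_rat \<theta>"] w by (simp add: eval_rat_add eval_rat_mult P0)
  moreover have "small (w mod ?P)" using degree_mod_less[OF Pn(1), of w] Pn(2) by (intro small_degree) auto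
  ultimately show ?thesis by blast
qed

lemma small_int_representation: "\<exists>r. small r \<and> eval_int \<theta> r = eval_int \<theta> p"
proof -
  have P: "P \<noteq> 0" using n_pos by auto
  obtain q r where qr: "pseudo_divmod p P = (q, r)" by (cases "pseudo_divmod p P")
  have "p = P * q + r" "r = 0 \<or> degree r < n" using pseudo_divmod[OF P qr] monic by simp_all
  then show ?thesis using root by (intro exI[of _ r]) (simp add: small_degree eval_int_add eval_int_mult)
qed

definition rep_poly :: "'k \<Rightarrow> rat poly" where
  "rep_poly x = (SOME r. small r \<and> eval_rat \<theta> r = x)"

text \<open>
  Euler's functional \<open>x \<mapsto> Tr (x / P'(\<theta>))\<close>.
\<close>

definition top_coeff :: "'k \<Rightarrow> rat" where
  "top_coeff x = coeff (rep_poly x) (n - 1)"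

lemma rep_poly: "small (rep_poly x)" "eval_rat \<theta> (rep_poly x) = x"
  using someI_ex[OF small_representation[of x]] by (simp_all add: rep_poly_def)

lemma rep_poly_eval: "small r \<Longrightarrow> rep_poly (eval_rat \<theta> r) = r"
  using small_unique[OF rep_poly(1)] rep_poly(2) by blast

lemma top_coeff_eval: "small r \<Longrightarrow> top_coeff (eval_rat \<theta> r) = coeff r (n - 1)"
  by (simp add: top_coeff_def rep_poly_eval)

lemma top_coeff_add: "top_coeff (x + y) = top_coeff x + top_coeff y"
proof -
  have "small (rep_poly x + rep_poly y)" using rep_poly(1) by (simp add: small_def)
  from top_coeff_eval[OF this] show ?thesis by (simp add: eval_rat_add rep_poly(2)) (simp add: top_coeff_def)
qed

lemma Z_adjoin_small: "x \<in> Z_adjoin \<theta> \<Longrightarrow> \<exists>r. small r \<and> x = eval_int \<theta> r"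
  using small_int_representation by (metis Z_adjoin_eq imageE)

lemma top_coeff_Z_adjoin: "x \<in> Z_adjoin \<theta> \<Longrightarrow> top_coeff x \<in> \<int>"
proof -
  assume "x \<in> Z_adjoin \<theta>"
  then obtain r where r: "small r" "x = eval_int \<theta> r" using Z_adjoin_small by blast
  then have "small (map_poly of_int r :: rat poly)" by (simp add: small_def coeff_map_poly)
  from top_coeff_eval[OF this] show ?thesis by (simp add: r eval_int_def coeff_map_poly)
qed

lemma Z_adjoin_mult: "x \<in> Z_adjoin \<theta> \<Longrightarrow> y \<in> Z_adjoin \<theta> \<Longrightarrow> x * y \<in> Z_adjoin \<theta>"
  unfolding Z_adjoin_eq by (auto simp: eval_int_mult[symmetric])

lemma Z_adjoin_diff: "x \<in> Z_adjoin \<theta> \<Longrightarrow> y \<in> Z_adjoin \<theta> \<Longrightarrow> x - y \<in> Z_adjoin \<theta>"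
  unfolding Z_adjoin_eq by (auto simp: eval_int_diff[symmetric])

lemma Z_adjoin_monom: "of_int c * \<theta> ^ i \<in> Z_adjoin \<theta>"
  unfolding Z_adjoin_eq by (rule image_eqI[of _ _ "monom c i"]) (simp_all add: eval_int_eq map_poly_monom poly_monom)

text \<open>
  If \<open>k\<close> is the largest exponent in \<open>x = r(\<theta>)\<close>, then \<open>x \<theta>\<^sup>j\<close> for \<open>j = n - 1 - k\<close> still has degree at most
  \<open>n - 1\<close> and its top coefficient is the leading coefficient of \<open>r\<close>.  So that one is integral and can be
  subtracted.
\<close>

lemma top_coeff_dual_bounded:
  assumes "k \<le> n" "\<And>i. k \<le> i \<Longrightarrow> coeff r i = 0" "\<And>j. top_coeff (eval_rat \<theta> r * \<theta> ^ j) \<in> \<int>"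
  shows "eval_rat \<theta> r \<in> Z_adjoin \<theta>"
  using assms
proof (induction k arbitrary: r)
  case 0
  then have "r = 0" by (intro poly_eqI) simp
  then show ?case using Z_adjoin_monom[of 0 0] by simp
next
  case (Suc k)
  define j where "j = n - 1 - k"
  have jk: "j + k = n - 1" "j + Suc k = n" using Suc(2) by (simp_all add: j_def)
  let ?w = "monom 1 j * r"
  have "coeff ?w i = 0" if "n \<le> i" for i
    using Suc(3)[of "i - j"] that jk by (simp add: coeff_monom_mult)
  then have "small ?w" by (simp add: small_def)
  from top_coeff_eval[OF this] have "top_coeff (eval_rat \<theta> r * \<theta> ^ j) = coeff ?w (n - 1)"
    by (simp add: eval_rat_mult eval_rat_monom mult.commute)
  also have "\<dots> = coeff r k" proof -
    have "n - Suc j = k" using jk by simp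
    then show ?thesis using jk by (simp add: coeff_monom_mult)
  qed
  finally obtain c where c: "coeff r k = of_int c" using Suc(4)[of j] by (metis Ints_cases)
  let ?r = "r - monom (of_int c) k"
  have ev: "eval_rat \<theta> ?r = eval_rat \<theta> r - of_int c * \<theta> ^ k" by (simp add: eval_rat_diff eval_rat_monom)
  have "eval_rat \<theta> ?r \<in> Z_adjoin \<theta>"
  proof (rule Suc.IH)
    show "k \<le> n" using Suc(2) by simp
    show "coeff ?r i = 0" if "k \<le> i" for i
      using Suc(3)[of i] that c by (cases "i = k") auto
    fix j
    have "of_int c * \<theta> ^ (k + j) \<in> Z_adjoin \<theta>" by (rule Z_adjoin_monom)
    then have "top_coeff (of_int c * \<theta> ^ (k + j)) \<in> \<int>" by (rule top_coeff_Z_adjoin)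
    moreover have "eval_rat \<theta> r * \<theta> ^ j = eval_rat \<theta> ?r * \<theta> ^ j + of_int c * \<theta> ^ (k + j)"
      unfolding ev by (simp add: algebra_simps power_add)
    ultimately show "top_coeff (eval_rat \<theta> ?r * \<theta> ^ j) \<in> \<int>"
      using Suc(4)[of j] top_coeff_add[of "eval_rat \<theta> ?r * \<theta> ^ j" "of_int c * \<theta> ^ (k + j)"]
      by (metis Ints_diff add_diff_cancel_right')
  qed
  then have "eval_rat \<theta> ?r - of_int (- c) * \<theta> ^ k \<in> Z_adjoin \<theta>" using Z_adjoin_monom by (rule Z_adjoin_diff)
  then show ?case by (simp add: ev)
qed

lemma top_coeff_dual: "(\<forall>m\<in>Z_adjoin \<theta>. top_coeff (x * m) \<in> \<int>) \<longleftrightarrow> x \<in> Z_adjoin \<theta>"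
proof
  assume *: "\<forall>m\<in>Z_adjoin \<theta>. top_coeff (x * m) \<in> \<int>"
  have "eval_rat \<theta> (rep_poly x) \<in> Z_adjoin \<theta>"
  proof (rule top_coeff_dual_bounded[OF order_refl])
    show "n \<le> i \<Longrightarrow> coeff (rep_poly x) i = 0" for i using rep_poly(1) by (simp add: small_def)
    show "top_coeff (eval_rat \<theta> (rep_poly x) * \<theta> ^ j) \<in> \<int>" for j
      using * Z_adjoin_monom[of 1 j] by (simp add: rep_poly(2))
  qed
  then show "x \<in> Z_adjoin \<theta>" by (simp add: rep_poly(2))
next
  assume "x \<in> Z_adjoin \<theta>"
  then show "\<forall>m\<in>Z_adjoin \<theta>. top_coeff (x * m) \<in> \<int>"
    by (intro ballI top_coeff_Z_adjoin Z_adjoin_mult)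
qed

definition char :: "'k \<Rightarrow> complex" where
  "char x = cis (2 * pi * of_rat (top_coeff x))"

lemma char_eq_1_iff: "char x = 1 \<longleftrightarrow> top_coeff x \<in> \<int>"
proof
  assume "char x = 1"
  then have "cos (2 * pi * of_rat (top_coeff x)) = 1" unfolding char_def by (metis cis.sel(1) one_complex.sel(1))
  then obtain k :: int where "2 * pi * of_rat (top_coeff x) = of_int k * 2 * pi" by (auto simp: cos_one_2pi_int)
  then have "(of_rat (top_coeff x) :: real) = of_rat (of_int k)" by simp
  then have "top_coeff x = of_int k" by (simp only: of_rat_eq_iff)
  then show "top_coeff x \<in> \<int>" by simp
next
  assume "top_coeff x \<in> \<int>"
  then obtain k :: int where "top_coeff x = of_int k" by (auto elim: Ints_cases)
  then show "char x = 1" by (simp add: char_def cis_multiple_2pi)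
qed

text \<open>
  The character is \<open>x \<mapsto> exp (2 \<pi> \<i> \<tau>(x))\<close> for Euler's functional \<open>\<tau>\<close>, so \<open>char_dual\<close> is \<open>top_coeff_dual\<close>.
\<close>

lemma Z_adjoin_self_dual: "self_dual_order (Z_adjoin \<theta>) char"
proof
  show "1 \<in> Z_adjoin \<theta>" using Z_adjoin_monom[of 1 0] by simp
  show "x - y \<in> Z_adjoin \<theta>" "x * y \<in> Z_adjoin \<theta>" if "x \<in> Z_adjoin \<theta>" "y \<in> Z_adjoin \<theta>" for x y
    using that by (rule Z_adjoin_diff, rule Z_adjoin_mult)
  show "\<exists>n::nat. 0 < n \<and> of_nat n * x \<in> Z_adjoin \<theta>" for x
  proof -
    obtain m :: nat and p where m: "0 < m" "smult (of_nat m) (rep_poly x) = map_poly of_int p" using clear_denominators by blast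
    have "of_nat m * x = eval_int \<theta> p"
      using arg_cong[OF m(2), of "eval_rat \<theta>"] by (simp add: eval_rat_smult rep_poly(2) eval_int_def)
    then show ?thesis using m(1) unfolding Z_adjoin_eq by blast
  qed
  show "char (x + y) = char x * char y" for x y
    by (simp add: char_def top_coeff_add of_rat_add distrib_left cis_mult)
  show "cmod (char x) = 1" for x by (simp add: char_def)
  show "(\<forall>m\<in>Z_adjoin \<theta>. char (x * m) = 1) \<longleftrightarrow> x \<in> Z_adjoin \<theta>" for x
    using top_coeff_dual[of x] by (simp add: char_eq_1_iff)
  fix N :: nat assume N: "0 < N"
  let ?F = "(\<lambda>xs. eval_int \<theta> (Poly xs)) ` {xs. set xs \<subseteq> {0..<int N} \<and> length xs = n}"
  have "finite ?F" by (intro finite_imageI finite_lists_length_eq) simp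
  moreover have "\<exists>y\<in>?F. \<exists>z\<in>Z_adjoin \<theta>. x = y + of_nat N * z" if "x \<in> Z_adjoin \<theta>" for x
  proof -
    from Z_adjoin_small[OF that] obtain r where r: "small r" "x = eval_int \<theta> r" by blast
    let ?xs = "map (\<lambda>i. coeff r i mod int N) [0..<n]" and ?ys = "map (\<lambda>i. coeff r i div int N) [0..<n]"
    have "r = Poly ?xs + smult (int N) (Poly ?ys)"
    proof (rule poly_eqI)
      fix i
      show "coeff r i = coeff (Poly ?xs + smult (int N) (Poly ?ys)) i"
        using r(1) by (cases "i < n") (simp_all add: nth_default_def small_def)
    qed
    then have "eval_int \<theta> r = eval_int \<theta> (Poly ?xs + smult (int N) (Poly ?ys))" by (rule arg_cong)
    then have "x = eval_int \<theta> (Poly ?xs) + of_nat N * eval_int \<theta> (Poly ?ys)"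
      unfolding r(2) by (simp only: eval_int_add eval_int_smult of_int_of_nat_eq)
    moreover have "eval_int \<theta> (Poly ?xs) \<in> ?F" using N by (intro imageI) auto
    ultimately show ?thesis unfolding Z_adjoin_eq by blast
  qed
  ultimately show "\<exists>F. finite F \<and> (\<forall>x\<in>Z_adjoin \<theta>. \<exists>y\<in>F. \<exists>z\<in>Z_adjoin \<theta>. x = y + of_nat N * z)" by blast
qed

end

section \<open>The generalized Bost--Connes algebra\<close>

theorem corollary7p1:
  fixes \<theta> :: "'k::field_char_0"
    and M R :: "'k set"
    and D :: "('k \<Rightarrow> complex) set"
    and p :: "(nat \<Rightarrow> 'k \<times> 'k \<Rightarrow> 'k \<Rightarrow> complex) set"
  defines "R \<equiv> {x. algebraic_int x}"
    and "M \<equiv> Z_adjoin \<theta>"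
    and "D \<equiv> coset_algebra M"
    and "p \<equiv> i_D affine_group D aff_alpha (indicator M)"
  assumes "algebraic_int \<theta>"
    and "Q_adjoin \<theta> = UNIV"
    and "M = R"
  shows "\<exists>\<phi>. star_hom (hecke_cstar affine_group (transl M))
                (corner (full_crossed_product affine_group D aff_alpha) p) \<phi> \<and>
             inj_on \<phi> (carrier (hecke_cstar affine_group (transl M)))"
proof -
  obtain P where P: "lead_coeff P = 1" "eval_int \<theta> P = 0"
    "\<And>r. eval_rat \<theta> r = 0 \<Longrightarrow> r \<noteq> 0 \<Longrightarrow> degree P \<le> degree r"
    using integral_minimal_polynomial[OF \<open>algebraic_int \<theta>\<close>] by blast
  then have "power_basis \<theta> P"
    using \<open>Q_adjoin \<theta> = UNIV\<close> by (intro power_basis.intro) auto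
  from self_dual_order.hecke_cstar_embeds[OF power_basis.Z_adjoin_self_dual[OF this]]
  show ?thesis unfolding M_def D_def p_def .
qed

end
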